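(* Let $0<\epsilon\le 1$. Then for every $v\in\langle\cdot\rangle^{\epsilon-2}L^2(\mathbb{C})$ the solution $u\in\langle\cdot\rangle^{\epsilon}L^2(\mathbb{C})$ of $\overline{\partial}u=v$ (a solution exists for every $\epsilon>0$) is unique.
   Context: For $z=x+iy\in\mathbb{C}$ put $\langle z\rangle=(1+|z|^2)^{1/2}$. For $\theta\in\mathbb{R}$, $\langle\cdot\rangle^{\theta}L^2(\mathbb{C})=\{\langle z\rangle^{\theta}u(z):\ u\in L^2(\mathbb{C})\}$, where $L^2(\mathbb{C})$ is taken with respect to Lebesgue measure on $\mathbb{C}\simeq\mathbb{R}^2$. The operator is $\overline{\partial}=\frac12(\partial_x+i\partial_y)$, and the equation $\overline\partial u=v$ is understood in the sense of distributions. *)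

theory Defs
  imports "HOL-Analysis.Analysis"
begin

definition bracket :: "complex \<Rightarrow> real" where
  "bracket z = sqrt (1 + (cmod z)\<^sup>2)"

(* Elements of L^2 are represented by functions; equality in L^2 is equality almost everywhere. *)
definition L2 :: "(complex \<Rightarrow> complex) set" where
  "L2 = {u. u \<in> borel_measurable lebesgue \<and> integrable lebesgue (\<lambda>z. (cmod (u z))\<^sup>2)}"

definition weighted_L2 :: "real \<Rightarrow> (complex \<Rightarrow> complex) set" where
  "weighted_L2 \<theta> = (\<lambda>u z. of_real (bracket z powr \<theta>) * u z) ` L2"

definition partial_x :: "(complex \<Rightarrow> complex) \<Rightarrow> complex \<Rightarrow> complex" where
  "partial_x f z = frechet_derivative f (at z) 1"

definition partial_y :: "(complex \<Rightarrow> complex) \<Rightarrow> complex \<Rightarrow> complex" where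
  "partial_y f z = frechet_derivative f (at z) \<i>"

definition dbar :: "(complex \<Rightarrow> complex) \<Rightarrow> complex \<Rightarrow> complex" where
  "dbar f z = (partial_x f z + \<i> * partial_y f z) / 2"

(* Differentiability here is real differentiability on the plane, not complex differentiability. *)
primrec C_k :: "nat \<Rightarrow> (complex \<Rightarrow> complex) \<Rightarrow> bool" where
  "C_k 0 f \<longleftrightarrow> continuous_on UNIV f"
| "C_k (Suc k) f \<longleftrightarrow> f differentiable_on UNIV \<and> C_k k (partial_x f) \<and> C_k k (partial_y f)"

definition test_functions :: "(complex \<Rightarrow> complex) set" where
  "test_functions = {\<phi>. (\<forall>k. C_k k \<phi>) \<and> compact (closure {z. \<phi> z \<noteq> 0})}"

(* The distribution given by a locally integrable function. Every element of a weighted L^2 space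
   is locally integrable, by Cauchy-Schwarz on compact sets. *)
definition distr_of :: "(complex \<Rightarrow> complex) \<Rightarrow> (complex \<Rightarrow> complex) \<Rightarrow> complex" where
  "distr_of u \<phi> = (LINT z|lebesgue. u z * \<phi> z)"

definition distr_dbar :: "((complex \<Rightarrow> complex) \<Rightarrow> complex) \<Rightarrow> (complex \<Rightarrow> complex) \<Rightarrow> complex" where
  "distr_dbar T \<phi> = - T (dbar \<phi>)"

definition dbar_eq :: "(complex \<Rightarrow> complex) \<Rightarrow> (complex \<Rightarrow> complex) \<Rightarrow> bool" where
  "dbar_eq u v \<longleftrightarrow> (\<forall>\<phi>\<in>test_functions. distr_dbar (distr_of u) \<phi> = distr_of v \<phi>)"

end

theory Submission
  imports Defs
begin

text \<open>
  Existence for \<open>0 < \<epsilon> \<le> 1\<close>: the Cauchy transform \<open>u(z) = (1/c) \<integral> v(x) / (z - x) dx\<close> solves the equation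
  by the Cauchy--Pompeiu formula, and a Schur test with power weights, resting on the bounds
  \<open>\<integral> \<langle>x\<rangle>\<^sup>-\<^sup>s / |z - x| dx \<le> C\<close> for \<open>s > 1\<close> and \<open>\<integral> \<langle>x\<rangle>\<^sup>-\<^sup>3 / |z - x| dx \<le> C / \<langle>z\<rangle>\<close>,
  puts it into the right space. Larger \<open>\<epsilon>\<close> follow by induction in unit steps: if \<open>u\<close> solves the
  equation for \<open>v / z\<close>, then \<open>z u\<close> solves it for \<open>v\<close>.

  Uniqueness is a distributional Liouville theorem. Let \<open>w\<close> be a difference of two solutions and \<open>\<psi>\<close> a
  test function. Then \<open>N = \<psi> * (1/z)\<close> is smooth, \<open>dbar N = c \<psi>\<close> and \<open>N = O(1/|z|)\<close>. Testing the equation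
  for \<open>w\<close> against \<open>\<chi>(z/n) N\<close> leaves, besides a multiple of \<open>\<integral> w \<psi>\<close>, an error of size
  \<open>n\<^sup>-\<^sup>2 \<integral>\<^bsub>|z| \<le> n\<^esub> |w|\<close>, which tends to \<open>0\<close> because \<open>\<epsilon> \<le> 1\<close>. So \<open>\<integral> w \<psi> = 0\<close> for all \<open>\<psi>\<close>.
\<close>

subsection \<open>Smooth functions\<close>

text \<open>The bound \<epsilon> \<le> 1 is sharp for uniqueness: a nonzero constant lies in the
  weighted space exactly if \<epsilon> > 1. At \<epsilon> = 1 no power of n is left over:
  Cauchy-Schwarz bounds the error only by the root of n^-2 times the integral of |w|^2 over the
  disc, and this tends to 0 by dominated convergence, without a rate. For existence the obstacle
  lies at the other end: for large \<epsilon> the integral defining the Cauchy transform of v may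
  diverge, and dividing by z restores the decay that no estimate of the kernel could supply. Polar
  coordinates are avoided. Integrals of powers are summed over dyadic shells, and the Cauchy-Pompeiu
  constant stays an unevaluated integral, known only to be nonzero. All smooth cutoffs, for discs
  and for boxes, arise from one flat function composed with real parts of polynomials in z and its
  conjugate. Orthogonality to all test functions gives vanishing almost everywhere by way of boxes:
  products of four smoothed half-plane indicators approximate the indicator of a box, and boxes
  generate the Borel sets.\<close>

definition smooth :: "(complex \<Rightarrow> complex) \<Rightarrow> bool" where
  "smooth f \<longleftrightarrow> (\<forall>k. C_k k f)"

lemma partial_derivs:
  assumes "(f has_derivative D) (at z)"
  shows "partial_x f z = D 1" "partial_y f z = D \<i>" "dbar f z = (D 1 + \<i> * D \<i>) / 2"
  using frechet_derivative_at[OF assms] by (simp_all add: partial_x_def partial_y_def dbar_def)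

text \<open>Writing the derivative through the partials lets its continuity in the base point be
  read off from theirs.\<close>

lemma has_derivative_partials:
  assumes "f differentiable (at z)"
  shows "(f has_derivative (\<lambda>h. of_real (Re h) * partial_x f z + of_real (Im h) * partial_y f z)) (at z)"
proof -
  have d: "(f has_derivative frechet_derivative f (at z)) (at z)"
    using assms frechet_derivative_works by blast
  interpret L: bounded_linear "frechet_derivative f (at z)" by (rule has_derivative_bounded_linear[OF d])
  have "frechet_derivative f (at z) h = of_real (Re h) * partial_x f z + of_real (Im h) * partial_y f z" for h
  proof -
    have "h = Re h *\<^sub>R 1 + Im h *\<^sub>R \<i>" by (simp add: complex_eq_iff)
    then have "frechet_derivative f (at z) h = frechet_derivative f (at z) (Re h *\<^sub>R 1 + Im h *\<^sub>R \<i>)" by simp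
    also have "\<dots> = Re h *\<^sub>R frechet_derivative f (at z) 1 + Im h *\<^sub>R frechet_derivative f (at z) \<i>"
      by (simp only: L.add L.scaleR)
    finally show ?thesis by (simp only: partial_x_def partial_y_def scaleR_conv_of_real)
  qed
  then have "frechet_derivative f (at z) = (\<lambda>h. of_real (Re h) * partial_x f z + of_real (Im h) * partial_y f z)" by (rule ext)
  with d show ?thesis by (simp only:)
qed

text \<open>Derivatives at a point are unique, so any family \<open>D\<close> of derivatives may
  replace \<open>frechet_derivative\<close> inside the partials. The closure properties below then
  need only the matching derivative rule.\<close>

lemma C_k_SucI:
  assumes "\<And>z. (f has_derivative D z) (at z)" "C_k k (\<lambda>z. D z 1)" "C_k k (\<lambda>z. D z \<i>)"
  shows "C_k (Suc k) f"
proof -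
  have "partial_x f = (\<lambda>z. D z 1)" "partial_y f = (\<lambda>z. D z \<i>)"
    using partial_derivs[OF assms(1)] by auto
  moreover have "f differentiable_on UNIV"
    using assms(1) by (auto simp: differentiable_on_def differentiable_def)
  ultimately show ?thesis using assms by simp
qed

lemma C_k_Suc_differentiable: "C_k (Suc k) f \<Longrightarrow> f differentiable (at z)"
  by (auto simp: differentiable_on_def)

lemma C_k_Suc_derivative:
  "C_k (Suc k) f \<Longrightarrow> (f has_derivative (frechet_derivative f (at z))) (at z)"
  using C_k_Suc_differentiable frechet_derivative_works by blast

lemma C_k_Suc_D: "C_k (Suc k) f \<Longrightarrow> C_k k f"
proof (induction k arbitrary: f)
  case 0
  then show ?case by (auto simp: differentiable_imp_continuous_on)
next
  case (Suc k)
  then have *: "f differentiable_on UNIV" "C_k (Suc k) (partial_x f)" "C_k (Suc k) (partial_y f)"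
    unfolding C_k.simps(2)[of "Suc k" f] by blast+
  show ?case unfolding C_k.simps(2)[of k f] using *(1) Suc.IH[OF *(2)] Suc.IH[OF *(3)] by blast
qed

lemma C_k_const: "C_k k (\<lambda>_. c)"
proof (induction k arbitrary: c)
  case (Suc k)
  then show ?case by (intro C_k_SucI[where D="\<lambda>_ _. 0"]) auto
qed simp

lemma C_k_bounded_linear: "bounded_linear f \<Longrightarrow> C_k k f"
proof (cases k)
  case 0
  assume "bounded_linear f"
  then show ?thesis using 0 by (simp add: linear_continuous_on)
next
  case (Suc n)
  assume "bounded_linear f"
  then show ?thesis unfolding Suc
    by (intro C_k_SucI[where D="\<lambda>_. f"] C_k_const) (auto intro: bounded_linear_imp_has_derivative)
qed

lemma C_k_add: "C_k k f \<Longrightarrow> C_k k g \<Longrightarrow> C_k k (\<lambda>z. f z + g z)"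
proof (induction k arbitrary: f g)
  case 0
  then show ?case by (auto intro: continuous_intros)
next
  case (Suc k)
  show ?case
    using Suc.prems Suc.IH[of "partial_x f" "partial_x g"] Suc.IH[of "partial_y f" "partial_y g"]
    by (intro C_k_SucI[OF has_derivative_add[OF C_k_Suc_derivative[OF Suc.prems(1)] C_k_Suc_derivative[OF Suc.prems(2)]]])
       (auto simp: partial_x_def[abs_def] partial_y_def[abs_def])
qed

lemma C_k_mult: "C_k k f \<Longrightarrow> C_k k g \<Longrightarrow> C_k k (\<lambda>z. f z * g z)"
proof (induction k arbitrary: f g)
  case 0
  then show ?case by (auto intro: continuous_intros)
next
  case (Suc k)
  \<comment> \<open>The product rule leaves one factor underived, so \<open>f\<close> and
    \<open>g\<close> themselves must also be known in the lower class.\<close>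
  have "C_k k f" "C_k k g" using Suc.prems C_k_Suc_D by blast+
  with Suc.prems
  have "C_k k (\<lambda>z. f z * partial_x g z + partial_x f z * g z)" "C_k k (\<lambda>z. f z * partial_y g z + partial_y f z * g z)"
    by (auto intro!: C_k_add Suc.IH)
  then show ?case
    by (intro C_k_SucI[OF has_derivative_mult[OF C_k_Suc_derivative[OF Suc.prems(1)] C_k_Suc_derivative[OF Suc.prems(2)]]])
       (auto simp: partial_x_def[abs_def] partial_y_def[abs_def])
qed

lemma C_k_compose_linear:
  assumes "bounded_linear L" shows "C_k k f \<Longrightarrow> C_k k (\<lambda>z. L (f z))"
proof (induction k arbitrary: f)
  case 0
  then show ?case
    using continuous_on_compose[of UNIV f L] linear_continuous_on[OF assms, of "range f"] by (simp add: o_def)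
next
  case (Suc k)
  then have "C_k k (\<lambda>z. L (partial_x f z))" "C_k k (\<lambda>z. L (partial_y f z))" by auto
  then show ?case
    by (intro C_k_SucI[OF bounded_linear.has_derivative[OF assms C_k_Suc_derivative[OF Suc.prems]]])
      (auto simp: partial_x_def[abs_def] partial_y_def[abs_def])
qed

lemma C_k_translate: "C_k k f \<Longrightarrow> C_k k (\<lambda>z. f (z + a))"
proof (induction k arbitrary: f)
  case 0
  then show ?case by (auto intro!: continuous_on_compose2[of UNIV f] continuous_intros)
next
  case (Suc k)
  then have "C_k k (\<lambda>z. partial_x f (z + a))" "C_k k (\<lambda>z. partial_y f (z + a))" by auto
  moreover have "((\<lambda>z. f (z + a)) has_derivative frechet_derivative f (at (z + a))) (at z)" for z
    by (rule has_derivative_compose[where f="\<lambda>z. z + a" and f'="\<lambda>h. h", OF _ C_k_Suc_derivative[OF Suc.prems], simplified o_def])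
       (auto intro!: derivative_eq_intros)
  ultimately show ?case
    by (intro C_k_SucI[where D="\<lambda>z. frechet_derivative f (at (z + a))"])
      (auto simp: partial_x_def[abs_def] partial_y_def[abs_def])
qed

lemma smooth_partials: "smooth f \<Longrightarrow> smooth (partial_x f)" "smooth f \<Longrightarrow> smooth (partial_y f)"
  unfolding smooth_def using C_k.simps(2) by blast+

lemma smooth_differentiable: "smooth f \<Longrightarrow> f differentiable (at z)"
  unfolding smooth_def using C_k_Suc_differentiable by blast

lemma smooth_continuous: "smooth f \<Longrightarrow> continuous_on A f"
  unfolding smooth_def using C_k.simps(1) continuous_on_subset by blast

lemma smooth_const: "smooth (\<lambda>_. c)"
  by (simp add: smooth_def C_k_const)

lemma smooth_linear: "bounded_linear L \<Longrightarrow> smooth L"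
  by (simp add: smooth_def C_k_bounded_linear)

lemma smooth_add: "smooth f \<Longrightarrow> smooth g \<Longrightarrow> smooth (\<lambda>z. f z + g z)"
  by (simp add: smooth_def C_k_add)

lemma smooth_mult: "smooth f \<Longrightarrow> smooth g \<Longrightarrow> smooth (\<lambda>z. f z * g z)"
  by (simp add: smooth_def C_k_mult)

lemma smooth_translate: "smooth f \<Longrightarrow> smooth (\<lambda>z. f (z + a))"
  by (simp add: smooth_def C_k_translate)

lemma smooth_dbar: "smooth f \<Longrightarrow> smooth (dbar f)"
proof -
  assume f: "smooth f"
  have "smooth (\<lambda>z. (1/2) * (partial_x f z + \<i> * partial_y f z))"
    by (rule smooth_mult[OF smooth_const smooth_add[OF smooth_partials(1)[OF f]
      smooth_mult[OF smooth_const smooth_partials(2)[OF f]]]])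
  then show ?thesis by (simp add: dbar_def[abs_def])
qed

lemma dbar_mult:
  assumes "f differentiable (at z)" "g differentiable (at z)"
  shows "dbar (\<lambda>z. f z * g z) z = f z * dbar g z + dbar f z * g z"
  by (subst partial_derivs(3)[OF has_derivative_mult[OF frechet_derivative_works[THEN iffD1, OF assms(1)] frechet_derivative_works[THEN iffD1, OF assms(2)]]])
     (simp add: dbar_def partial_x_def partial_y_def field_simps)

text \<open>The family \<open>t\<^sup>-\<^sup>m exp (-1/t)\<close> is closed under differentiation up to linear combinations, so
  that smoothness of the compositions below is a single induction over all \<open>m\<close>.\<close>

definition flat :: "nat \<Rightarrow> real \<Rightarrow> real" where
  "flat m t = (if t \<le> 0 then 0 else exp (- 1 / t) / t ^ m)"

text \<open>With s = 1/t the right-hand limit becomes that of \<open>s ^ m / exp s\<close> at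
  infinity; on the left the function is constantly 0.\<close>

lemma flat_tendsto_0: "(flat m \<longlongrightarrow> 0) (at 0)"
proof -
  have "((\<lambda>t. inverse t ^ m / exp (inverse t)) \<longlongrightarrow> (0::real)) (at_right 0)"
    by (rule filterlim_compose[OF tendsto_power_div_exp_0 filterlim_inverse_at_top_right])
  moreover have "eventually (\<lambda>t. inverse t ^ m / exp (inverse t) = flat m t) (at_right 0)"
    by (auto simp: eventually_at_filter flat_def exp_minus field_simps)
  ultimately have r: "(flat m \<longlongrightarrow> 0) (at_right 0)" by (rule Lim_transform_eventually)
  have l: "(flat m \<longlongrightarrow> 0) (at_left 0)"
    by (rule Lim_transform_eventually[OF tendsto_const]) (auto simp: eventually_at_filter flat_def)
  show ?thesis using l r by (simp add: filterlim_split_at)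
qed

lemma DERIV_flat: "(flat m has_real_derivative flat (m + 2) t - real m * flat (m + 1) t) (at t)"
proof -
  consider "t < 0" | "t = 0" | "t > 0" by linarith
  then show ?thesis
  proof cases
    case 1
    have "((\<lambda>_. 0) has_real_derivative 0) (at t)" by simp
    then have "(flat m has_real_derivative 0) (at t)"
      by (rule has_field_derivative_transform_within_open[where S="{..<0}"]) (use 1 in \<open>auto simp: flat_def\<close>)
    then show ?thesis using 1 by (simp add: flat_def)
  next
    case 2
    \<comment> \<open>At 0 the division by \<open>h\<close> merely raises the index: the difference
      quotient of \<open>flat m\<close> is \<open>flat (m + 1)\<close>.\<close>
    have "((\<lambda>h. (flat m (0 + h) - flat m 0) / h) \<longlongrightarrow> 0) (at 0)"
    proof (rule Lim_transform_eventually[OF flat_tendsto_0[of "m+1"]])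
      show "\<forall>\<^sub>F h in at 0. flat (m + 1) h = (flat m (0 + h) - flat m 0) / h"
        by (auto simp: eventually_at_filter flat_def)
    qed
    then show ?thesis using 2 by (simp add: DERIV_def flat_def)
  next
    case 3
    have "((\<lambda>t. exp (- 1 / t) / t ^ m) has_real_derivative exp (- 1 / t) / t ^ (m+2) - real m * (exp (- 1 / t) / t ^ (m+1))) (at t)"
    proof -
      have e: "((\<lambda>t. exp (- 1 / t)) has_real_derivative exp (- 1 / t) / t\<^sup>2) (at t)"
        using 3 by (auto intro!: derivative_eq_intros simp: power2_eq_square)
      have "t ^ m \<noteq> 0" using 3 by simp
      from DERIV_divide[OF e DERIV_pow[of m t UNIV] this] show ?thesis
        by (rule DERIV_cong) (use 3 in \<open>cases m; simp add: field_simps power2_eq_square\<close>)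
    qed
    then have "(flat m has_real_derivative exp (- 1 / t) / t ^ (m+2) - real m * (exp (- 1 / t) / t ^ (m+1))) (at t)"
      by (rule has_field_derivative_transform_within_open[where S="{0<..}"]) (use 3 in \<open>auto simp: flat_def\<close>)
    then show ?thesis using 3 by (simp add: flat_def)
  qed
qed

text \<open>\<open>C_k\<close> speaks only of maps of the plane into itself; hence the real argument
  of \<open>flat\<close> is supplied as the real part of a smooth \<open>Q\<close>, and the value is
  embedded back by \<open>of_real\<close>.\<close>

lemma C_k_flat_compose:
  assumes "smooth Q"
  shows "C_k k (\<lambda>z. of_real (flat m (Re (Q z))))"
proof (induction k arbitrary: m)
  case 0
  have "isCont (flat m) t" for t using DERIV_flat DERIV_isCont by blast
  then have "continuous_on UNIV (flat m)" by (simp add: continuous_at_imp_continuous_on)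
  then show ?case using smooth_continuous[OF assms, of UNIV]
    by (auto intro!: continuous_intros continuous_on_compose2[of UNIV "flat m"])
next
  case (Suc k)
  let ?D = "\<lambda>z. frechet_derivative Q (at z)"
  have dQ: "(Q has_derivative ?D z) (at z)" for z
    using frechet_derivative_works smooth_differentiable[OF assms] by blast
  have 1: "((\<lambda>z. of_real (flat m (Re (Q z))) :: complex) has_derivative
      (\<lambda>h. of_real (flat (m+2) (Re (Q z)) - real m * flat (m+1) (Re (Q z))) * of_real (Re (?D z h)))) (at z)" for z
  proof -
    have r: "((\<lambda>z. Re (Q z)) has_derivative (\<lambda>h. Re (?D z h))) (at z)"
      by (rule bounded_linear.has_derivative[OF bounded_linear_Re dQ])
    have "((\<lambda>z. flat m (Re (Q z))) has_derivative
      (\<lambda>h. (flat (m+2) (Re (Q z)) - real m * flat (m+1) (Re (Q z))) * Re (?D z h))) (at z)"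
      using has_derivative_compose[OF r DERIV_flat[of m, unfolded has_field_derivative_def]] by (simp add: o_def)
    from bounded_linear.has_derivative[OF bounded_linear_of_real this] show ?thesis by simp
  qed
  have c: "C_k k (\<lambda>z. complex_of_real (flat (m+2) (Re (Q z)) - real m * flat (m+1) (Re (Q z))))"
    using C_k_add[OF Suc.IH[of "m+2"] C_k_mult[OF C_k_const[of k "- of_nat m"] Suc.IH[of "m+1"]]] by simp
  have s: "C_k k (\<lambda>z. complex_of_real (Re (F z)))" if "smooth F" for F
    using C_k_compose_linear[of "\<lambda>z. complex_of_real (Re z)" k F] that
    by (auto simp: smooth_def intro: bounded_linear_compose[OF bounded_linear_of_real bounded_linear_Re])
  show ?case
    using s[OF smooth_partials(1)[OF assms]] s[OF smooth_partials(2)[OF assms]] c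
    by (intro C_k_SucI[OF 1] C_k_mult) (auto simp: partial_x_def[abs_def] partial_y_def[abs_def])
qed

lemma smooth_flat_compose: "smooth Q \<Longrightarrow> smooth (\<lambda>z. of_real (flat m (Re (Q z))))"
  by (simp add: smooth_def C_k_flat_compose)

text \<open>By Heine-Borel, compactness of the closure amounts to boundedness. The radius
  \<open>R\<close> is the form in which the support enters all later estimates.\<close>

lemma test_functions_iff:
  "\<phi> \<in> test_functions \<longleftrightarrow> smooth \<phi> \<and> (\<exists>R>0. \<forall>z. \<phi> z \<noteq> 0 \<longrightarrow> cmod z \<le> R)"
proof
  assume "\<phi> \<in> test_functions"
  then have "smooth \<phi>" "bounded (closure {z. \<phi> z \<noteq> 0})"
    by (auto simp: test_functions_def smooth_def compact_imp_bounded)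
  then have "bounded {z. \<phi> z \<noteq> 0}" by (metis bounded_subset closure_subset)
  then show "smooth \<phi> \<and> (\<exists>R>0. \<forall>z. \<phi> z \<noteq> 0 \<longrightarrow> cmod z \<le> R)"
    using \<open>smooth \<phi>\<close> by (auto simp: bounded_pos)
next
  assume a: "smooth \<phi> \<and> (\<exists>R>0. \<forall>z. \<phi> z \<noteq> 0 \<longrightarrow> cmod z \<le> R)"
  then have "bounded {z. \<phi> z \<noteq> 0}" by (auto simp: bounded_pos)
  then show "\<phi> \<in> test_functions" using a by (simp add: test_functions_def smooth_def compact_closure)
qed

subsection \<open>Power weights against the kernel $1/|z|$\<close>

lemma bracket_ge_1: "1 \<le> bracket z"
  by (simp add: bracket_def)

lemma bracket_pos [simp]: "0 < bracket z"
  using bracket_ge_1[of z] by linarith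

lemma bracket_simps [simp]: "0 \<le> bracket z" "bracket z \<noteq> 0" "\<bar>bracket z\<bar> = bracket z"
  using bracket_pos[of z] by (auto simp del: bracket_pos)

lemma bracket_sq: "(bracket z)\<^sup>2 = 1 + (cmod z)\<^sup>2"
  by (simp add: bracket_def)

lemma cmod_le_bracket: "cmod z \<le> bracket z"
  by (rule power2_le_imp_le) (auto simp: bracket_sq less_imp_le)

lemma bracket_le_1_cmod: "bracket z \<le> 1 + cmod z"
  by (rule power2_le_imp_le) (auto simp: bracket_sq power2_sum)

text \<open>After squaring, the 1 under the root is absorbed by \<open>bracket x\<close>, and the
  cross term only needs \<open>cmod x \<le> bracket x\<close>.\<close>

lemma bracket_triangle: "bracket z \<le> bracket x + cmod (z - x)"
proof -
  have "(cmod z)\<^sup>2 \<le> (cmod x + cmod (z - x))\<^sup>2"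
    using norm_triangle_ineq[of x "z - x"] by (intro power_mono) auto
  moreover have "cmod x * cmod (z - x) \<le> bracket x * cmod (z - x)"
    by (intro mult_right_mono cmod_le_bracket) auto
  ultimately have "(bracket z)\<^sup>2 \<le> (bracket x + cmod (z - x))\<^sup>2"
    by (simp add: power2_sum bracket_sq)
  then show ?thesis by (rule power2_le_imp_le) (simp add: less_imp_le)
qed

lemma continuous_on_bracket [continuous_intros]: "continuous_on A bracket"
  unfolding bracket_def[abs_def] by (intro continuous_intros)

lemma bracket_measurable [measurable]: "bracket \<in> borel_measurable borel"
  using continuous_on_bracket by (rule borel_measurable_continuous_onI)

section \<open>Affine changes of variables and sums over dyadic shells\<close>

lemma ennreal_finite_obtain:
  assumes "x < \<infinity>" obtains C where "0 \<le> C" "x = ennreal C"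
  using assms by (cases x) auto

lemma nn_integral_lborel_affine:
  fixes f :: "'a::euclidean_space \<Rightarrow> ennreal"
  assumes [measurable]: "f \<in> borel_measurable borel" and c: "c \<noteq> 0"
  shows "(\<integral>\<^sup>+x. f x \<partial>lborel) = ennreal (\<bar>c\<bar> ^ DIM('a)) * (\<integral>\<^sup>+x. f (t + c *\<^sub>R x) \<partial>lborel)"
  by (subst lborel_affine[OF c, of t])
     (simp add: nn_integral_density nn_integral_distr nn_integral_cmult ennreal_power)

lemma lborel_integral_affine:
  fixes f :: "'a::euclidean_space \<Rightarrow> 'b::{banach, second_countable_topology}"
  assumes [measurable]: "f \<in> borel_measurable borel" and c: "c \<noteq> 0"
  shows "(LINT x|lborel. f x) = (\<bar>c\<bar> ^ DIM('a)) *\<^sub>R (LINT x|lborel. f (t + c *\<^sub>R x))"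
proof -
  have "(lborel :: 'a measure) = density (distr lborel borel (\<lambda>x. t + c *\<^sub>R x)) (\<lambda>_. ennreal (\<bar>c\<bar> ^ DIM('a)))"
    using lborel_affine[OF c, of t] by (simp add: ennreal_power)
  then have "(LINT x|lborel. f x) = (LINT x|density (distr lborel borel (\<lambda>x. t + c *\<^sub>R x)) (\<lambda>_. ennreal (\<bar>c\<bar> ^ DIM('a))). f x)"
    by simp
  also have "\<dots> = (\<bar>c\<bar> ^ DIM('a)) *\<^sub>R (LINT x|lborel. f (t + c *\<^sub>R x))"
    by (subst integral_density) (auto simp: integral_distr)
  finally show ?thesis .
qed

lemma nn_integral_lborel_reflect:
  fixes f :: "'a::euclidean_space \<Rightarrow> ennreal"
  assumes "f \<in> borel_measurable borel"
  shows "(\<integral>\<^sup>+x. f (z - x) \<partial>lborel) = (\<integral>\<^sup>+x. f x \<partial>lborel)"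
  using nn_integral_lborel_affine[OF assms, of "-1" z] by simp

lemma lborel_integral_reflect:
  fixes f :: "'a::euclidean_space \<Rightarrow> 'b::{banach, second_countable_topology}"
  assumes "f \<in> borel_measurable borel"
  shows "(LINT x|lborel. f (z - x)) = (LINT x|lborel. f x)"
  using lborel_integral_affine[OF assms, of "-1" z] by simp

lemma ex_dyadic: assumes "1 \<le> (r::real)" shows "\<exists>n. 2 ^ n \<le> r \<and> r < 2 ^ (n + 1)"
proof -
  let ?n = "LEAST n. r < 2 ^ (n + 1)"
  obtain m where "r < 2 ^ m" using real_arch_pow[of 2 r] by auto
  then have "r < 2 ^ (m + 1)" by (simp) (use assms in linarith)
  then have n: "r < 2 ^ (?n + 1)" by (rule LeastI)
  have "2 ^ ?n \<le> r"
  proof (cases ?n)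
    case 0 then show ?thesis using assms by simp
  next
    case (Suc k)
    then have "\<not> r < 2 ^ (k + 1)" using not_less_Least[of k "\<lambda>n. r < 2 ^ (n + 1)"] by simp
    then show ?thesis using Suc by simp
  qed
  with n show ?thesis by blast
qed

text \<open>A substitute for polar coordinates. Each point where \<open>f\<close> does not vanish is
  charged to one ball whose constant bounds the value there, so the integral is at most the sum of
  constants times areas. It serves shells running to infinity as well as shells shrinking to a
  pole.\<close>

lemma nn_integral_geometric_balls:
  fixes f :: "complex \<Rightarrow> ennreal"
  assumes f: "\<And>z. f z \<noteq> 0 \<Longrightarrow> \<exists>n. f z \<le> ennreal (a n) \<and> cmod z < r n"
    and a: "\<And>n. 0 \<le> a n" "\<And>n. 0 \<le> r n" "summable (\<lambda>n. a n * (r n)\<^sup>2)"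
  shows "(\<integral>\<^sup>+z. f z \<partial>lborel) < \<infinity>"
proof -
  let ?t = "\<lambda>n (z::complex). ennreal (a n) * indicator (ball 0 (r n)) z"
  have "f z \<le> (\<Sum>n. ?t n z)" for z
  proof (cases "f z = 0")
    case False
    then obtain n where "f z \<le> ennreal (a n)" "cmod z < r n" using f by blast
    then have "f z \<le> ?t n z" by simp
    also have "?t n z = (\<Sum>n\<in>{n}. ?t n z)" by (simp only: sum.insert finite.emptyI empty_iff not_False_eq_True sum.empty add_0_right)
    also have "\<dots> \<le> (\<Sum>n. ?t n z)" by (rule sum_le_suminf) auto
    finally show ?thesis .
  qed simp
  then have "(\<integral>\<^sup>+z. f z \<partial>lborel) \<le> (\<integral>\<^sup>+z. (\<Sum>n. ?t n z) \<partial>lborel)" by (intro nn_integral_mono)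
  also have "\<dots> = (\<Sum>n. \<integral>\<^sup>+z. ?t n z \<partial>lborel)" 
    by (rule nn_integral_suminf)
       (intro borel_measurable_times_ennreal borel_measurable_const borel_measurable_indicator, simp)
  also have "\<dots> = (\<Sum>n. ennreal (pi * (a n * (r n)\<^sup>2)))"
  proof (rule arg_cong[where f=suminf], rule ext)
    fix n
    have "(\<integral>\<^sup>+z. ?t n z \<partial>lborel) = ennreal (a n) * ennreal (pi * (r n)\<^sup>2)"
      using a(2)[of n] by (simp add: nn_integral_cmult_indicator emeasure_ball unit_ball_vol_2)
    also have "\<dots> = ennreal (pi * (a n * (r n)\<^sup>2))"
      using a(1)[of n] by (simp add: ennreal_mult'[symmetric] mult_ac)
    finally show "(\<integral>\<^sup>+z. ?t n z \<partial>lborel) = ennreal (pi * (a n * (r n)\<^sup>2))" .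
  qed
  also have "\<dots> < \<infinity>"
    by (subst suminf_ennreal2) (use a(1) summable_mult[OF a(3), of pi] in auto)
  finally show ?thesis .
qed

text \<open>The shell where the bracket is about 2^n has area of order 4^n and carries values of
  order 2^(-tn); the ratio 4 * 2^-t is below 1 exactly if t > 2.\<close>

lemma nn_integral_bracket_powr:
  assumes t: "2 < t" shows "(\<integral>\<^sup>+z. ennreal (bracket z powr -t) \<partial>lborel) < \<infinity>"
proof (rule nn_integral_geometric_balls[where a="\<lambda>n. (2 powr -t) ^ n" and r="\<lambda>n. 2 ^ (n + 1)"])
  fix z
  obtain n where n: "2 ^ n \<le> bracket z" "bracket z < 2 ^ (n + 1)" using ex_dyadic[OF bracket_ge_1] by blast
  have "bracket z powr -t \<le> (2 ^ n) powr -t" using n t by (intro powr_mono2') auto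
  also have "\<dots> = (2 powr -t) ^ n" by (simp add: powr_powr powr_realpow[symmetric] mult.commute)
  finally show "\<exists>n. ennreal (bracket z powr -t) \<le> ennreal ((2 powr -t) ^ n) \<and> cmod z < 2 ^ (n + 1)"
    using n cmod_le_bracket[of z] by (intro exI[of _ n]) (auto intro: ennreal_leI)
next
  have "4 * 2 powr -t < (1::real)"
  proof -
    have "4 * 2 powr -t = (2::real) powr (2 - t)" by (simp add: powr_diff powr_minus divide_inverse)
    also have "\<dots> < 2 powr 0" using t by (intro powr_less_mono) auto
    finally show ?thesis by simp
  qed
  then have "summable (\<lambda>n. 4 * (4 * 2 powr -t) ^ n)" by (intro summable_mult summable_geometric) auto
  moreover have "(2 powr -t) ^ n * (2 ^ (n + 1))\<^sup>2 = 4 * (4 * 2 powr -t) ^ n" for n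
  proof -
    have "(2 ^ (n + 1))\<^sup>2 = 4 * ((2::real) ^ n * 2 ^ n)" by (simp add: power2_eq_square)
    also have "(2::real) ^ n * 2 ^ n = 4 ^ n" by (subst power_mult_distrib[symmetric]) simp
    finally show ?thesis by (simp add: power_mult_distrib)
  qed
  ultimately show "summable (\<lambda>n. (2 powr -t) ^ n * (2 ^ (n + 1))\<^sup>2)" by (simp only:)
qed auto

text \<open>On the shell where |z| is about 2^-n the function is below 2^(n+1) and the area is of
  order 4^-n, so the terms decay like 2^-n.\<close>

lemma nn_integral_inverse_near_0:
  "(\<integral>\<^sup>+z. ennreal ((if cmod z < 1 then 1 / cmod z else 0)) \<partial>lborel) < \<infinity>"
proof (rule nn_integral_geometric_balls[where a="\<lambda>n. 2 ^ (n + 1)" and r="\<lambda>n. 2 * (1/2) ^ n"])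
  fix z assume "ennreal ((if cmod z < 1 then 1 / cmod z else 0)) \<noteq> 0"
  then have z: "z \<noteq> 0" "cmod z < 1" by (auto split: if_splits)
  then have "1 \<le> 1 / cmod z" by simp
  then obtain n where n: "2 ^ n \<le> 1 / cmod z" "1 / cmod z < 2 ^ (n + 1)" using ex_dyadic by blast
  from n(1) z have "cmod z \<le> (1/2) ^ n" by (simp add: field_simps)
  \<comment> \<open>The radius is doubled because the dyadic bound on |z| is not strict while the
    balls are open.\<close>
  also have "\<dots> < 2 * (1/2) ^ n" by simp
  finally show "\<exists>n. ennreal ((if cmod z < 1 then 1 / cmod z else 0)) \<le> ennreal (2 ^ (n + 1)) \<and> cmod z < 2 * (1/2) ^ n"
    using n z by (intro exI[of _ n]) (auto intro!: ennreal_leI)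
next
  have "summable (\<lambda>n. 8 * (1 / 2 :: real) ^ n)" by (intro summable_mult summable_geometric) auto
  moreover have "2 ^ (n + 1) * (2 * (1 / 2 :: real) ^ n)\<^sup>2 = 8 * (1 / 2) ^ n" for n
  proof -
    have "2 ^ (n + 1) * (2 * (1 / 2 :: real) ^ n)\<^sup>2 = 8 * (1 / 2) ^ n * (2 ^ n * (1 / 2) ^ n)"
      by (simp add: power2_eq_square)
    also have "2 ^ n * (1 / 2 :: real) ^ n = 1" by (subst power_mult_distrib[symmetric]) simp
    finally show ?thesis by simp
  qed
  ultimately show "summable (\<lambda>n. 2 ^ (n + 1) * (2 * (1 / 2 :: real) ^ n)\<^sup>2)" by (simp only:)
qed auto

section \<open>Weighted integrals of the kernel, uniformly in the pole\<close>

text \<open>Away from the diagonal 1/|z - x| is at most 2/D, and A^-s / D is at most the power -(s +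
  1) of the smaller of A and D. This decouples \<open>x\<close> from \<open>z - x\<close>, and the
  new exponent s + 1 exceeds 2, the threshold for integrability.\<close>

lemma riesz_kernel_pointwise:
  assumes s: "1 < s"
  shows "bracket x powr -s / cmod (z - x) \<le>
    (if cmod (z - x) < 1 then 1 / cmod (z - x) else 0) + 2 * (bracket x powr -(s + 1) + bracket (z - x) powr -(s + 1))"
proof (cases "cmod (z - x) < 1")
  case True
  have "bracket x powr -s \<le> 1 powr -s" using bracket_ge_1[of x] s by (intro powr_mono2') auto
  then have "bracket x powr -s / cmod (z - x) \<le> 1 / cmod (z - x)" by (intro divide_right_mono) auto
  also have "\<dots> = (if cmod (z - x) < 1 then 1 / cmod (z - x) else 0)" using True by simp
  finally show ?thesis by (rule add_increasing2[rotated]) simp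
next
  case False
  define A D where "A = bracket x" and "D = bracket (z - x)"
  have AD: "0 < A" "0 < D" by (auto simp: A_def D_def)
  have "D \<le> 2 * cmod (z - x)" using bracket_le_1_cmod[of "z - x"] False by (simp add: D_def)
  moreover have "0 < cmod (z - x)" using False by linarith
  ultimately have "1 / cmod (z - x) \<le> 2 / D" using AD by (simp add: divide_simps)
  then have "A powr -s * (1 / cmod (z - x)) \<le> A powr -s * (2 / D)" by (intro mult_left_mono) auto
  also have "A powr -s * (1 / D) \<le> A powr -(s + 1) + D powr -(s + 1)"
  proof (cases "A \<le> D")
    case True
    then have "A powr -s * (1 / D) \<le> A powr -s * (1 / A)" using AD by (intro mult_left_mono divide_left_mono) auto
    also have "\<dots> = A powr -(s + 1)" using AD by (simp add: powr_diff[of A "-s" 1])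
    finally show ?thesis by (rule add_increasing2[rotated]) simp
  next
    case False
    then have "A powr -s * (1 / D) \<le> D powr -s * (1 / D)" using AD s by (intro mult_right_mono powr_mono2') auto
    also have "\<dots> = D powr -(s + 1)" using AD by (simp add: powr_diff[of D "-s" 1])
    finally show ?thesis by (rule add_increasing[rotated]) simp
  qed
  then have "A powr -s * (2 / D) \<le> 2 * (A powr -(s + 1) + D powr -(s + 1))" by (simp add: field_simps)
  finally show ?thesis using False by (simp add: A_def D_def)
qed

text \<open>Every term of the pointwise bound depends on \<open>x\<close> alone or on
  \<open>z - x\<close> alone; reflection turns the latter integrals into integrals free of
  \<open>z\<close>, whence the uniform constant.\<close>

lemma riesz_kernel_bounded:
  assumes s: "1 < s"
  shows "\<exists>C\<ge>0. \<forall>z. (\<integral>\<^sup>+x. ennreal (bracket x powr -s / cmod (z - x)) \<partial>lborel) \<le> ennreal C"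
proof -
  let ?I = "\<integral>\<^sup>+x. ennreal (bracket x powr -(s + 1)) \<partial>lborel"
  let ?J = "\<integral>\<^sup>+x. ennreal ((if cmod x < 1 then 1 / cmod x else 0)) \<partial>lborel"
  have plus: "ennreal (a + 2 * (b + c)) = ennreal a + 2 * (ennreal b + ennreal c)" if "0 \<le> a" "0 \<le> b" "0 \<le> c" for a b c :: real
    using that by (simp add: ennreal_plus ennreal_mult' del: distrib_left_numeral)
  have I: "?I < \<infinity>" and J: "?J < \<infinity>"
    using nn_integral_bracket_powr[of "s + 1"] s nn_integral_inverse_near_0 by auto
  have le: "(\<integral>\<^sup>+x. ennreal (bracket x powr -s / cmod (z - x)) \<partial>lborel) \<le> ?J + 2 * (?I + ?I)" for z
  proof -
    have "(\<integral>\<^sup>+x. ennreal (bracket x powr -s / cmod (z - x)) \<partial>lborel) \<le>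
      (\<integral>\<^sup>+x. ennreal ((if cmod (z - x) < 1 then 1 / cmod (z - x) else 0)) +
         2 * (ennreal (bracket x powr -(s + 1)) + ennreal (bracket (z - x) powr -(s + 1))) \<partial>lborel)"
      by (rule nn_integral_mono, rule order_trans[OF ennreal_leI[OF riesz_kernel_pointwise[OF s]]], subst plus) auto
    also have "\<dots> = (\<integral>\<^sup>+x. ennreal ((if cmod (z - x) < 1 then 1 / cmod (z - x) else 0)) \<partial>lborel) +
       2 * (?I + (\<integral>\<^sup>+x. ennreal (bracket (z - x) powr -(s + 1)) \<partial>lborel))"
      by (simp add: nn_integral_add nn_integral_cmult)
    also have "(\<integral>\<^sup>+x. ennreal ((if cmod (z - x) < 1 then 1 / cmod (z - x) else 0)) \<partial>lborel) = ?J"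
      by (rule nn_integral_lborel_reflect) measurable
    also have "(\<integral>\<^sup>+x. ennreal (bracket (z - x) powr -(s + 1)) \<partial>lborel) = ?I"
      by (rule nn_integral_lborel_reflect) measurable
    finally show ?thesis .
  qed
  have "?J + 2 * (?I + ?I) < \<infinity>" using I J by (simp add: ennreal_mult_less_top)
  then obtain C where "C \<ge> 0" "?J + 2 * (?I + ?I) = ennreal C" by (rule ennreal_finite_obtain)
  with le show ?thesis by (intro exI[of _ C]) simp
qed

text \<open>Multiply by \<open>bracket z\<close> and use \<open>bracket_triangle\<close>: the
  summand \<open>bracket x\<close> lowers the weight to the power -2, covered by the uniform bound,
  and the summand |z - x| cancels the kernel and leaves an integrable power.\<close>

lemma riesz_kernel_decay:
  "\<exists>C\<ge>0. \<forall>z. (\<integral>\<^sup>+x. ennreal (bracket x powr -3 / cmod (z - x)) \<partial>lborel) \<le> ennreal (C / bracket z)"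
proof -
  obtain C where C: "C \<ge> 0" "\<And>z. (\<integral>\<^sup>+x. ennreal (bracket x powr -2 / cmod (z - x)) \<partial>lborel) \<le> ennreal C"
    using riesz_kernel_bounded[of 2] by auto
  let ?I = "\<integral>\<^sup>+x. ennreal (bracket x powr -3) \<partial>lborel"
  obtain D where D: "D \<ge> 0" "?I = ennreal D"
    by (rule ennreal_finite_obtain[OF nn_integral_bracket_powr[of 3]]) auto
  have "(\<integral>\<^sup>+x. ennreal (bracket x powr -3 / cmod (z - x)) \<partial>lborel) \<le> ennreal ((C + D) / bracket z)" for z
  proof -
    have "bracket z * (bracket x powr -3 / cmod (z - x)) \<le> bracket x powr -2 / cmod (z - x) + bracket x powr -3" for x
    proof (cases "x = z")
      case False
      have "bracket z * (bracket x powr -3 / cmod (z - x)) \<le> (bracket x + cmod (z - x)) * (bracket x powr -3 / cmod (z - x))"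
        by (intro mult_right_mono bracket_triangle) auto
      also have "\<dots> = bracket x powr (1 + -3) / cmod (z - x) + bracket x powr -3"
        using False by (subst powr_add) (simp add: field_simps)
      finally show ?thesis by simp
    qed simp
    then have "(\<integral>\<^sup>+x. ennreal (bracket z * (bracket x powr -3 / cmod (z - x))) \<partial>lborel) \<le>
      (\<integral>\<^sup>+x. ennreal (bracket x powr -2 / cmod (z - x)) + ennreal (bracket x powr -3) \<partial>lborel)"
      by (intro nn_integral_mono) (simp add: ennreal_plus[symmetric] ennreal_leI del: ennreal_plus)
    also have "\<dots> \<le> ennreal C + ennreal D" using C D by (simp add: nn_integral_add add_right_mono)
    finally have *: "ennreal (bracket z) * (\<integral>\<^sup>+x. ennreal (bracket x powr -3 / cmod (z - x)) \<partial>lborel) \<le> ennreal (C + D)"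
      using C D by (subst nn_integral_cmult[symmetric]) (auto simp: ennreal_mult'[symmetric] ennreal_plus)
    have "(\<integral>\<^sup>+x. ennreal (bracket x powr -3 / cmod (z - x)) \<partial>lborel) =
      ennreal (1 / bracket z) * (ennreal (bracket z) * (\<integral>\<^sup>+x. ennreal (bracket x powr -3 / cmod (z - x)) \<partial>lborel))"
      by (simp add: mult.assoc[symmetric] ennreal_mult'[symmetric] less_imp_le less_imp_neq[symmetric])
    also have "\<dots> \<le> ennreal (1 / bracket z) * ennreal (C + D)" by (intro mult_left_mono *) auto
    also have "\<dots> = ennreal ((C + D) / bracket z)" by (simp add: ennreal_mult'[symmetric] less_imp_le)
    finally show ?thesis .
  qed
  then show ?thesis using C D by (intro exI[of _ "C + D"]) auto
qed

subsection \<open>The Cauchy--Pompeiu formula\<close>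

lemma compact_support_bounded:
  fixes f :: "complex \<Rightarrow> complex"
  assumes "continuous_on UNIV f" "\<And>z. f z \<noteq> 0 \<Longrightarrow> cmod z \<le> R"
  obtains M where "0 \<le> M" "\<And>z. cmod (f z) \<le> M"
proof -
  have "compact (f ` cball 0 R)"
    by (intro compact_continuous_image continuous_on_subset[OF assms(1)]) auto
  then obtain M where M: "0 < M" "\<And>y. y \<in> f ` cball 0 R \<Longrightarrow> norm y \<le> M"
    using compact_imp_bounded bounded_pos by metis
  have "cmod (f z) \<le> M" for z
    using M assms(2)[of z] by (cases "f z = 0") auto
  with M(1) that show ?thesis by (metis less_imp_le)
qed

lemma compact_support_integrable:
  fixes f :: "complex \<Rightarrow> complex"
  assumes "continuous_on UNIV f" "\<And>z. f z \<noteq> 0 \<Longrightarrow> cmod z \<le> R"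
  shows "integrable lborel f"
proof -
  have "integrable lborel (\<lambda>x. indicator (cball 0 R) x *\<^sub>R f x)"
    by (rule borel_integrable_compact) (auto intro: continuous_on_subset[OF assms(1)])
  moreover have "(\<lambda>x. indicator (cball 0 R) x *\<^sub>R f x) = f"
    using assms(2) by (auto simp: indicator_def fun_eq_iff)
  ultimately show ?thesis by simp
qed

lemma compact_support_derivative_eq_0:
  fixes f :: "complex \<Rightarrow> complex"
  assumes "(f has_derivative D) (at z)" "\<And>z. f z \<noteq> 0 \<Longrightarrow> cmod z \<le> R" "R < cmod z"
  shows "D h = 0"
proof -
  have "open {z::complex. R < cmod z}" by (intro open_Collect_less continuous_intros)
  then have "(f has_derivative (\<lambda>_. 0)) (at z)"
    by (rule has_derivative_transform_within_open[OF has_derivative_const[of 0]])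
      (use assms in \<open>auto simp: not_le[symmetric]\<close>)
  with assms(1) have "D = (\<lambda>_. 0)" by (rule has_derivative_unique)
  then show ?thesis by simp
qed

text \<open>Mean value inequality on the segment from \<open>z\<close> to \<open>z + h\<close>.
  Bounding \<open>D z h\<close> for this one \<open>h\<close>, not the operator norm, lets
  \<open>M\<close> carry the length of the step.\<close>

lemma directional_difference_bound:
  fixes f :: "complex \<Rightarrow> complex"
  assumes "\<And>z. (f has_derivative D z) (at z)" "\<And>z. cmod (D z h) \<le> M"
  shows "cmod (f (z + h) - f z) \<le> M"
proof -
  have "norm (f (z + 1 *\<^sub>R h) - f (z + 0 *\<^sub>R h)) \<le> M * norm (1 - 0 :: real)"
  proof (rule differentiable_bound[where S="{0..1::real}" and f="\<lambda>t. f (z + t *\<^sub>R h)"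
        and f'="\<lambda>t s. s *\<^sub>R D (z + t *\<^sub>R h) h"])
    fix t :: real
    interpret L: bounded_linear "D (z + t *\<^sub>R h)" by (rule has_derivative_bounded_linear[OF assms(1)])
    have "((\<lambda>t. f (z + t *\<^sub>R h)) has_derivative (\<lambda>s. D (z + t *\<^sub>R h) (s *\<^sub>R h))) (at t)"
      by (rule has_derivative_compose[where f="\<lambda>t. z + t *\<^sub>R h" and f'="\<lambda>s. s *\<^sub>R h" and s=UNIV and g=f, OF _ assms(1)])
         (auto intro!: derivative_eq_intros)
    then show "((\<lambda>t. f (z + t *\<^sub>R h)) has_derivative (\<lambda>s. s *\<^sub>R D (z + t *\<^sub>R h) h)) (at t within {0..1})"
      by (simp add: L.scaleR has_derivative_at_withinI)
    show "onorm (\<lambda>s. s *\<^sub>R D (z + t *\<^sub>R h) h) \<le> M"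
      by (rule onorm_le) (simp add: assms(2) mult.commute[of M] mult_left_mono)
  qed auto
  then show ?thesis by simp
qed

text \<open>The integral of each difference quotient vanishes by translation invariance of Lebesgue
  measure, and dominated convergence carries this over to the derivative.\<close>

lemma integral_directional_derivative_eq_0:
  fixes f :: "complex \<Rightarrow> complex"
  assumes D: "\<And>z. (f has_derivative D z) (at z)"
    and c: "continuous_on UNIV (\<lambda>z. D z h)"
    and R: "\<And>z. f z \<noteq> 0 \<Longrightarrow> cmod z \<le> R"
  shows "(LINT z|lborel. D z h) = 0"
proof -
  have lin: "bounded_linear (D z)" for z by (rule has_derivative_bounded_linear[OF D])
  have cf: "continuous_on UNIV f"
    by (rule continuous_at_imp_continuous_on) (use has_derivative_continuous[OF D] in blast)
  have D0: "D z h \<noteq> 0 \<Longrightarrow> cmod z \<le> R" for z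
    using compact_support_derivative_eq_0[OF D[of z], of R h] R by (meson not_le)
  obtain M where M: "0 \<le> M" "\<And>z. cmod (D z h) \<le> M" using compact_support_bounded[OF c D0] by blast
  have fi: "integrable lborel f" by (rule compact_support_integrable[OF cf R])
  have fm[measurable]: "f \<in> borel_measurable borel" using fi by auto
  let ?s = "\<lambda>n z. (f (z + (1 / real (Suc n)) *\<^sub>R h) - f z) /\<^sub>R (1 / real (Suc n))"
  \<comment> \<open>Steps h/(n + 1) displace the support by at most |h|, so all quotients vanish
    outside the disc of radius \<open>R + cmod h\<close>; on it the mean value inequality bounds
    them by \<open>M\<close>.\<close>
  have "(\<lambda>n. LINT z|lborel. ?s n z) \<longlonglongrightarrow> (LINT z|lborel. D z h)"
  proof (rule integral_dominated_convergence[where w="\<lambda>z. indicator (cball 0 (R + cmod h)) z *\<^sub>R M"])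
    show "(\<lambda>z. D z h) \<in> borel_measurable lborel" using c by (simp add: borel_measurable_continuous_onI)
    show "integrable lborel (\<lambda>z. indicator (cball 0 (R + cmod h)) z *\<^sub>R M)"
      by (rule borel_integrable_compact) auto
    show "AE z in lborel. (\<lambda>n. ?s n z) \<longlonglongrightarrow> D z h"
    proof (rule AE_I2)
      fix z
      let ?F = "\<lambda>t. f (z + t *\<^sub>R h)"
      interpret L: bounded_linear "D z" by (rule lin)
      have "(?F has_derivative (\<lambda>s. D (z + 0 *\<^sub>R h) (s *\<^sub>R h))) (at 0)"
        by (rule has_derivative_compose[where f="\<lambda>t. z + t *\<^sub>R h" and f'="\<lambda>s. s *\<^sub>R h" and s=UNIV and g=f, OF _ D])
           (auto intro!: derivative_eq_intros)
      then have "(?F has_derivative (\<lambda>s. s *\<^sub>R D z h)) (at 0)" by (simp add: L.scaleR)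
      then have 0: "((\<lambda>y. norm (?F (0 + y) - ?F 0 - y *\<^sub>R D z h) / norm y) \<longlongrightarrow> 0) (at 0)"
        unfolding has_derivative_at by blast
      have "((\<lambda>y. norm ((f (z + y *\<^sub>R h) - f z) /\<^sub>R y - D z h)) \<longlongrightarrow> 0) (at 0)"
      proof (rule Lim_transform_eventually[OF 0])
        have "norm (w - y *\<^sub>R v) / norm y = norm (w /\<^sub>R y - v)" if "y \<noteq> 0" for w v :: complex and y :: real
        proof -
          have "w /\<^sub>R y - v = (w - y *\<^sub>R v) /\<^sub>R y" using that by (simp add: scaleR_diff_right)
          then show ?thesis by (simp add: divide_inverse mult.commute)
        qed
        then show "\<forall>\<^sub>F y in at 0. norm (?F (0 + y) - ?F 0 - y *\<^sub>R D z h) / norm y = norm ((f (z + y *\<^sub>R h) - f z) /\<^sub>R y - D z h)"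
          by (auto simp: eventually_at_filter)
      qed
      then have "((\<lambda>y. (f (z + y *\<^sub>R h) - f z) /\<^sub>R y) \<longlongrightarrow> D z h) (at 0)"
        by (metis (no_types) LIM_zero_cancel tendsto_norm_zero_cancel)
      moreover have "filterlim (\<lambda>n. 1 / real (Suc n)) (at 0) sequentially"
        using LIMSEQ_inverse_real_of_nat by (simp add: filterlim_at inverse_eq_divide)
      ultimately show "(\<lambda>n. ?s n z) \<longlonglongrightarrow> D z h"
        by (rule filterlim_compose)
    qed
    fix n
    show "AE z in lborel. norm (?s n z) \<le> indicator (cball 0 (R + cmod h)) z *\<^sub>R M"
    proof (rule AE_I2)
      fix z
      let ?h = "(1 / real (Suc n)) *\<^sub>R h"
      have "cmod (f (z + ?h) - f z) \<le> M / real (Suc n)"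
      proof (rule directional_difference_bound[OF D])
        fix w
        interpret L: bounded_linear "D w" by (rule lin)
        show "cmod (D w ?h) \<le> M / real (Suc n)"
          unfolding L.scaleR using M(2)[of w] by (simp add: divide_right_mono)
      qed
      then have "real (Suc n) * cmod (f (z + ?h) - f z) \<le> real (Suc n) * (M / real (Suc n))"
        by (rule mult_left_mono) simp
      then have le: "cmod (?s n z) \<le> M" unfolding norm_scaleR by simp
      have "?s n z = 0" if "R + cmod h < cmod z"
      proof -
        have "cmod ?h \<le> cmod h" by (simp add: field_simps mult_left_le)
        moreover have "cmod z \<le> cmod (z + ?h) + cmod ?h" using norm_triangle_ineq4[of "z + ?h" ?h] by simp
        ultimately have "R < cmod (z + ?h)" "R < cmod z" using that norm_ge_zero[of h] by linarith+
        then have "f (z + ?h) = 0" "f z = 0" using R by (meson not_le)+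
        then show ?thesis by simp
      qed
      with le show "norm (?s n z) \<le> indicator (cball 0 (R + cmod h)) z *\<^sub>R M"
        by (cases "R + cmod h < cmod z") (auto simp: not_le indicator_def)
    qed
  qed measurable
  moreover have "(LINT z|lborel. ?s n z) = 0" for n
  proof -
    let ?h = "(1 / real (Suc n)) *\<^sub>R h"
    have "integrable lborel (\<lambda>z. f (z + ?h))"
    proof (rule compact_support_integrable[where R="R + cmod ?h"])
      show "continuous_on UNIV (\<lambda>z. f (z + ?h))"
        by (auto intro!: continuous_on_compose2[OF cf] continuous_intros)
      fix z assume "f (z + ?h) \<noteq> 0"
      then have "cmod (z + ?h) \<le> R" by (rule R)
      then show "cmod z \<le> R + cmod ?h" using norm_triangle_ineq4[of "z + ?h" ?h] by simp
    qed
    moreover have "(LINT z|lborel. f (z + ?h)) = (LINT z|lborel. f z)"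
      using lborel_integral_affine[OF fm, of 1 ?h] by (simp add: add.commute)
    ultimately show ?thesis using fi by simp
  qed
  ultimately show ?thesis using LIMSEQ_unique[OF _ tendsto_const[of 0]] by simp
qed

lemma integral_dbar_eq_0:
  fixes f :: "complex \<Rightarrow> complex"
  assumes D: "\<And>z. (f has_derivative D z) (at z)"
    and c: "\<And>h. continuous_on UNIV (\<lambda>z. D z h)"
    and R: "\<And>z. f z \<noteq> 0 \<Longrightarrow> cmod z \<le> R"
  shows "(LINT z|lborel. dbar f z) = 0"
proof -
  have i: "integrable lborel (\<lambda>z. D z h)" for h
    by (rule compact_support_integrable[OF c, of _ R])
      (use compact_support_derivative_eq_0[OF D, of R] R in \<open>meson not_le\<close>)
  have "(LINT z|lborel. dbar f z) = (LINT z|lborel. (D z 1 + \<i> * D z \<i>) / 2)"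
    by (simp only: partial_derivs(3)[OF D])
  also have "\<dots> = ((LINT z|lborel. D z 1) + \<i> * (LINT z|lborel. D z \<i>)) / 2"
    using i by simp
  also have "\<dots> = 0" using integral_directional_derivative_eq_0[OF D c R] by simp
  finally show ?thesis .
qed

text \<open>The exponent -3 is chosen to match \<open>riesz_kernel_decay\<close>.\<close>

lemma bracket_powr_dominates:
  fixes g :: "complex \<Rightarrow> complex"
  assumes "continuous_on UNIV g" "\<And>z. g z \<noteq> 0 \<Longrightarrow> cmod z \<le> R"
  obtains M where "0 \<le> M" "\<And>z. cmod (g z) \<le> M * bracket z powr -3"
proof -
  have "continuous_on UNIV (\<lambda>z. g z * of_real (bracket z powr 3))"
    using assms(1) by (auto intro!: continuous_intros)
  then obtain M where M: "0 \<le> M" "\<And>z. cmod (g z * of_real (bracket z powr 3)) \<le> M"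
    using compact_support_bounded[of "\<lambda>z. g z * of_real (bracket z powr 3)" R] assms(2) by auto
  have "cmod (g z) \<le> M * bracket z powr -3" for z
  proof -
    have "cmod (g z) = cmod (g z * of_real (bracket z powr 3)) * bracket z powr -3"
      by (simp add: norm_mult norm_power powr_minus)
    also have "\<dots> \<le> M * bracket z powr -3" using M(2)[of z] by (intro mult_right_mono) auto
    finally show ?thesis .
  qed
  with M(1) that show ?thesis by blast
qed

text \<open>The decay is used twice: it gives the absolute convergence behind Fubini's theorem for
  the Cauchy transform, and the size at infinity of the convolution in the uniqueness proof.\<close>

lemma nn_integral_cauchy_kernel:
  fixes g :: "complex \<Rightarrow> complex"
  assumes "continuous_on UNIV g" "\<And>z. g z \<noteq> 0 \<Longrightarrow> cmod z \<le> R"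
  obtains C where "0 \<le> C" "\<And>z. (\<integral>\<^sup>+x. ennreal (cmod (g x / (z - x))) \<partial>lborel) \<le> ennreal (C / bracket z)"
proof -
  obtain M where M: "0 \<le> M" "\<And>z. cmod (g z) \<le> M * bracket z powr -3" using bracket_powr_dominates[OF assms] by blast
  obtain C where C: "0 \<le> C" "\<And>z. (\<integral>\<^sup>+x. ennreal (bracket x powr -3 / cmod (z - x)) \<partial>lborel) \<le> ennreal (C / bracket z)"
    using riesz_kernel_decay by blast
  have "(\<integral>\<^sup>+x. ennreal (cmod (g x / (z - x))) \<partial>lborel) \<le> ennreal (M * C / bracket z)" for z
  proof -
    have "(\<integral>\<^sup>+x. ennreal (cmod (g x / (z - x))) \<partial>lborel) \<le>
        (\<integral>\<^sup>+x. ennreal M * ennreal (bracket x powr -3 / cmod (z - x)) \<partial>lborel)"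
      using M by (intro nn_integral_mono)
        (auto simp: norm_divide ennreal_mult'[symmetric] intro!: ennreal_leI divide_right_mono)
    also have "\<dots> = ennreal M * (\<integral>\<^sup>+x. ennreal (bracket x powr -3 / cmod (z - x)) \<partial>lborel)"
      by (rule nn_integral_cmult) measurable
    also have "\<dots> \<le> ennreal M * ennreal (C / bracket z)" by (intro mult_left_mono C) auto
    also have "\<dots> = ennreal (M * C / bracket z)" using M by (simp add: ennreal_mult'[symmetric])
    finally show ?thesis .
  qed
  then show ?thesis using that[of "M * C"] M C by auto
qed

lemma integrable_cauchy_kernel:
  fixes g :: "complex \<Rightarrow> complex"
  assumes "continuous_on UNIV g" "\<And>z. g z \<noteq> 0 \<Longrightarrow> cmod z \<le> R"
  shows "integrable lborel (\<lambda>x. g x / (z - x))"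
proof (rule integrableI_bounded)
  have [measurable]: "g \<in> borel_measurable borel" by (rule borel_measurable_continuous_onI[OF assms(1)])
  show "(\<lambda>x. g x / (z - x)) \<in> borel_measurable lborel" by measurable
  obtain C where "(\<integral>\<^sup>+x. ennreal (cmod (g x / (z - x))) \<partial>lborel) \<le> ennreal (C / bracket z)"
    using nn_integral_cauchy_kernel[OF assms] by blast
  then show "(\<integral>\<^sup>+x. ennreal (cmod (g x / (z - x))) \<partial>lborel) < \<infinity>"
    by (rule le_less_trans) simp
qed

lemma integrable_bracket_powr: "2 < t \<Longrightarrow> integrable lborel (\<lambda>z. bracket z powr -t)"
  by (rule integrableI_bounded) (use nn_integral_bracket_powr[of t] in auto)

section \<open>The regularized kernel and its limit\<close>

lemma dbar_translate:
  assumes "f differentiable (at (z + a))" shows "dbar (\<lambda>z. f (z + a)) z = dbar f (z + a)"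
proof -
  have "(f has_derivative frechet_derivative f (at (z + a))) (at (z + a))"
    using assms frechet_derivative_works by blast
  then have "((\<lambda>z. f (z + a)) has_derivative frechet_derivative f (at (z + a))) (at z)"
    by (rule has_derivative_compose[where f="\<lambda>z. z + a" and f'="\<lambda>h. h", OF _ , simplified o_def, rotated])
       (auto intro!: derivative_eq_intros)
  from partial_derivs(3)[OF this] show ?thesis by (simp add: dbar_def partial_x_def partial_y_def)
qed

text \<open>A smooth regularization of \<open>1 / z\<close>; its image under \<open>dbar\<close> is an approximate identity, up to the
  factor \<open>cauchy_const\<close>.\<close>

definition reg_kernel :: "real \<Rightarrow> complex \<Rightarrow> complex" where
  "reg_kernel d z = inverse ((cmod z)\<^sup>2 + d\<^sup>2) *\<^sub>R cnj z"

lemma reg_kernel_pos: "0 < d \<Longrightarrow> 0 < (cmod z)\<^sup>2 + (d::real)\<^sup>2"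
  by (simp add: add_nonneg_pos)

lemma reg_kernel_has_derivative:
  assumes "0 < d"
  shows "(reg_kernel d has_derivative (\<lambda>h. inverse ((cmod z)\<^sup>2 + d\<^sup>2) *\<^sub>R cnj h
    - (2 * (z \<bullet> h) * (inverse ((cmod z)\<^sup>2 + d\<^sup>2))\<^sup>2) *\<^sub>R cnj z)) (at z)"
proof -
  have p: "z \<bullet> z + d\<^sup>2 \<noteq> 0" using reg_kernel_pos[OF assms, of z] by (simp add: power2_norm_eq_inner)
  have "((\<lambda>z. z \<bullet> z + d\<^sup>2) has_derivative (\<lambda>h. 2 * (z \<bullet> h))) (at z)"
    by (auto intro!: derivative_eq_intros simp: inner_commute)
  from Deriv.has_derivative_inverse[OF p this]
  have "((\<lambda>z. inverse (z \<bullet> z + d\<^sup>2)) has_derivative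
      (\<lambda>h. - (inverse (z \<bullet> z + d\<^sup>2) * (2 * (z \<bullet> h)) * inverse (z \<bullet> z + d\<^sup>2)))) (at z)" .
  from has_derivative_scaleR[OF this bounded_linear_imp_has_derivative[OF bounded_linear_cnj]]
  show ?thesis
    unfolding reg_kernel_def[abs_def] power2_norm_eq_inner
    by (rule has_derivative_eq_rhs) (simp add: fun_eq_iff power2_eq_square mult_ac)
qed

text \<open>With \<open>r\<close> for the reciprocal, the derivative formula yields r - |z|^2 r^2.
  Relation \<open>q\<close> identifies this with d^2 r^2, so no division remains in the final
  comparison of real and imaginary parts.\<close>

lemma dbar_reg_kernel:
  assumes "0 < d"
  shows "dbar (reg_kernel d) z = of_real (d\<^sup>2 / ((cmod z)\<^sup>2 + d\<^sup>2)\<^sup>2)"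
proof -
  define r where "r = inverse ((cmod z)\<^sup>2 + d\<^sup>2)"
  have q: "((cmod z)\<^sup>2 + d\<^sup>2) * r = 1" using less_imp_neq[OF reg_kernel_pos[OF assms, of z]] by (simp add: r_def)
  have "d\<^sup>2 / ((cmod z)\<^sup>2 + d\<^sup>2)\<^sup>2 = d\<^sup>2 * r\<^sup>2" by (simp add: r_def divide_inverse power_inverse)
  also have "\<dots> = r * (((cmod z)\<^sup>2 + d\<^sup>2) * r) - (cmod z)\<^sup>2 * r\<^sup>2" by (simp add: power2_eq_square algebra_simps)
  also have "\<dots> = r - ((Re z)\<^sup>2 + (Im z)\<^sup>2) * r\<^sup>2" unfolding q by (simp add: cmod_power2)
  finally have e: "d\<^sup>2 / ((cmod z)\<^sup>2 + d\<^sup>2)\<^sup>2 = r - ((Re z)\<^sup>2 + (Im z)\<^sup>2) * r\<^sup>2" .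
  show ?thesis
    unfolding e partial_derivs(3)[OF reg_kernel_has_derivative[OF assms]] r_def[symmetric]
    by (simp add: complex_eq_iff inner_complex_def power2_eq_square algebra_simps
      add_divide_distrib diff_divide_distrib)
qed

text \<open>At \<open>z = 0\<close> the statement relies on \<open>1 / 0 = 0\<close>, which agrees
  with the value of the regularized kernel there.\<close>

lemma reg_kernel_tendsto: "(\<lambda>n. reg_kernel (1 / real (Suc n)) z) \<longlonglongrightarrow> 1 / z"
proof (cases "z = 0")
  case False
  have "(\<lambda>n. 1 / real (Suc n)) \<longlonglongrightarrow> 0"
    using LIMSEQ_inverse_real_of_nat by (simp add: inverse_eq_divide)
  then have "(\<lambda>n. reg_kernel (1 / real (Suc n)) z) \<longlonglongrightarrow> inverse ((cmod z)\<^sup>2 + 0\<^sup>2) *\<^sub>R cnj z"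
    unfolding reg_kernel_def using False by (intro tendsto_intros) auto
  also have "inverse ((cmod z)\<^sup>2 + 0\<^sup>2) *\<^sub>R cnj z = 1 / z"
    using False complex_norm_square[of z] by (simp add: scaleR_conv_of_real field_simps)
  finally show ?thesis .
qed (simp add: reg_kernel_def)

lemma reg_kernel_norm_le: "cmod (reg_kernel d z) \<le> 1 / cmod z"
proof (cases "z = 0")
  case False
  then have p: "0 < (cmod z)\<^sup>2" by simp
  have "cmod (reg_kernel d z) = cmod z / ((cmod z)\<^sup>2 + d\<^sup>2)"
    by (simp add: reg_kernel_def divide_inverse abs_of_nonneg)
  also have "\<dots> \<le> cmod z / (cmod z)\<^sup>2" using p by (intro divide_left_mono mult_pos_pos add_pos_nonneg) auto
  also have "\<dots> = 1 / cmod z" using False by (simp add: power2_eq_square)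
  finally show ?thesis .
qed (simp add: reg_kernel_def)

lemma reg_kernel_continuous: "0 < d \<Longrightarrow> continuous_on A (reg_kernel d)"
  unfolding reg_kernel_def[abs_def]
  using reg_kernel_pos by (intro continuous_intros) (auto simp: less_imp_neq[symmetric])

lemma reg_kernel_measurable [measurable]: "reg_kernel d \<in> borel_measurable borel"
proof -
  have [measurable]: "cnj \<in> borel_measurable borel"
    by (intro borel_measurable_continuous_onI continuous_intros)
  show ?thesis unfolding reg_kernel_def[abs_def] by measurable
qed

lemma dbar_support:
  assumes "smooth \<phi>" "\<And>z. \<phi> z \<noteq> 0 \<Longrightarrow> cmod z \<le> R" "dbar \<phi> z \<noteq> 0"
  shows "cmod z \<le> R"
proof (rule ccontr)
  assume "\<not> cmod z \<le> R"
  then have "frechet_derivative \<phi> (at z) h = 0" for h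
    using compact_support_derivative_eq_0[of \<phi> "frechet_derivative \<phi> (at z)" z R h]
      frechet_derivative_works smooth_differentiable[OF assms(1)] assms(2) by auto
  then show False using assms(3) by (simp add: dbar_def partial_x_def partial_y_def)
qed

text \<open>Integration by parts: the product of \<open>\<phi>\<close> and the kernel is
  differentiable with compact support, so its \<open>dbar\<close> integrates to 0, and the product
  rule splits that integral.\<close>

lemma integral_dbar_reg_kernel:
  assumes s: "smooth \<phi>" and R: "\<And>z. \<phi> z \<noteq> 0 \<Longrightarrow> cmod z \<le> R" and d: "0 < d"
  shows "(LINT z|lborel. dbar \<phi> z * reg_kernel d z) = - (LINT z|lborel. \<phi> z * of_real (d\<^sup>2 / ((cmod z)\<^sup>2 + d\<^sup>2)\<^sup>2))"
proof -
  note [continuous_intros] = smooth_continuous[OF s] smooth_continuous[OF smooth_partials(1)[OF s]]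
    smooth_continuous[OF smooth_partials(2)[OF s]] smooth_continuous[OF smooth_dbar[OF s]] reg_kernel_continuous[OF d]
  note nz = less_imp_neq[OF reg_kernel_pos[OF d], symmetric]
  have k: "reg_kernel d differentiable (at z)" for z
    using reg_kernel_has_derivative[OF d] by (auto simp: differentiable_def)
  have dR: "cmod z \<le> R" if "dbar \<phi> z \<noteq> 0" for z
    using dbar_support[OF s R] that by blast
  have "(LINT z|lborel. dbar (\<lambda>z. \<phi> z * reg_kernel d z) z) = 0"
  proof (rule integral_dbar_eq_0[OF has_derivative_mult[OF has_derivative_partials[OF smooth_differentiable[OF s]] reg_kernel_has_derivative[OF d]]])
    show "continuous_on UNIV (\<lambda>z. \<phi> z * (inverse ((cmod z)\<^sup>2 + d\<^sup>2) *\<^sub>R cnj h - (2 * (z \<bullet> h) * (inverse ((cmod z)\<^sup>2 + d\<^sup>2))\<^sup>2) *\<^sub>R cnj z) +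
       (of_real (Re h) * partial_x \<phi> z + of_real (Im h) * partial_y \<phi> z) * reg_kernel d z)" for h
      by (intro continuous_intros ballI nz)
  qed (use R in auto)
  also have "(LINT z|lborel. dbar (\<lambda>z. \<phi> z * reg_kernel d z) z) =
      (LINT z|lborel. \<phi> z * of_real (d\<^sup>2 / ((cmod z)\<^sup>2 + d\<^sup>2)\<^sup>2) + dbar \<phi> z * reg_kernel d z)"
    by (simp only: dbar_mult[OF smooth_differentiable[OF s] k] dbar_reg_kernel[OF d])
  also have "\<dots> = (LINT z|lborel. \<phi> z * of_real (d\<^sup>2 / ((cmod z)\<^sup>2 + d\<^sup>2)\<^sup>2)) + (LINT z|lborel. dbar \<phi> z * reg_kernel d z)"
  proof (rule Bochner_Integration.integral_add)
    show "integrable lborel (\<lambda>z. \<phi> z * of_real (d\<^sup>2 / ((cmod z)\<^sup>2 + d\<^sup>2)\<^sup>2))"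
      by (rule compact_support_integrable[of _ R], intro continuous_intros ballI)
         (use R nz in \<open>auto\<close>)
    show "integrable lborel (\<lambda>z. dbar \<phi> z * reg_kernel d z)"
      by (rule compact_support_integrable[of _ R], intro continuous_intros) (use dR in auto)
  qed
  finally show ?thesis by (simp add: eq_neg_iff_add_eq_0 add.commute)
qed

text \<open>The value is \<open>\<pi>\<close>, but only \<open>cauchy_const \<noteq> 0\<close> matters.\<close>

definition cauchy_const :: real where
  "cauchy_const = (LINT w|lborel. bracket w powr -4)"

lemma cauchy_const_nonzero: "cauchy_const \<noteq> 0"
proof
  assume "cauchy_const = 0"
  then have "AE w in lborel. bracket w powr -4 = 0"
    unfolding cauchy_const_def
    by (subst (asm) integral_nonneg_eq_0_iff_AE) (auto intro: integrable_bracket_powr)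
  then have "AE w::complex in lborel. False" by simp
  then show False using AE_iff_null[of lborel "\<lambda>_::complex. False"] by (simp add: null_sets_def)
qed

text \<open>Substitute z = d w. The Jacobian d^2 makes the density independent of \<open>d\<close>,
  which survives only in the argument of \<open>\<phi>\<close>; dominated convergence as d tends to
  0 becomes possible.\<close>

lemma dirac_integral:
  fixes \<phi> :: "complex \<Rightarrow> complex"
  assumes d: "0 < d" and [measurable]: "\<phi> \<in> borel_measurable borel"
  shows "(LINT z|lborel. \<phi> z * of_real (d\<^sup>2 / ((cmod z)\<^sup>2 + d\<^sup>2)\<^sup>2)) =
    (LINT w|lborel. \<phi> (d *\<^sub>R w) * of_real (bracket w powr -4))"
proof -
  have "(LINT z|lborel. \<phi> z * of_real (d\<^sup>2 / ((cmod z)\<^sup>2 + d\<^sup>2)\<^sup>2)) =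
    (\<bar>d\<bar> ^ DIM(complex)) *\<^sub>R (LINT w|lborel. \<phi> (0 + d *\<^sub>R w) * of_real (d\<^sup>2 / ((cmod (0 + d *\<^sub>R w))\<^sup>2 + d\<^sup>2)\<^sup>2))"
    by (rule lborel_integral_affine) (use d in auto)
  also have "\<dots> = (LINT w|lborel. d\<^sup>2 *\<^sub>R (\<phi> (d *\<^sub>R w) * of_real (d\<^sup>2 / ((cmod (d *\<^sub>R w))\<^sup>2 + d\<^sup>2)\<^sup>2)))"
    by simp
  also have "\<dots> = (LINT w|lborel. \<phi> (d *\<^sub>R w) * of_real (bracket w powr -4))"
  proof (rule Bochner_Integration.integral_cong[OF refl])
    fix w
    have "(cmod (d *\<^sub>R w))\<^sup>2 + d\<^sup>2 = d\<^sup>2 * (bracket w)\<^sup>2"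
      by (simp add: bracket_sq power_mult_distrib algebra_simps)
    then have e: "d\<^sup>2 * (d\<^sup>2 / ((cmod (d *\<^sub>R w))\<^sup>2 + d\<^sup>2)\<^sup>2) = bracket w powr -4"
      using d by (simp add: powr_minus field_simps)
    show "d\<^sup>2 *\<^sub>R (\<phi> (d *\<^sub>R w) * of_real (d\<^sup>2 / ((cmod (d *\<^sub>R w))\<^sup>2 + d\<^sup>2)\<^sup>2)) = \<phi> (d *\<^sub>R w) * of_real (bracket w powr -4)"
      unfolding e[symmetric] by (simp only: scaleR_conv_of_real of_real_mult mult_ac)
  qed
  finally show ?thesis .
qed

text \<open>Let d = 1/(n + 1) tend to 0 in the integration by parts. The left side is dominated by
  |dbar \<phi>| / |z|; the right side, after rescaling, by a constant times the integrable power -4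
  of the bracket.\<close>

lemma cauchy_pompeiu_0:
  assumes s: "smooth \<phi>" and R: "\<And>z. \<phi> z \<noteq> 0 \<Longrightarrow> cmod z \<le> R"
  shows "(LINT z|lborel. dbar \<phi> z / z) = - of_real cauchy_const * \<phi> 0"
proof -
  let ?d = "\<lambda>n. 1 / real (Suc n)"
  have cd: "continuous_on UNIV (dbar \<phi>)" by (rule smooth_continuous[OF smooth_dbar[OF s]])
  have [measurable]: "dbar \<phi> \<in> borel_measurable borel" "\<phi> \<in> borel_measurable borel"
    using cd smooth_continuous[OF s] by (auto intro!: borel_measurable_continuous_onI)
  \<comment> \<open>The denominator is kept as \<open>0 - z\<close> so that it is the Cauchy kernel
    with pole at 0.\<close>
  have i: "integrable lborel (\<lambda>z. cmod (dbar \<phi> z / (0 - z)))"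
    by (intro integrable_norm integrable_cauchy_kernel[OF cd, of R]) (use dbar_support[OF s R] in blast)
  have 1: "(\<lambda>n. LINT z|lborel. dbar \<phi> z * reg_kernel (?d n) z) \<longlonglongrightarrow> (LINT z|lborel. dbar \<phi> z / z)"
  proof (rule integral_dominated_convergence[where w="\<lambda>z. cmod (dbar \<phi> z / (0 - z))"])
    show "AE z in lborel. (\<lambda>n. dbar \<phi> z * reg_kernel (?d n) z) \<longlonglongrightarrow> dbar \<phi> z / z"
      using tendsto_mult[OF tendsto_const reg_kernel_tendsto] by (intro AE_I2) (metis times_divide_eq_right mult.right_neutral)
    show "AE z in lborel. norm (dbar \<phi> z * reg_kernel (?d n) z) \<le> cmod (dbar \<phi> z / (0 - z))" for n
      using mult_left_mono[OF reg_kernel_norm_le norm_ge_zero] by (intro AE_I2) (auto simp: norm_mult norm_divide)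
  qed (use i in auto)
  obtain M where M: "\<And>z. cmod (\<phi> z) \<le> M" using compact_support_bounded[OF smooth_continuous[OF s] R] by blast
  have lim: "?d \<longlonglongrightarrow> 0" using LIMSEQ_inverse_real_of_nat by (simp add: inverse_eq_divide)
  have 2: "(\<lambda>n. LINT w|lborel. \<phi> (?d n *\<^sub>R w) * of_real (bracket w powr -4)) \<longlonglongrightarrow> (LINT w|lborel. \<phi> 0 * of_real (bracket w powr -4))"
  proof (rule integral_dominated_convergence[where w="\<lambda>w. M * bracket w powr -4"])
    show "integrable lborel (\<lambda>w. M * bracket w powr -4)"
      by (intro integrable_mult_right integrable_bracket_powr) auto
    show "AE w in lborel. (\<lambda>n. \<phi> (?d n *\<^sub>R w) * of_real (bracket w powr -4)) \<longlonglongrightarrow> \<phi> 0 * of_real (bracket w powr -4)"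
    proof (rule AE_I2)
      fix w :: complex
      have "(\<lambda>n. ?d n *\<^sub>R w) \<longlonglongrightarrow> 0 *\<^sub>R w" by (intro tendsto_intros lim)
      moreover have "isCont \<phi> (0 *\<^sub>R w)"
        using smooth_continuous[OF s, of UNIV] by (simp add: continuous_on_eq_continuous_at)
      ultimately have "(\<lambda>n. \<phi> (?d n *\<^sub>R w)) \<longlonglongrightarrow> \<phi> (0 *\<^sub>R w)" by (rule isCont_tendsto_compose[rotated])
      then show "(\<lambda>n. \<phi> (?d n *\<^sub>R w) * of_real (bracket w powr -4)) \<longlonglongrightarrow> \<phi> 0 * of_real (bracket w powr -4)"
        by (intro tendsto_intros) simp
    qed
    show "AE w in lborel. norm (\<phi> (?d n *\<^sub>R w) * of_real (bracket w powr -4)) \<le> M * bracket w powr -4" for n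
      using M mult_right_mono[OF M powr_ge_zero] by (intro AE_I2) (simp only: norm_mult norm_of_real abs_of_nonneg[OF powr_ge_zero])
  qed auto
  have "(LINT z|lborel. dbar \<phi> z * reg_kernel (?d n) z) = - (LINT w|lborel. \<phi> (?d n *\<^sub>R w) * of_real (bracket w powr -4))" for n
    by (subst integral_dbar_reg_kernel[OF s R], simp, simp, subst dirac_integral) auto
  with 1 have "(\<lambda>n. - (LINT w|lborel. \<phi> (?d n *\<^sub>R w) * of_real (bracket w powr -4))) \<longlonglongrightarrow> (LINT z|lborel. dbar \<phi> z / z)"
    by simp
  from LIMSEQ_unique[OF this tendsto_minus[OF 2]]
  have "(LINT z|lborel. dbar \<phi> z / z) = - (LINT w|lborel. \<phi> 0 * of_real (bracket w powr -4))" .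
  also have "\<dots> = - of_real cauchy_const * \<phi> 0"
    by (simp only: integral_mult_right_zero integral_complex_of_real cauchy_const_def mult_minus_left mult_minus_right mult.commute)
  finally show ?thesis .
qed

text \<open>Translation by \<open>a\<close> moves the pole to 0. The denominator then becomes -z,
  which cancels the minus sign of the previous formula.\<close>

lemma cauchy_pompeiu:
  assumes s: "smooth \<phi>" and R: "\<And>z. \<phi> z \<noteq> 0 \<Longrightarrow> cmod z \<le> R"
  shows "(LINT z|lborel. dbar \<phi> z / (a - z)) = of_real cauchy_const * \<phi> a"
proof -
  have [measurable]: "dbar \<phi> \<in> borel_measurable borel"
    by (intro borel_measurable_continuous_onI smooth_continuous smooth_dbar s)
  have "(LINT z|lborel. dbar \<phi> z / (a - z)) = (LINT z|lborel. dbar \<phi> (a + 1 *\<^sub>R z) / (a - (a + 1 *\<^sub>R z)))"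
    by (subst lborel_integral_affine[of _ 1 a]) auto
  also have "\<dots> = (LINT z|lborel. - (dbar (\<lambda>z. \<phi> (z + a)) z / z))"
    by (simp add: dbar_translate[OF smooth_differentiable[OF s]] add.commute)
  also have "\<dots> = of_real cauchy_const * \<phi> a"
  proof -
    have "(LINT z|lborel. dbar (\<lambda>z. \<phi> (z + a)) z / z) = - of_real cauchy_const * \<phi> (0 + a)"
    proof (rule cauchy_pompeiu_0[OF smooth_translate[OF s], of _ "R + cmod a"])
      fix z assume "\<phi> (z + a) \<noteq> 0"
      then have "cmod (z + a) \<le> R" by (rule R)
      then show "cmod z \<le> R + cmod a" using norm_triangle_ineq4[of "z + a" a] by simp
    qed
    then show ?thesis by simp
  qed
  finally show ?thesis .
qed

subsection \<open>Existence\<close>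

text \<open>Borel representatives, since Fubini's theorem is applied to products of \<open>lborel\<close>.\<close>

definition borel_weighted_L2 :: "real \<Rightarrow> (complex \<Rightarrow> complex) \<Rightarrow> bool" where
  "borel_weighted_L2 \<theta> v \<longleftrightarrow> v \<in> borel_measurable borel \<and>
    (\<integral>\<^sup>+z. ennreal ((cmod (v z))\<^sup>2 * bracket z powr -(2 * \<theta>)) \<partial>lborel) < \<infinity>"

section \<open>Weighted spaces and the weak equation through Borel functions\<close>

lemma measurable_completion_complex:
  fixes g :: "'a \<Rightarrow> complex"
  assumes "g \<in> borel_measurable (completion M)"
  obtains g' where "g' \<in> borel_measurable M" "AE x in M. g x = g' x"
proof -
  have "(\<lambda>x. Re (g x)) \<in> borel_measurable (completion M)" "(\<lambda>x. Im (g x)) \<in> borel_measurable (completion M)"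
    using assms by measurable
  then obtain a b where ab: "a \<in> borel_measurable M" "AE x in M. Re (g x) = a x"
    "b \<in> borel_measurable M" "AE x in M. Im (g x) = b x"
    using completion_ex_borel_measurable_real[of "\<lambda>x. Re (g x)" M] completion_ex_borel_measurable_real[of "\<lambda>x. Im (g x)" M]
    by blast
  show ?thesis
  proof
    show "(\<lambda>x. of_real (a x) + \<i> * of_real (b x)) \<in> borel_measurable M" using ab by measurable
    show "AE x in M. g x = of_real (a x) + \<i> * of_real (b x)"
      using ab(2,4) by eventually_elim (simp add: complex_eq_iff)
  qed
qed

lemma weighted_L2_borel:
  assumes "v \<in> weighted_L2 \<theta>"
  obtains v' where "borel_weighted_L2 \<theta> v'" "AE z in lebesgue. v z = v' z"
proof -
  obtain w where w: "w \<in> borel_measurable lebesgue" "integrable lebesgue (\<lambda>z. (cmod (w z))\<^sup>2)"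
    and v: "v = (\<lambda>z. of_real (bracket z powr \<theta>) * w z)"
    using assms by (auto simp: weighted_L2_def L2_def)
  obtain w' where w': "w' \<in> borel_measurable lborel" "AE z in lborel. w z = w' z"
    using measurable_completion_complex[OF w(1)] by blast
  let ?v = "\<lambda>z. of_real (bracket z powr \<theta>) * w' z"
  have [measurable]: "w' \<in> borel_measurable borel" using w'(1) by simp
  have "(\<integral>\<^sup>+z. ennreal ((cmod (?v z))\<^sup>2 * bracket z powr -(2 * \<theta>)) \<partial>lborel) = (\<integral>\<^sup>+z. ennreal ((cmod (w' z))\<^sup>2) \<partial>lborel)"
  proof (rule nn_integral_cong)
    fix z
    have "(cmod (?v z))\<^sup>2 * bracket z powr -(2 * \<theta>) = (cmod (w' z))\<^sup>2 * (bracket z powr \<theta> * bracket z powr \<theta> * bracket z powr -(2 * \<theta>))"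
      by (simp add: norm_mult power2_eq_square)
    also have "bracket z powr \<theta> * bracket z powr \<theta> * bracket z powr -(2 * \<theta>) = 1"
      by (simp add: powr_add[symmetric])
    finally show "ennreal ((cmod (?v z))\<^sup>2 * bracket z powr -(2 * \<theta>)) = ennreal ((cmod (w' z))\<^sup>2)" by simp
  qed
  also have "\<dots> = (\<integral>\<^sup>+z. ennreal ((cmod (w z))\<^sup>2) \<partial>lborel)"
    by (rule nn_integral_cong_AE) (use w'(2) in eventually_elim, simp)
  also have "\<dots> = (\<integral>\<^sup>+z. ennreal ((cmod (w z))\<^sup>2) \<partial>lebesgue)" by (rule nn_integral_completion[symmetric])
  also have "\<dots> < \<infinity>" using w(2) by (simp add: integrable_iff_bounded)
  finally have "borel_weighted_L2 \<theta> ?v" by (simp add: borel_weighted_L2_def)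
  moreover have "AE z in lebesgue. v z = ?v z"
    unfolding v by (rule AE_completion) (use w'(2) in eventually_elim, simp)
  ultimately show ?thesis by (rule that)
qed

lemma weighted_L2I:
  assumes "borel_weighted_L2 \<theta> u" shows "u \<in> weighted_L2 \<theta>"
proof -
  have [measurable]: "u \<in> borel_measurable borel" using assms by (simp add: borel_weighted_L2_def)
  let ?w = "\<lambda>z. of_real (bracket z powr -\<theta>) * u z"
  have "integrable lborel (\<lambda>z. (cmod (?w z))\<^sup>2)"
  proof (rule integrableI_bounded)
    have "(\<integral>\<^sup>+z. ennreal (norm ((cmod (?w z))\<^sup>2)) \<partial>lborel) = (\<integral>\<^sup>+z. ennreal ((cmod (u z))\<^sup>2 * bracket z powr -(2 * \<theta>)) \<partial>lborel)"
    proof (rule nn_integral_cong)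
      fix z
      have "bracket z powr -\<theta> * bracket z powr -\<theta> = bracket z powr -(2 * \<theta>)"
        by (simp only: powr_add[symmetric]) simp
      then have "(cmod (?w z))\<^sup>2 = (cmod (u z))\<^sup>2 * bracket z powr -(2 * \<theta>)"
        by (simp add: norm_mult power2_eq_square mult_ac)
      then show "ennreal (norm ((cmod (?w z))\<^sup>2)) = ennreal ((cmod (u z))\<^sup>2 * bracket z powr -(2 * \<theta>))" by simp
    qed
    also have "\<dots> < \<infinity>" using assms by (simp add: borel_weighted_L2_def)
    finally show "(\<integral>\<^sup>+z. ennreal (norm ((cmod (?w z))\<^sup>2)) \<partial>lborel) < \<infinity>" .
  qed measurable
  then have "?w \<in> L2" by (auto simp: L2_def integrable_completion intro!: measurable_completion)
  moreover have "u = (\<lambda>z. of_real (bracket z powr \<theta>) * ?w z)"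
  proof
    fix z
    have "complex_of_real (bracket z powr \<theta>) * of_real (bracket z powr -\<theta>) = 1"
      by (simp only: of_real_mult[symmetric] powr_add[symmetric]) simp
    then show "u z = of_real (bracket z powr \<theta>) * ?w z" by (simp only: mult.assoc[symmetric] mult_1_left)
  qed
  ultimately show ?thesis unfolding weighted_L2_def by (intro image_eqI[where x="?w"])
qed

lemma distr_of_borel:
  assumes "AE z in lebesgue. u z = u' z" "u \<in> borel_measurable lebesgue"
    "u' \<in> borel_measurable borel" "continuous_on UNIV \<phi>"
  shows "distr_of u \<phi> = (LINT z|lborel. u' z * \<phi> z)"
proof -
  have [measurable]: "\<phi> \<in> borel_measurable borel" "u' \<in> borel_measurable borel"
    using assms by (auto intro: borel_measurable_continuous_onI)
  have m: "(\<lambda>z. u' z * \<phi> z) \<in> borel_measurable lborel" by measurable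
  have p: "\<phi> \<in> borel_measurable lebesgue" using \<open>\<phi> \<in> borel_measurable borel\<close> by (auto intro!: measurable_completion)
  have "distr_of u \<phi> = (LINT z|lebesgue. u' z * \<phi> z)"
    unfolding distr_of_def
  proof (rule integral_cong_AE)
    show "(\<lambda>z. u z * \<phi> z) \<in> borel_measurable lebesgue" using assms(2) p by (rule borel_measurable_times)
    show "(\<lambda>z. u' z * \<phi> z) \<in> borel_measurable lebesgue" using m by (rule measurable_completion)
    show "AE z in lebesgue. u z * \<phi> z = u' z * \<phi> z" using assms(1) by eventually_elim simp
  qed
  also have "\<dots> = (LINT z|lborel. u' z * \<phi> z)" using m by (rule integral_completion)
  finally show ?thesis .
qed

lemma weighted_L2_measurable: "v \<in> weighted_L2 \<theta> \<Longrightarrow> v \<in> borel_measurable lebesgue"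
proof -
  assume "v \<in> weighted_L2 \<theta>"
  then obtain w where w: "w \<in> borel_measurable lebesgue" and v: "v = (\<lambda>z. of_real (bracket z powr \<theta>) * w z)"
    by (auto simp: weighted_L2_def L2_def)
  have "(\<lambda>z. complex_of_real (bracket z powr \<theta>)) \<in> borel_measurable lborel" by measurable
  then have "(\<lambda>z. complex_of_real (bracket z powr \<theta>)) \<in> borel_measurable lebesgue" by (rule measurable_completion)
  then show ?thesis unfolding v using w by (rule borel_measurable_times)
qed

lemma dbar_eq_borel_iff:
  assumes "AE z in lebesgue. u z = u' z" "u \<in> borel_measurable lebesgue" "u' \<in> borel_measurable borel"
    and "AE z in lebesgue. v z = v' z" "v \<in> borel_measurable lebesgue" "v' \<in> borel_measurable borel"
  shows "dbar_eq u v \<longleftrightarrow> (\<forall>\<phi>\<in>test_functions. (LINT z|lborel. u' z * dbar \<phi> z) = - (LINT z|lborel. v' z * \<phi> z))"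
proof -
  have "distr_dbar (distr_of u) \<phi> = distr_of v \<phi> \<longleftrightarrow> (LINT z|lborel. u' z * dbar \<phi> z) = - (LINT z|lborel. v' z * \<phi> z)"
    if "\<phi> \<in> test_functions" for \<phi>
  proof -
    have s: "smooth \<phi>" using that by (simp add: test_functions_iff)
    show ?thesis
      unfolding distr_dbar_def distr_of_borel[OF assms(1-3) smooth_continuous[OF smooth_dbar[OF s]]]
        distr_of_borel[OF assms(4-6) smooth_continuous[OF s]]
      by (metis minus_minus)
  qed
  then show ?thesis unfolding dbar_eq_def by blast
qed

lemma borel_weighted_L2_mono:
  assumes "borel_weighted_L2 \<theta> v" "\<theta> \<le> \<theta>'" shows "borel_weighted_L2 \<theta>' v"
proof -
  have "(\<integral>\<^sup>+z. ennreal ((cmod (v z))\<^sup>2 * bracket z powr -(2 * \<theta>')) \<partial>lborel) \<le>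
      (\<integral>\<^sup>+z. ennreal ((cmod (v z))\<^sup>2 * bracket z powr -(2 * \<theta>)) \<partial>lborel)"
    using assms(2) bracket_ge_1 by (intro nn_integral_mono ennreal_leI mult_left_mono powr_mono) auto
  then show ?thesis using assms(1) by (auto simp: borel_weighted_L2_def intro: le_less_trans)
qed

section \<open>Schur test and the weak equation for the Cauchy transform\<close>

text \<open>The kernel is split evenly between the two Cauchy-Schwarz factors, and the weight is
  inserted as the powers a/2 and -a/2; the square roots in \<open>?f\<close> and \<open>?g\<close>
  encode this.\<close>

lemma nn_integral_cauchy_schwarz_kernel:
  assumes [measurable]: "v \<in> borel_measurable borel"
  shows "(\<integral>\<^sup>+x. ennreal (cmod (v x / (z - x))) \<partial>lborel)\<^sup>2 \<le>
    (\<integral>\<^sup>+x. ennreal ((cmod (v x))\<^sup>2 * bracket x powr a / cmod (z - x)) \<partial>lborel) *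
    (\<integral>\<^sup>+x. ennreal (bracket x powr -a / cmod (z - x)) \<partial>lborel)"
proof -
  let ?f = "\<lambda>x. ennreal (sqrt ((cmod (v x))\<^sup>2 * bracket x powr a / cmod (z - x)))"
  let ?g = "\<lambda>x. ennreal (sqrt (bracket x powr -a / cmod (z - x)))"
  have "ennreal (cmod (v x / (z - x))) = ?f x * ?g x" for x
  proof -
    have "bracket x powr a * bracket x powr -a = 1" by (simp only: powr_add[symmetric]) simp
    then have "(cmod (v x))\<^sup>2 * bracket x powr a / cmod (z - x) * (bracket x powr -a / cmod (z - x)) = (cmod (v x / (z - x)))\<^sup>2"
      by (simp add: norm_divide power2_eq_square mult_ac)
    then show ?thesis by (simp add: ennreal_mult'[symmetric] real_sqrt_mult[symmetric] del: real_sqrt_divide)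
  qed
  moreover have "(?f x)\<^sup>2 = ennreal ((cmod (v x))\<^sup>2 * bracket x powr a / cmod (z - x))"
    "(?g x)\<^sup>2 = ennreal (bracket x powr -a / cmod (z - x))" for x
    by (simp_all add: ennreal_power del: real_sqrt_divide)
  ultimately show ?thesis using Cauchy_Schwarz_nn_integral[of ?f lborel ?g] by simp
qed

definition cauchy_transform :: "(complex \<Rightarrow> complex) \<Rightarrow> complex \<Rightarrow> complex" where
  "cauchy_transform v z = (LINT x|lborel. v x / (z - x)) / of_real cauchy_const"

lemma cauchy_transform_measurable:
  assumes [measurable]: "v \<in> borel_measurable borel"
  shows "cauchy_transform v \<in> borel_measurable borel"
proof -
  have "(\<lambda>z. LINT x|lborel. v x / (z - x)) \<in> borel_measurable borel"
    by (rule lborel.borel_measurable_lebesgue_integral) measurable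
  then show ?thesis unfolding cauchy_transform_def[abs_def] by measurable
qed

text \<open>Valid at every \<open>z\<close>: where the kernel is not integrable against
  \<open>v\<close>, the Bochner integral takes its default value 0, so points of divergence need no
  separate treatment.\<close>

lemma cauchy_transform_norm_le:
  "ennreal (cmod (cauchy_transform v z)) \<le>
    ennreal (1 / \<bar>cauchy_const\<bar>) * (\<integral>\<^sup>+x. ennreal (cmod (v x / (z - x))) \<partial>lborel)"
proof -
  have "ennreal (cmod (LINT x|lborel. v x / (z - x))) \<le> (\<integral>\<^sup>+x. ennreal (cmod (v x / (z - x))) \<partial>lborel)"
  proof (cases "integrable lborel (\<lambda>x. v x / (z - x))")
    case True
    then show ?thesis by (rule integral_norm_bound_ennreal)
  qed (simp add: not_integrable_integral_eq)
  then have "ennreal (1 / \<bar>cauchy_const\<bar>) * ennreal (cmod (LINT x|lborel. v x / (z - x))) \<le>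
    ennreal (1 / \<bar>cauchy_const\<bar>) * (\<integral>\<^sup>+x. ennreal (cmod (v x / (z - x))) \<partial>lborel)"
    by (rule mult_left_mono) simp
  then show ?thesis by (simp add: cauchy_transform_def norm_divide ennreal_mult'[symmetric])
qed

text \<open>Schur test. Cauchy-Schwarz in \<open>x\<close> with weight exponent \<open>a\<close>
  gains the factor of hypothesis \<open>A\<close>. After exchanging the integrals, the integral in
  \<open>z\<close> has weight exponent -(b + 2 * \<epsilon>), and
  \<open>riesz_kernel_bounded\<close> controls it because b + 2 * \<epsilon> > 1.\<close>

lemma cauchy_transform_weighted_L2:
  assumes v: "v \<in> borel_measurable borel"
    and va: "(\<integral>\<^sup>+x. ennreal ((cmod (v x))\<^sup>2 * bracket x powr a) \<partial>lborel) < \<infinity>"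
    and A: "\<And>z. (\<integral>\<^sup>+x. ennreal (bracket x powr -a / cmod (z - x)) \<partial>lborel) \<le> ennreal (A * bracket z powr -b)"
    and \<epsilon>: "1 < b + 2 * \<epsilon>"
  shows "borel_weighted_L2 \<epsilon> (cauchy_transform v)"
proof -
  note [measurable] = v cauchy_transform_measurable[OF v]
  obtain B where B: "\<And>x. (\<integral>\<^sup>+z. ennreal (bracket z powr -(b + 2 * \<epsilon>) / cmod (x - z)) \<partial>lborel) \<le> ennreal B"
    using riesz_kernel_bounded[OF \<epsilon>] by blast
  let ?V = "\<lambda>x. ennreal ((cmod (v x))\<^sup>2 * bracket x powr a)"
  \<comment> \<open>The sign of \<open>A\<close> is open, and products pass through
    \<open>ennreal\<close> only for nonnegative factors; hence the absolute value.\<close>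
  let ?K = "ennreal ((1 / \<bar>cauchy_const\<bar>)\<^sup>2 * \<bar>A\<bar>)"
  have "ennreal ((cmod (cauchy_transform v z))\<^sup>2 * bracket z powr -(2 * \<epsilon>)) \<le>
      ?K * (\<integral>\<^sup>+x. ?V x * ennreal (bracket z powr -(b + 2 * \<epsilon>) / cmod (x - z)) \<partial>lborel)" for z
  proof -
    let ?I = "\<integral>\<^sup>+x. ennreal ((cmod (v x))\<^sup>2 * bracket x powr a / cmod (z - x)) \<partial>lborel"
    have "(ennreal (cmod (cauchy_transform v z)))\<^sup>2 \<le> (ennreal (1 / \<bar>cauchy_const\<bar>) * (\<integral>\<^sup>+x. ennreal (cmod (v x / (z - x))) \<partial>lborel))\<^sup>2"
      by (intro power_mono cauchy_transform_norm_le) simp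
    also have "\<dots> = ennreal ((1 / \<bar>cauchy_const\<bar>)\<^sup>2) * (\<integral>\<^sup>+x. ennreal (cmod (v x / (z - x))) \<partial>lborel)\<^sup>2"
      by (simp only: power_mult_distrib ennreal_power divide_nonneg_nonneg zero_le_one abs_ge_zero)
    also have "\<dots> \<le> ennreal ((1 / \<bar>cauchy_const\<bar>)\<^sup>2) * (?I * ennreal (\<bar>A\<bar> * bracket z powr -b))"
    proof (rule mult_left_mono)
      have "(\<integral>\<^sup>+x. ennreal (bracket x powr -a / cmod (z - x)) \<partial>lborel) \<le> ennreal (\<bar>A\<bar> * bracket z powr -b)"
        by (rule order_trans[OF A]) (intro ennreal_leI mult_right_mono, auto)
      then show "(\<integral>\<^sup>+x. ennreal (cmod (v x / (z - x))) \<partial>lborel)\<^sup>2 \<le> ?I * ennreal (\<bar>A\<bar> * bracket z powr -b)"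
        by (intro order_trans[OF nn_integral_cauchy_schwarz_kernel[OF v, where a=a]] mult_left_mono) auto
    qed simp
    finally have 1: "(ennreal (cmod (cauchy_transform v z)))\<^sup>2 \<le> ennreal ((1 / \<bar>cauchy_const\<bar>)\<^sup>2) * (?I * ennreal (\<bar>A\<bar> * bracket z powr -b))" .
    have "ennreal ((cmod (cauchy_transform v z))\<^sup>2 * bracket z powr -(2 * \<epsilon>)) =
       (ennreal (cmod (cauchy_transform v z)))\<^sup>2 * ennreal (bracket z powr -(2 * \<epsilon>))"
      by (simp only: ennreal_power[OF norm_ge_zero] ennreal_mult' powr_ge_zero)
        (simp add: ennreal_mult)
    also have "\<dots> \<le> ennreal ((1 / \<bar>cauchy_const\<bar>)\<^sup>2) * (?I * ennreal (\<bar>A\<bar> * bracket z powr -b)) * ennreal (bracket z powr -(2 * \<epsilon>))"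
      using 1 by (rule mult_right_mono) simp
    also have "\<dots> = ennreal ((1 / \<bar>cauchy_const\<bar>)\<^sup>2) * ennreal (\<bar>A\<bar> * bracket z powr -b) * ennreal (bracket z powr -(2 * \<epsilon>)) * ?I"
      by (simp only: mult_ac)
    also have "ennreal ((1 / \<bar>cauchy_const\<bar>)\<^sup>2) * ennreal (\<bar>A\<bar> * bracket z powr -b) * ennreal (bracket z powr -(2 * \<epsilon>)) = ?K * ennreal (bracket z powr -(b + 2 * \<epsilon>))"
    proof -
      have "bracket z powr -b * bracket z powr -(2 * \<epsilon>) = bracket z powr -(b + 2 * \<epsilon>)"
        by (simp only: powr_add[symmetric]) simp
      then show ?thesis by (simp add: ennreal_mult[symmetric] mult.assoc)
    qed
    also have "?K * ennreal (bracket z powr -(b + 2 * \<epsilon>)) * ?I = ?K * (\<integral>\<^sup>+x. ennreal (bracket z powr -(b + 2 * \<epsilon>)) * ennreal ((cmod (v x))\<^sup>2 * bracket x powr a / cmod (z - x)) \<partial>lborel)"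
      by (simp add: nn_integral_cmult mult.assoc)
    also have "\<dots> = ?K * (\<integral>\<^sup>+x. ?V x * ennreal (bracket z powr -(b + 2 * \<epsilon>) / cmod (x - z)) \<partial>lborel)"
      by (simp add: ennreal_mult[symmetric] norm_minus_commute mult_ac)
    finally show ?thesis .
  qed
  then have "(\<integral>\<^sup>+z. ennreal ((cmod (cauchy_transform v z))\<^sup>2 * bracket z powr -(2 * \<epsilon>)) \<partial>lborel) \<le>
    (\<integral>\<^sup>+z. ?K * (\<integral>\<^sup>+x. ?V x * ennreal (bracket z powr -(b + 2 * \<epsilon>) / cmod (x - z)) \<partial>lborel) \<partial>lborel)"
    by (intro nn_integral_mono)
  also have "\<dots> = ?K * (\<integral>\<^sup>+z. \<integral>\<^sup>+x. ?V x * ennreal (bracket z powr -(b + 2 * \<epsilon>) / cmod (x - z)) \<partial>lborel \<partial>lborel)"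
    by (rule nn_integral_cmult) measurable
  also have "(\<integral>\<^sup>+z. \<integral>\<^sup>+x. ?V x * ennreal (bracket z powr -(b + 2 * \<epsilon>) / cmod (x - z)) \<partial>lborel \<partial>lborel) =
      (\<integral>\<^sup>+x. \<integral>\<^sup>+z. ?V x * ennreal (bracket z powr -(b + 2 * \<epsilon>) / cmod (x - z)) \<partial>lborel \<partial>lborel)"
    by (rule lborel_pair.Fubini') measurable
  also have "\<dots> = (\<integral>\<^sup>+x. ?V x * (\<integral>\<^sup>+z. ennreal (bracket z powr -(b + 2 * \<epsilon>) / cmod (x - z)) \<partial>lborel) \<partial>lborel)"
    by (intro nn_integral_cong nn_integral_cmult) measurable
  also have "?K * \<dots> \<le> ?K * (\<integral>\<^sup>+x. ?V x * ennreal B \<partial>lborel)"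
    by (intro mult_left_mono nn_integral_mono B) auto
  also have "\<dots> = ?K * ((\<integral>\<^sup>+x. ?V x \<partial>lborel) * ennreal B)" by (subst nn_integral_multc) measurable
  also have "\<dots> < \<infinity>" using va by (simp add: ennreal_mult_less_top)
  finally show ?thesis by (simp add: borel_weighted_L2_def)
qed

lemma test_functionE:
  assumes "\<phi> \<in> test_functions"
  obtains R where "smooth \<phi>" "\<And>z. \<phi> z \<noteq> 0 \<Longrightarrow> cmod z \<le> R" "\<And>z. dbar \<phi> z \<noteq> 0 \<Longrightarrow> cmod z \<le> R"
  using assms dbar_support unfolding test_functions_iff by metis

lemma mult_le_sum_squares: "0 \<le> a \<Longrightarrow> 0 \<le> b \<Longrightarrow> a * b \<le> a\<^sup>2 + (b::real)\<^sup>2"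
  using sum_squares_bound[of a b] mult_nonneg_nonneg[of a b] by linarith

text \<open>Absolute convergence for the Fubini argument below. The integrand is a product of
  \<open>cmod (v x) * bracket x powr (2 - \<epsilon>)\<close>, square integrable by hypothesis, and
  the power \<epsilon> - 3 of the bracket, square integrable exactly if \<epsilon> < 2.\<close>

lemma nn_integral_bracket_inverse:
  assumes v: "borel_weighted_L2 (\<epsilon> - 2) v" and "\<epsilon> < 2"
  shows "(\<integral>\<^sup>+x. ennreal (cmod (v x) / bracket x) \<partial>lborel) < \<infinity>"
proof -
  have [measurable]: "v \<in> borel_measurable borel" using v by (simp add: borel_weighted_L2_def)
  have "cmod (v x) / bracket x \<le> (cmod (v x))\<^sup>2 * bracket x powr -(2 * (\<epsilon> - 2)) + bracket x powr -(6 - 2 * \<epsilon>)" for x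
  proof -
    let ?a = "cmod (v x) * bracket x powr (2 - \<epsilon>)" and ?b = "bracket x powr (\<epsilon> - 3)"
    have "cmod (v x) / bracket x = ?a * ?b"
    proof -
      have "bracket x powr (2 - \<epsilon>) * bracket x powr (\<epsilon> - 3) = bracket x powr -1"
        by (simp only: powr_add[symmetric]) simp
      then show ?thesis by (simp add: mult.assoc powr_minus divide_inverse)
    qed
    also have "\<dots> \<le> ?a\<^sup>2 + ?b\<^sup>2"
      by (rule mult_le_sum_squares) auto
    also have "?a\<^sup>2 = (cmod (v x))\<^sup>2 * bracket x powr -(2 * (\<epsilon> - 2))"
      by (simp add: power_mult_distrib power2_eq_square powr_add[symmetric])
    also have "?b\<^sup>2 = bracket x powr -(6 - 2 * \<epsilon>)"
      by (simp add: power2_eq_square powr_add[symmetric])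
    finally show ?thesis .
  qed
  then have "(\<integral>\<^sup>+x. ennreal (cmod (v x) / bracket x) \<partial>lborel) \<le>
    (\<integral>\<^sup>+x. ennreal ((cmod (v x))\<^sup>2 * bracket x powr -(2 * (\<epsilon> - 2))) + ennreal (bracket x powr -(6 - 2 * \<epsilon>)) \<partial>lborel)"
    by (intro nn_integral_mono) (simp add: ennreal_plus[symmetric] ennreal_leI del: ennreal_plus)
  also have "\<dots> = (\<integral>\<^sup>+x. ennreal ((cmod (v x))\<^sup>2 * bracket x powr -(2 * (\<epsilon> - 2))) \<partial>lborel) +
      (\<integral>\<^sup>+x. ennreal (bracket x powr -(6 - 2 * \<epsilon>)) \<partial>lborel)"
    by (rule nn_integral_add) measurable
  also have "\<dots> < \<infinity>"
    using v nn_integral_bracket_powr[of "6 - 2 * \<epsilon>"] assms(2) by (simp add: borel_weighted_L2_def)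
  finally show ?thesis .
qed

text \<open>Fubini moves the kernel from \<open>v\<close> onto \<open>dbar \<phi>\<close>, where the
  Cauchy-Pompeiu formula applies. Exchanging the roles of \<open>x\<close> and \<open>z\<close>
  flips the kernel, which yields the minus sign of the weak derivative.\<close>

lemma cauchy_transform_dbar:
  assumes [measurable]: "v \<in> borel_measurable borel"
    and v: "(\<integral>\<^sup>+x. ennreal (cmod (v x) / bracket x) \<partial>lborel) < \<infinity>"
    and \<phi>: "\<phi> \<in> test_functions"
  shows "(LINT z|lborel. cauchy_transform v z * dbar \<phi> z) = - (LINT z|lborel. v z * \<phi> z)"
proof -
  obtain R where s: "smooth \<phi>" and R: "\<And>z. \<phi> z \<noteq> 0 \<Longrightarrow> cmod z \<le> R" "\<And>z. dbar \<phi> z \<noteq> 0 \<Longrightarrow> cmod z \<le> R"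
    using test_functionE[OF \<phi>] by blast
  have cd: "continuous_on UNIV (dbar \<phi>)" by (rule smooth_continuous[OF smooth_dbar[OF s]])
  have [measurable]: "dbar \<phi> \<in> borel_measurable borel" by (rule borel_measurable_continuous_onI[OF cd])
  obtain C where C: "0 \<le> C" "\<And>z. (\<integral>\<^sup>+x. ennreal (cmod (dbar \<phi> x / (z - x))) \<partial>lborel) \<le> ennreal (C / bracket z)"
    using nn_integral_cauchy_kernel[OF cd R(2)] by blast
  let ?f = "\<lambda>x z. v x * (dbar \<phi> z / (z - x))"
  have nn: "(\<integral>\<^sup>+z. ennreal (cmod (?f x z)) \<partial>lborel) \<le> ennreal C * ennreal (cmod (v x) / bracket x)" for x
  proof -
    have "(\<integral>\<^sup>+z. ennreal (cmod (?f x z)) \<partial>lborel) = (\<integral>\<^sup>+z. ennreal (cmod (v x)) * ennreal (cmod (dbar \<phi> z / (x - z))) \<partial>lborel)"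
      by (simp add: norm_mult norm_divide ennreal_mult[symmetric] norm_minus_commute)
    also have "\<dots> = ennreal (cmod (v x)) * (\<integral>\<^sup>+z. ennreal (cmod (dbar \<phi> z / (x - z))) \<partial>lborel)"
      by (rule nn_integral_cmult) measurable
    also have "\<dots> \<le> ennreal (cmod (v x)) * ennreal (C / bracket x)" by (intro mult_left_mono C) auto
    also have "\<dots> = ennreal C * ennreal (cmod (v x) / bracket x)" using C(1) by (simp add: ennreal_mult[symmetric])
    finally show ?thesis .
  qed
  have int: "integrable (lborel \<Otimes>\<^sub>M lborel) (case_prod ?f)"
  proof (rule integrableI_bounded)
    show m: "case_prod ?f \<in> borel_measurable (lborel \<Otimes>\<^sub>M lborel)" by measurable
    have "(\<integral>\<^sup>+p. ennreal (norm (case_prod ?f p)) \<partial>(lborel \<Otimes>\<^sub>M lborel)) = (\<integral>\<^sup>+x. \<integral>\<^sup>+z. ennreal (cmod (?f x z)) \<partial>lborel \<partial>lborel)"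
      by (subst lborel.nn_integral_fst[symmetric]) (use m in simp_all)
    also have "\<dots> \<le> (\<integral>\<^sup>+x. ennreal C * ennreal (cmod (v x) / bracket x) \<partial>lborel)"
      by (intro nn_integral_mono nn)
    also have "\<dots> = ennreal C * (\<integral>\<^sup>+x. ennreal (cmod (v x) / bracket x) \<partial>lborel)"
      by (rule nn_integral_cmult) measurable
    also have "\<dots> < \<infinity>" using v by (simp add: ennreal_mult_less_top)
    finally show "(\<integral>\<^sup>+p. ennreal (norm (case_prod ?f p)) \<partial>(lborel \<Otimes>\<^sub>M lborel)) < \<infinity>" .
  qed
  have "(LINT z|lborel. cauchy_transform v z * dbar \<phi> z) = (LINT z|lborel. (LINT x|lborel. ?f x z) / of_real cauchy_const)"
  proof (rule Bochner_Integration.integral_cong[OF refl])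
    fix z
    have "(LINT x|lborel. ?f x z) = (LINT x|lborel. (v x / (z - x)) * dbar \<phi> z)" by simp
    also have "\<dots> = (LINT x|lborel. v x / (z - x)) * dbar \<phi> z" by (rule integral_mult_left_zero)
    finally show "cauchy_transform v z * dbar \<phi> z = (LINT x|lborel. ?f x z) / of_real cauchy_const"
      by (simp add: cauchy_transform_def)
  qed
  also have "\<dots> = (LINT z|lborel. LINT x|lborel. ?f x z) / of_real cauchy_const"
    by (rule integral_divide_zero)
  also have "(LINT z|lborel. LINT x|lborel. ?f x z) = (LINT x|lborel. LINT z|lborel. ?f x z)"
    by (rule lborel_pair.Fubini_integral[OF int])
  also have "\<dots> = (LINT x|lborel. - of_real cauchy_const * (v x * \<phi> x))"
  proof (rule Bochner_Integration.integral_cong[OF refl])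
    fix x
    have "(LINT z|lborel. ?f x z) = v x * (LINT z|lborel. dbar \<phi> z / (z - x))" by (rule integral_mult_right_zero)
    also have "(LINT z|lborel. dbar \<phi> z / (z - x)) = (LINT z|lborel. - (dbar \<phi> z / (x - z)))"
      by (rule Bochner_Integration.integral_cong) (auto simp: minus_divide_right)
    also have "\<dots> = - (of_real cauchy_const * \<phi> x)" using cauchy_pompeiu[OF s R(1)] by simp
    finally show "(LINT z|lborel. ?f x z) = - of_real cauchy_const * (v x * \<phi> x)" by simp
  qed
  also have "\<dots> = - of_real cauchy_const * (LINT x|lborel. v x * \<phi> x)" by (rule integral_mult_right_zero)
  also have "\<dots> / of_real cauchy_const = - (LINT x|lborel. v x * \<phi> x)" using cauchy_const_nonzero by simp
  finally show ?thesis .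
qed

lemma exists_borel_solution_small:
  assumes \<epsilon>: "0 < \<epsilon>" "\<epsilon> \<le> 1" and v: "borel_weighted_L2 (\<epsilon> - 2) v"
  shows "\<exists>u. borel_weighted_L2 \<epsilon> u \<and>
    (\<forall>\<phi>\<in>test_functions. (LINT z|lborel. u z * dbar \<phi> z) = - (LINT z|lborel. v z * \<phi> z))"
proof -
  have m: "v \<in> borel_measurable borel" using v by (simp add: borel_weighted_L2_def)
  obtain C where C: "\<And>z. (\<integral>\<^sup>+x. ennreal (bracket x powr -2 / cmod (z - x)) \<partial>lborel) \<le> ennreal C"
    using riesz_kernel_bounded[of 2] by auto
  obtain D where D: "\<And>z. (\<integral>\<^sup>+x. ennreal (bracket x powr -3 / cmod (z - x)) \<partial>lborel) \<le> ennreal (D / bracket z)"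
    using riesz_kernel_decay by blast
  have fin: "(\<integral>\<^sup>+x. ennreal ((cmod (v x))\<^sup>2 * bracket x powr a) \<partial>lborel) < \<infinity>" if "a \<le> 4 - 2 * \<epsilon>" for a
    using borel_weighted_L2_mono[OF v, of "-a/2"] that by (simp add: borel_weighted_L2_def)
  have "borel_weighted_L2 \<epsilon> (cauchy_transform v)"
  \<comment> \<open>Two conditions constrain the Schur exponents: a \<le> 4 - 2 * \<epsilon>, so
    that \<open>v\<close> absorbs the weight, and b + 2 * \<epsilon> > 1. The pair (3, 1) meets them
    for \<epsilon> at most 1/2, and the pair (2, 0) for \<epsilon> above 1/2 and at most 1.\<close>
  proof (cases "\<epsilon> \<le> 1 / 2")
    case True
    show ?thesis
    proof (rule cauchy_transform_weighted_L2[OF m fin[of 3]])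
      show "(\<integral>\<^sup>+x. ennreal (bracket x powr -3 / cmod (z - x)) \<partial>lborel) \<le> ennreal (D * bracket z powr -1)" for z
        using D[of z] by (simp only: powr_minus powr_one bracket_simps divide_inverse)
    qed (use True \<epsilon> in linarith)+
  next
    case False
    show ?thesis
    proof (rule cauchy_transform_weighted_L2[OF m fin[of 2]])
      show "(\<integral>\<^sup>+x. ennreal (bracket x powr -2 / cmod (z - x)) \<partial>lborel) \<le> ennreal (C * bracket z powr -0)" for z
        using C[of z] by (simp only: powr_zero_eq_one minus_zero bracket_simps mult_1_right if_False)
    qed (use False \<epsilon> in linarith)+
  qed
  moreover have "(LINT z|lborel. cauchy_transform v z * dbar \<phi> z) = - (LINT z|lborel. v z * \<phi> z)"
    if "\<phi> \<in> test_functions" for \<phi>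
    by (rule cauchy_transform_dbar[OF m nn_integral_bracket_inverse[OF v] that]) (use \<epsilon> in auto)
  ultimately show ?thesis by blast
qed

section \<open>Removing the upper bound on \<epsilon> in the existence statement\<close>

lemma dbar_id_mult:
  assumes "f differentiable (at z)" shows "dbar (\<lambda>z. z * f z) z = z * dbar f z"
proof -
  have "dbar (\<lambda>z::complex. z) z = 0"
    using partial_derivs(3)[of "\<lambda>z. z" "\<lambda>h. h" z] by simp
  then show ?thesis using dbar_mult[of "\<lambda>z. z" z f] assms by simp
qed

lemma borel_weighted_L2_integrable_compact_support:
  assumes u: "borel_weighted_L2 \<theta> u" and g: "continuous_on UNIV g" "\<And>z. g z \<noteq> 0 \<Longrightarrow> cmod z \<le> R"
  shows "integrable lborel (\<lambda>z. u z * g z)"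
proof (rule integrableI_bounded)
  have [measurable]: "u \<in> borel_measurable borel" "g \<in> borel_measurable borel"
    using u g by (auto simp: borel_weighted_L2_def borel_measurable_continuous_onI)
  \<comment> \<open>This is |g|^2 times the weight, written with \<open>cnj\<close> to be a
    continuous complex function of compact support, to which
    \<open>compact_support_integrable\<close> applies.\<close>
  let ?h = "\<lambda>z. g z * of_real (bracket z powr (2 * \<theta>)) * cnj (g z)"
  have hi: "integrable lborel ?h"
    by (rule compact_support_integrable[of _ R]) (use g in \<open>auto intro!: continuous_intros\<close>)
  have "cmod (u z * g z) \<le> (cmod (u z))\<^sup>2 * bracket z powr -(2 * \<theta>) + cmod (?h z)" for z
  proof -
    let ?a = "cmod (u z) * bracket z powr -\<theta>" and ?b = "cmod (g z) * bracket z powr \<theta>"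
    have "bracket z powr -\<theta> * bracket z powr \<theta> = 1" by (simp only: powr_add[symmetric]) simp
    then have "cmod (u z * g z) = ?a * ?b" by (simp add: norm_mult mult_ac)
    also have "\<dots> \<le> ?a\<^sup>2 + ?b\<^sup>2"
      by (rule mult_le_sum_squares) auto
    also have "?a\<^sup>2 = (cmod (u z))\<^sup>2 * bracket z powr -(2 * \<theta>)"
      by (simp add: power_mult_distrib power2_eq_square powr_add[symmetric])
    also have "?b\<^sup>2 = cmod (?h z)"
      by (simp add: norm_mult power2_eq_square powr_add[symmetric] mult_ac)
    finally show ?thesis .
  qed
  then have "(\<integral>\<^sup>+z. ennreal (norm (u z * g z)) \<partial>lborel) \<le>
    (\<integral>\<^sup>+z. ennreal ((cmod (u z))\<^sup>2 * bracket z powr -(2 * \<theta>)) + ennreal (cmod (?h z)) \<partial>lborel)"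
    by (intro nn_integral_mono) (simp add: ennreal_plus[symmetric] ennreal_leI del: ennreal_plus)
  also have "\<dots> = (\<integral>\<^sup>+z. ennreal ((cmod (u z))\<^sup>2 * bracket z powr -(2 * \<theta>)) \<partial>lborel) + (\<integral>\<^sup>+z. ennreal (cmod (?h z)) \<partial>lborel)"
    by (rule nn_integral_add) (use hi in auto)
  also have "\<dots> < \<infinity>" using u hi by (simp add: borel_weighted_L2_def integrable_iff_bounded)
  finally show "(\<integral>\<^sup>+z. ennreal (norm (u z * g z)) \<partial>lborel) < \<infinity>" .
  show "(\<lambda>z. u z * g z) \<in> borel_measurable lborel" by measurable
qed

lemma borel_weighted_L2_add:
  assumes "borel_weighted_L2 \<theta> u" "borel_weighted_L2 \<theta> w"
  shows "borel_weighted_L2 \<theta> (\<lambda>z. u z + w z)"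
proof -
  have [measurable]: "u \<in> borel_measurable borel" "w \<in> borel_measurable borel"
    using assms by (auto simp: borel_weighted_L2_def)
  let ?n = "\<lambda>f z. ennreal ((cmod (f z))\<^sup>2 * bracket z powr -(2 * \<theta>))"
  have le: "(cmod (u z + w z))\<^sup>2 \<le> 2 * (cmod (u z))\<^sup>2 + 2 * (cmod (w z))\<^sup>2" for z
  proof -
    have "(cmod (u z + w z))\<^sup>2 \<le> (cmod (u z) + cmod (w z))\<^sup>2" by (intro power_mono norm_triangle_ineq) auto
    also have "\<dots> \<le> 2 * (cmod (u z))\<^sup>2 + 2 * (cmod (w z))\<^sup>2"
      using sum_squares_bound[of "cmod (u z)" "cmod (w z)"] by (simp add: power2_sum)
    finally show ?thesis .
  qed
  have "(cmod (u z + w z))\<^sup>2 * bracket z powr -(2 * \<theta>) \<le>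
    2 * ((cmod (u z))\<^sup>2 * bracket z powr -(2 * \<theta>)) + 2 * ((cmod (w z))\<^sup>2 * bracket z powr -(2 * \<theta>))" for z
    using mult_right_mono[OF le[of z] powr_ge_zero[of "bracket z" "-(2 * \<theta>)"]] by (simp add: algebra_simps)
  then have "?n (\<lambda>z. u z + w z) z \<le> 2 * ?n u z + 2 * ?n w z" for z
    by (rule order_trans[OF ennreal_leI]) (simp add: ennreal_mult')
  then have "(\<integral>\<^sup>+z. ?n (\<lambda>z. u z + w z) z \<partial>lborel) \<le> (\<integral>\<^sup>+z. 2 * ?n u z + 2 * ?n w z \<partial>lborel)"
    by (intro nn_integral_mono)
  also have "\<dots> = 2 * (\<integral>\<^sup>+z. ?n u z \<partial>lborel) + 2 * (\<integral>\<^sup>+z. ?n w z \<partial>lborel)"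
    by (simp add: nn_integral_add nn_integral_cmult)
  also have "\<dots> < \<infinity>" using assms by (simp add: borel_weighted_L2_def ennreal_mult_less_top)
  finally show ?thesis by (simp add: borel_weighted_L2_def)
qed

lemma borel_weighted_L2_dominated:
  assumes "borel_weighted_L2 \<theta> u" "w \<in> borel_measurable borel" "0 \<le> C"
    "\<And>z. (cmod (w z))\<^sup>2 * bracket z powr -(2 * \<theta>') \<le> C * ((cmod (u z))\<^sup>2 * bracket z powr -(2 * \<theta>))"
  shows "borel_weighted_L2 \<theta>' w"
proof -
  have [measurable]: "u \<in> borel_measurable borel" using assms by (simp add: borel_weighted_L2_def)
  have "(\<integral>\<^sup>+z. ennreal ((cmod (w z))\<^sup>2 * bracket z powr -(2 * \<theta>')) \<partial>lborel) \<le>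
     (\<integral>\<^sup>+z. ennreal C * ennreal ((cmod (u z))\<^sup>2 * bracket z powr -(2 * \<theta>)) \<partial>lborel)"
    using assms by (intro nn_integral_mono) (simp add: ennreal_mult[symmetric] ennreal_leI)
  also have "\<dots> = ennreal C * (\<integral>\<^sup>+z. ennreal ((cmod (u z))\<^sup>2 * bracket z powr -(2 * \<theta>)) \<partial>lborel)"
    by (rule nn_integral_cmult) measurable
  also have "\<dots> < \<infinity>" using assms by (simp add: borel_weighted_L2_def ennreal_mult_less_top)
  finally show ?thesis using assms by (simp add: borel_weighted_L2_def)
qed

text \<open>The natural number makes the real exponent accessible to induction: each step lowers
  \<epsilon> by 1 until it is at most 1.\<close>

lemma exists_borel_solution:
  assumes "0 < \<epsilon>" "\<epsilon> \<le> real n + 1" "borel_weighted_L2 (\<epsilon> - 2) v"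
  shows "\<exists>u. borel_weighted_L2 \<epsilon> u \<and>
    (\<forall>\<phi>\<in>test_functions. (LINT z|lborel. u z * dbar \<phi> z) = - (LINT z|lborel. v z * \<phi> z))"
  using assms
proof (induction n arbitrary: \<epsilon> v)
  case 0
  then show ?case using exists_borel_solution_small by simp
next
  case (Suc n)
  show ?case
  proof (cases "\<epsilon> \<le> 1")
    case True
    then show ?thesis using exists_borel_solution_small Suc.prems by blast
  next
    case False
    note v = Suc.prems(3)
    have [measurable]: "v \<in> borel_measurable borel" using v by (simp add: borel_weighted_L2_def)
    txt \<open>The part of \<open>v\<close> in the unit disc lies in every weighted space; the rest may be divided by \<open>z\<close>.\<close>
    let ?v1 = "\<lambda>z. if cmod z < 1 then v z else 0" and ?v2 = "\<lambda>z. if cmod z < 1 then 0 else v z / z"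
    have v12m: "?v1 \<in> borel_measurable borel" "?v2 \<in> borel_measurable borel" by measurable
    \<comment> \<open>The exponent is left as \<open>1 - 2\<close> to present the case \<epsilon> =
      1 of the small-exponent lemma; its solution lies in the larger space for the present
      \<epsilon>. The constant comes from \<open>bracket z \<le> 2\<close> on the unit disc.\<close>
    have v1: "borel_weighted_L2 (1 - 2) ?v1"
    proof (rule borel_weighted_L2_dominated[OF v v12m(1)])
      fix z
      show "(cmod (?v1 z))\<^sup>2 * bracket z powr -(2 * (1 - 2)) \<le> 2 powr (2 * (\<epsilon> - 1)) * ((cmod (v z))\<^sup>2 * bracket z powr -(2 * (\<epsilon> - 2)))"
      proof (cases "cmod z < 1")
        case True
        then have "bracket z \<le> 2" using bracket_le_1_cmod[of z] by simp
        have "bracket z powr -(2 * (1 - 2)) = bracket z powr (2 * (\<epsilon> - 1)) * bracket z powr -(2 * (\<epsilon> - 2))"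
          by (simp only: powr_add[symmetric]) (simp add: algebra_simps)
        also have "\<dots> \<le> 2 powr (2 * (\<epsilon> - 1)) * bracket z powr -(2 * (\<epsilon> - 2))"
          using \<open>bracket z \<le> 2\<close> False by (intro mult_right_mono powr_mono2) auto
        finally have "(cmod (v z))\<^sup>2 * bracket z powr -(2 * (1 - 2)) \<le> (cmod (v z))\<^sup>2 * (2 powr (2 * (\<epsilon> - 1)) * bracket z powr -(2 * (\<epsilon> - 2)))"
          by (rule mult_left_mono) simp
        also have "\<dots> = 2 powr (2 * (\<epsilon> - 1)) * ((cmod (v z))\<^sup>2 * bracket z powr -(2 * (\<epsilon> - 2)))" by (rule mult.left_commute)
        finally show ?thesis using True by (simp only: if_True)
      next
        case False
        then show ?thesis by simp
      qed
    qed auto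
    \<comment> \<open>Outside the unit disc \<open>bracket z \<le> 2 * cmod z\<close>, so division
      by \<open>z\<close> gains one power of the bracket; squaring gives the constant 4.\<close>
    have v2: "borel_weighted_L2 ((\<epsilon> - 1) - 2) ?v2"
    proof (rule borel_weighted_L2_dominated[OF v v12m(2)])
      fix z
      show "(cmod (?v2 z))\<^sup>2 * bracket z powr -(2 * ((\<epsilon> - 1) - 2)) \<le> 4 * ((cmod (v z))\<^sup>2 * bracket z powr -(2 * (\<epsilon> - 2)))"
      proof (cases "cmod z < 1")
        case False
        then have z: "0 < cmod z" "bracket z \<le> 2 * cmod z" using bracket_le_1_cmod[of z] by linarith+
        have "bracket z powr -(2 * ((\<epsilon> - 1) - 2)) = bracket z powr 2 * bracket z powr -(2 * (\<epsilon> - 2))"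
          by (simp only: powr_add[symmetric]) (simp add: algebra_simps)
        also have "\<dots> = (bracket z)\<^sup>2 * bracket z powr -(2 * (\<epsilon> - 2))" by simp
        also have "\<dots> \<le> (2 * cmod z)\<^sup>2 * bracket z powr -(2 * (\<epsilon> - 2))"
          using z by (intro mult_right_mono power_mono) auto
        finally have "(cmod (v z / z))\<^sup>2 * bracket z powr -(2 * ((\<epsilon> - 1) - 2)) \<le> (cmod (v z / z))\<^sup>2 * ((2 * cmod z)\<^sup>2 * bracket z powr -(2 * (\<epsilon> - 2)))"
          by (rule mult_left_mono) simp
        also have "\<dots> = 4 * ((cmod (v z))\<^sup>2 * bracket z powr -(2 * (\<epsilon> - 2)))"
          using z(1) by (simp add: norm_divide power_divide power_mult_distrib)
        finally show ?thesis using False by (simp only: if_False)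
      qed simp
    qed auto
    obtain u1 where u1: "borel_weighted_L2 1 u1"
      "\<And>\<phi>. \<phi> \<in> test_functions \<Longrightarrow> (LINT z|lborel. u1 z * dbar \<phi> z) = - (LINT z|lborel. ?v1 z * \<phi> z)"
      using exists_borel_solution_small[OF _ _ v1] by auto
    obtain u2 where u2: "borel_weighted_L2 (\<epsilon> - 1) u2"
      "\<And>\<phi>. \<phi> \<in> test_functions \<Longrightarrow> (LINT z|lborel. u2 z * dbar \<phi> z) = - (LINT z|lborel. ?v2 z * \<phi> z)"
      using Suc.IH[OF _ _ v2] False Suc.prems by auto
    have [measurable]: "u2 \<in> borel_measurable borel" using u2 by (simp add: borel_weighted_L2_def)
    have zu2: "borel_weighted_L2 \<epsilon> (\<lambda>z. z * u2 z)"
    proof (rule borel_weighted_L2_dominated[OF u2(1)])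
      fix z
      have "bracket z powr -(2 * (\<epsilon> - 1)) = (bracket z)\<^sup>2 * bracket z powr -(2 * \<epsilon>)"
      proof -
        have "bracket z powr -(2 * (\<epsilon> - 1)) = bracket z powr 2 * bracket z powr -(2 * \<epsilon>)"
          by (simp only: powr_add[symmetric]) (simp add: algebra_simps)
        then show ?thesis by simp
      qed
      moreover have "(cmod z)\<^sup>2 \<le> (bracket z)\<^sup>2" by (intro power_mono cmod_le_bracket) simp
      ultimately show "(cmod (z * u2 z))\<^sup>2 * bracket z powr -(2 * \<epsilon>) \<le> 1 * ((cmod (u2 z))\<^sup>2 * bracket z powr -(2 * (\<epsilon> - 1)))"
        by (simp add: norm_mult power_mult_distrib mult_ac mult_left_mono mult_right_mono)
    qed auto
    have "borel_weighted_L2 \<epsilon> (\<lambda>z. u1 z + z * u2 z)"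
      using borel_weighted_L2_add[OF borel_weighted_L2_mono[OF u1(1)] zu2] False by simp
    moreover have "(LINT z|lborel. (u1 z + z * u2 z) * dbar \<phi> z) = - (LINT z|lborel. v z * \<phi> z)" if \<phi>: "\<phi> \<in> test_functions" for \<phi>
    proof -
      obtain R where s: "smooth \<phi>" and R: "\<And>z. \<phi> z \<noteq> 0 \<Longrightarrow> cmod z \<le> R" "\<And>z. dbar \<phi> z \<noteq> 0 \<Longrightarrow> cmod z \<le> R"
        using test_functionE[OF \<phi>] by blast
      note c = smooth_continuous[OF s, of UNIV] smooth_continuous[OF smooth_dbar[OF s], of UNIV]
      have sz: "smooth (\<lambda>z. z * \<phi> z)"
        by (rule smooth_mult[OF smooth_linear[OF bounded_linear_ident] s])
      have z\<phi>: "(\<lambda>z. z * \<phi> z) \<in> test_functions"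
        using sz \<phi> unfolding test_functions_iff by auto
      have "(LINT z|lborel. (u1 z + z * u2 z) * dbar \<phi> z) = (LINT z|lborel. u1 z * dbar \<phi> z + (z * u2 z) * dbar \<phi> z)"
        by (simp only: distrib_right)
      also have "\<dots> = (LINT z|lborel. u1 z * dbar \<phi> z) + (LINT z|lborel. (z * u2 z) * dbar \<phi> z)"
        by (intro Bochner_Integration.integral_add borel_weighted_L2_integrable_compact_support[OF u1(1) c(2) R(2)]
           borel_weighted_L2_integrable_compact_support[OF zu2 c(2) R(2)]) auto
      \<comment> \<open>Since \<open>z\<close> is holomorphic it passes through \<open>dbar\<close>,
        so the equation for \<open>u2\<close> can be tested against
        \<open>z * \<phi> z\<close>.\<close>
      also have "(LINT z|lborel. (z * u2 z) * dbar \<phi> z) = (LINT z|lborel. u2 z * dbar (\<lambda>z. z * \<phi> z) z)"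
        by (simp add: dbar_id_mult[OF smooth_differentiable[OF s]] mult_ac)
      also have "\<dots> = - (LINT z|lborel. ?v2 z * (z * \<phi> z))" by (rule u2(2)[OF z\<phi>])
      also have "(LINT z|lborel. u1 z * dbar \<phi> z) = - (LINT z|lborel. ?v1 z * \<phi> z)" by (rule u1(2)[OF \<phi>])
      also have "- (LINT z|lborel. ?v1 z * \<phi> z) + - (LINT z|lborel. ?v2 z * (z * \<phi> z)) =
        - ((LINT z|lborel. ?v1 z * \<phi> z) + (LINT z|lborel. ?v2 z * (z * \<phi> z)))" by simp
      also have "(LINT z|lborel. ?v1 z * \<phi> z) + (LINT z|lborel. ?v2 z * (z * \<phi> z)) = (LINT z|lborel. ?v1 z * \<phi> z + ?v2 z * (z * \<phi> z))"
      proof (rule Bochner_Integration.integral_add[symmetric])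
        show "integrable lborel (\<lambda>z. ?v1 z * \<phi> z)"
          by (rule borel_weighted_L2_integrable_compact_support[OF v1 c(1) R(1)]) auto
        show "integrable lborel (\<lambda>z. ?v2 z * (z * \<phi> z))"
          by (rule borel_weighted_L2_integrable_compact_support[OF v2 smooth_continuous[OF sz], of R]) (use R in auto)
      qed
      also have "\<dots> = (LINT z|lborel. v z * \<phi> z)"
        by (rule Bochner_Integration.integral_cong) auto
      finally show ?thesis .
    qed
    ultimately show ?thesis by blast
  qed
qed

subsection \<open>Uniqueness\<close>

text \<open>Up to the factor \<open>cauchy_const\<close> and a reflection this is the Cauchy
  transform. Here the parameter sits in the smooth factor, so derivatives fall on
  \<open>\<psi>\<close> and never on the singular kernel.\<close>

definition cauchy_conv :: "(complex \<Rightarrow> complex) \<Rightarrow> complex \<Rightarrow> complex" where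
  "cauchy_conv \<psi> z = (LINT x|lborel. \<psi> (z - x) / x)"

lemma cauchy_conv_integrable:
  assumes c: "continuous_on UNIV \<psi>" and R: "\<And>z. \<psi> z \<noteq> 0 \<Longrightarrow> cmod z \<le> R"
  shows "integrable lborel (\<lambda>x. \<psi> (z - x) / x)"
proof -
  have "integrable lborel (\<lambda>x. \<psi> (z - x) / (0 - x))"
  proof (rule integrable_cauchy_kernel)
    show "continuous_on UNIV (\<lambda>x. \<psi> (z - x))"
      by (auto intro!: continuous_on_compose2[OF c] continuous_intros)
    fix x assume "\<psi> (z - x) \<noteq> 0"
    then have "cmod (z - x) \<le> R" by (rule R)
    then show "cmod x \<le> R + cmod z" using norm_triangle_ineq4[of z "z - x"] by simp
  qed
  then have "integrable lborel (\<lambda>x. - (\<psi> (z - x) / (0 - x)))" by (rule Bochner_Integration.integrable_minus)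
  then show ?thesis by simp
qed

lemma partial_support:
  assumes "smooth \<phi>" "\<And>z. \<phi> z \<noteq> 0 \<Longrightarrow> cmod z \<le> R"
  shows "partial_x \<phi> z \<noteq> 0 \<Longrightarrow> cmod z \<le> R" "partial_y \<phi> z \<noteq> 0 \<Longrightarrow> cmod z \<le> R"
proof -
  have "frechet_derivative \<phi> (at z) h = 0" if "\<not> cmod z \<le> R" for h
    using compact_support_derivative_eq_0[of \<phi> "frechet_derivative \<phi> (at z)" z R h] that
      frechet_derivative_works smooth_differentiable[OF assms(1)] assms(2) by auto
  then show "partial_x \<phi> z \<noteq> 0 \<Longrightarrow> cmod z \<le> R" "partial_y \<phi> z \<noteq> 0 \<Longrightarrow> cmod z \<le> R"
    unfolding partial_x_def partial_y_def by blast+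
qed

lemma cauchy_conv_linear:
  assumes "continuous_on UNIV f" "continuous_on UNIV g" "\<And>z. f z \<noteq> 0 \<Longrightarrow> cmod z \<le> R" "\<And>z. g z \<noteq> 0 \<Longrightarrow> cmod z \<le> R"
  shows "cauchy_conv (\<lambda>z. a * f z + b * g z) z = a * cauchy_conv f z + b * cauchy_conv g z"
proof -
  have i: "integrable lborel (\<lambda>x. a * (f (z - x) / x))" "integrable lborel (\<lambda>x. b * (g (z - x) / x))"
    by (intro integrable_mult_right cauchy_conv_integrable[OF assms(1,3)] cauchy_conv_integrable[OF assms(2,4)], assumption+)+
  have "cauchy_conv (\<lambda>z. a * f z + b * g z) z = (LINT x|lborel. a * (f (z - x) / x) + b * (g (z - x) / x))"
    unfolding cauchy_conv_def by (rule Bochner_Integration.integral_cong) (auto simp: add_divide_distrib)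
  also have "\<dots> = (LINT x|lborel. a * (f (z - x) / x)) + (LINT x|lborel. b * (g (z - x) / x))"
    by (rule Bochner_Integration.integral_add[OF i])
  also have "\<dots> = a * cauchy_conv f z + b * cauchy_conv g z"
    unfolding cauchy_conv_def by (simp only: integral_mult_right_zero)
  finally show ?thesis .
qed

text \<open>Differentiation under the integral along sequences of increments. The normalized
  remainder of \<open>\<psi>\<close> tends to 0 pointwise and is bounded by \<open>2 * L\<close> on
  a fixed disc, where the kernel is integrable.\<close>

lemma cauchy_conv_has_derivative:
  assumes s: "smooth \<psi>" and R: "\<And>z. \<psi> z \<noteq> 0 \<Longrightarrow> cmod z \<le> R"
  shows "(cauchy_conv \<psi> has_derivative
    (\<lambda>h. of_real (Re h) * cauchy_conv (partial_x \<psi>) z + of_real (Im h) * cauchy_conv (partial_y \<psi>) z)) (at z)"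
proof -
  let ?X = "partial_x \<psi>" and ?Y = "partial_y \<psi>"
  define D where "D = (\<lambda>w h. of_real (Re h) * ?X w + of_real (Im h) * ?Y w)"
  have dpsi: "(\<psi> has_derivative D w) (at w)" for w
    unfolding D_def by (rule has_derivative_partials[OF smooth_differentiable[OF s]])
  note c = smooth_continuous[OF s, of UNIV] smooth_continuous[OF smooth_partials(1)[OF s], of UNIV]
    smooth_continuous[OF smooth_partials(2)[OF s], of UNIV]
  note XR = partial_support(1)[OF s R] and YR = partial_support(2)[OF s R]
  have cD: "continuous_on UNIV (\<lambda>w. D w h)" for h
    unfolding D_def by (intro continuous_intros c)
  obtain Mx My where M: "0 \<le> Mx" "\<And>w. cmod (?X w) \<le> Mx" "0 \<le> My" "\<And>w. cmod (?Y w) \<le> My"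
    using compact_support_bounded[OF c(2) XR] compact_support_bounded[OF c(3) YR] by metis
  define L where "L = Mx + My"
  have L: "0 \<le> L" using M by (simp add: L_def)
  have DL: "cmod (D w h) \<le> L * cmod h" for w h
  proof -
    have "cmod (D w h) \<le> \<bar>Re h\<bar> * cmod (?X w) + \<bar>Im h\<bar> * cmod (?Y w)"
      unfolding D_def by (rule order_trans[OF norm_triangle_ineq]) (simp add: norm_mult)
    also have "\<dots> \<le> cmod h * Mx + cmod h * My"
      using M by (intro add_mono mult_mono abs_Re_le_cmod abs_Im_le_cmod) auto
    finally show ?thesis by (simp add: L_def algebra_simps)
  qed
  have DR: "D w h \<noteq> 0 \<Longrightarrow> cmod w \<le> R" for w h
    using XR[of w] YR[of w] unfolding D_def by fastforce
  have conv_D: "cauchy_conv (\<lambda>w. D w h) z = of_real (Re h) * cauchy_conv ?X z + of_real (Im h) * cauchy_conv ?Y z" for h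
    unfolding D_def by (rule cauchy_conv_linear[OF c(2,3) XR YR])
  have "bounded_linear (\<lambda>h. of_real (Re h) * cauchy_conv ?X z + of_real (Im h) * cauchy_conv ?Y z)"
    by (intro bounded_linear_add bounded_linear_mult_const bounded_linear_compose[OF bounded_linear_of_real] bounded_linear_Re bounded_linear_Im)
  moreover have "((\<lambda>h. norm (cauchy_conv \<psi> (z + h) - cauchy_conv \<psi> z -
      (of_real (Re h) * cauchy_conv ?X z + of_real (Im h) * cauchy_conv ?Y z)) / norm h) \<longlongrightarrow> 0) (at 0)"
  proof (subst tendsto_at_iff_sequentially, intro allI impI)
    fix h :: "nat \<Rightarrow> complex" assume hne: "\<forall>i. h i \<in> UNIV - {0}" and h0: "h \<longlonglongrightarrow> 0"
    have hnz: "h n \<noteq> 0" for n using hne by simp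
    \<comment> \<open>A bound on all increments confines the supports of all remainders to the disc
      of radius \<open>\<rho>\<close>.\<close>
    obtain K where K: "\<And>n. cmod (h n) \<le> K"
      using convergent_imp_Bseq[OF convergentI[OF h0]] unfolding Bseq_def by blast
    let ?q = "\<lambda>n w. (\<psi> (w + h n) - \<psi> w - D w (h n)) /\<^sub>R norm (h n)"
    define \<rho> where "\<rho> = R + cmod z + K"
    \<comment> \<open>A continuous substitute for the indicator of the disc of radius
      \<open>\<rho>\<close>, equal to 1 on it; the integrability lemma for the kernel takes
      continuous functions.\<close>
    define g :: "complex \<Rightarrow> complex" where "g = (\<lambda>x. of_real (max 0 (min 1 (\<rho> + 1 - cmod x))))"
    have gi: "integrable lborel (\<lambda>x. 2 * L * cmod (g x / (0 - x)))"
    proof (intro integrable_mult_right integrable_norm integrable_cauchy_kernel)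
      show "continuous_on UNIV g" unfolding g_def by (intro continuous_intros)
      show "cmod x \<le> \<rho> + 1" if "g x \<noteq> 0" for x using that unfolding g_def by (auto simp: max_def min_def split: if_splits)
    qed
    have "(\<lambda>n. LINT x|lborel. ?q n (z - x) / x) \<longlonglongrightarrow> (LINT x::complex|lborel. 0)"
    proof (rule integral_dominated_convergence[OF _ _ gi])
      have [measurable]: "\<psi> \<in> borel_measurable borel" "(\<lambda>w. D w k) \<in> borel_measurable borel" for k
        using c(1) cD by (auto intro: borel_measurable_continuous_onI)
      show "(\<lambda>x. ?q n (z - x) / x) \<in> borel_measurable lborel" for n
      proof -
        have [measurable]: "?q n \<in> borel_measurable borel" by measurable
        show ?thesis by measurable
      qed
      show "AE x in lborel. (\<lambda>n. ?q n (z - x) / x) \<longlonglongrightarrow> 0"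
      proof (rule AE_I2)
        fix x
        have "((\<lambda>k. norm (\<psi> (z - x + k) - \<psi> (z - x) - D (z - x) k) / norm k) \<longlongrightarrow> 0) (at 0)"
          using dpsi[of "z - x"] unfolding has_derivative_at by blast
        moreover have "filterlim h (at 0) sequentially"
          using h0 hnz by (auto simp: filterlim_at)
        ultimately have "(\<lambda>n. norm (\<psi> (z - x + h n) - \<psi> (z - x) - D (z - x) (h n)) / norm (h n)) \<longlonglongrightarrow> 0"
          by (rule filterlim_compose)
        then have "(\<lambda>n. norm (?q n (z - x))) \<longlonglongrightarrow> 0" by (simp add: divide_inverse mult.commute)
        then have "(\<lambda>n. ?q n (z - x)) \<longlonglongrightarrow> 0" by (rule tendsto_norm_zero_cancel)
        from tendsto_mult[OF this tendsto_const[of "inverse x"]]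
        show "(\<lambda>n. ?q n (z - x) / x) \<longlonglongrightarrow> 0" by (simp add: divide_inverse)
      qed
      show "AE x in lborel. norm (?q n (z - x) / x) \<le> 2 * L * cmod (g x / (0 - x))" for n
      proof (rule AE_I2)
        fix x
        have q: "norm (?q n (z - x)) \<le> 2 * L * cmod (g x)"
        proof (cases "cmod x \<le> \<rho>")
          case True
          have "cmod (\<psi> (z - x + h n) - \<psi> (z - x)) \<le> L * cmod (h n)"
            by (rule directional_difference_bound[OF dpsi DL])
          moreover have "cmod (D (z - x) (h n)) \<le> L * cmod (h n)" by (rule DL)
          ultimately have "cmod (\<psi> (z - x + h n) - \<psi> (z - x) - D (z - x) (h n)) \<le> 2 * L * cmod (h n)"
            using norm_triangle_ineq4[of "\<psi> (z - x + h n) - \<psi> (z - x)" "D (z - x) (h n)"] by linarith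
          then have "norm (?q n (z - x)) \<le> 2 * L" using hnz[of n]
            by (simp add: divide_inverse_commute[symmetric] pos_divide_le_eq)
          moreover have "g x = 1" using True by (simp add: g_def)
          ultimately show ?thesis by simp
        next
          case False
          have "cmod x \<le> cmod (z - x) + cmod z" using norm_triangle_ineq4[of z "z - x"] by simp
          moreover have "cmod (z - x) \<le> cmod (z - x + h n) + cmod (h n)" using norm_triangle_ineq4[of "z - x + h n" "h n"] by simp
          moreover have "cmod (h n) \<le> K" "0 \<le> cmod (h n)" using K by auto
          ultimately have "R < cmod (z - x + h n)" "R < cmod (z - x)" using False unfolding \<rho>_def by linarith+
          then have "\<psi> (z - x + h n) = 0" "\<psi> (z - x) = 0" "D (z - x) (h n) = 0"
            using R DR by (meson not_le)+
          then have "?q n (z - x) = 0" by simp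
          then show ?thesis using L by (simp only: norm_zero) (intro mult_nonneg_nonneg, auto)
        qed
        then have "norm (?q n (z - x)) / cmod x \<le> 2 * L * cmod (g x) / cmod x" by (rule divide_right_mono) simp
        then show "norm (?q n (z - x) / x) \<le> 2 * L * cmod (g x / (0 - x))" by (simp add: norm_divide)
      qed
    qed simp
    moreover have "(LINT x|lborel. ?q n (z - x) / x) = (cauchy_conv \<psi> (z + h n) - cauchy_conv \<psi> z -
      (of_real (Re (h n)) * cauchy_conv ?X z + of_real (Im (h n)) * cauchy_conv ?Y z)) /\<^sub>R norm (h n)" for n
    proof -
      have i: "integrable lborel (\<lambda>x. \<psi> (z + h n - x) / x)" "integrable lborel (\<lambda>x. \<psi> (z - x) / x)"
        "integrable lborel (\<lambda>x. D (z - x) (h n) / x)"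
        by (rule cauchy_conv_integrable[OF c(1) R], assumption)+
          (rule cauchy_conv_integrable[of "\<lambda>w. D w (h n)" R, OF cD DR], assumption)
      have "(LINT x|lborel. ?q n (z - x) / x) =
        (LINT x|lborel. (\<psi> (z + h n - x) / x - \<psi> (z - x) / x - D (z - x) (h n) / x) /\<^sub>R norm (h n))"
        by (rule Bochner_Integration.integral_cong[OF refl])
          (simp only: diff_divide_distrib[symmetric] scaleR_conv_of_real times_divide_eq_right diff_add_eq)
      also have "\<dots> = (cauchy_conv \<psi> (z + h n) - cauchy_conv \<psi> z - cauchy_conv (\<lambda>w. D w (h n)) z) /\<^sub>R norm (h n)"
        unfolding cauchy_conv_def using i by simp
      finally show ?thesis unfolding conv_D .
    qed
    ultimately have "(\<lambda>n. (cauchy_conv \<psi> (z + h n) - cauchy_conv \<psi> z -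
      (of_real (Re (h n)) * cauchy_conv ?X z + of_real (Im (h n)) * cauchy_conv ?Y z)) /\<^sub>R norm (h n)) \<longlonglongrightarrow> 0" by simp
    from tendsto_norm_zero[OF this]
    show "((\<lambda>h. norm (cauchy_conv \<psi> (z + h) - cauchy_conv \<psi> z -
      (of_real (Re h) * cauchy_conv ?X z + of_real (Im h) * cauchy_conv ?Y z)) / norm h) \<circ> h) \<longlonglongrightarrow> 0"
      by (simp add: o_def divide_inverse mult.commute)
  qed
  ultimately show ?thesis unfolding has_derivative_at by blast
qed

lemma cauchy_conv_C_k:
  assumes "smooth \<psi>" "\<And>z. \<psi> z \<noteq> 0 \<Longrightarrow> cmod z \<le> R"
  shows "C_k k (cauchy_conv \<psi>)"
  using assms
proof (induction k arbitrary: \<psi>)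
  case 0
  have "isCont (cauchy_conv \<psi>) z" for z
    by (rule has_derivative_continuous[OF cauchy_conv_has_derivative[OF 0]])
  then show ?case by (simp add: continuous_at_imp_continuous_on)
next
  case (Suc k)
  have "C_k k (cauchy_conv (partial_x \<psi>))" "C_k k (cauchy_conv (partial_y \<psi>))"
    using Suc.IH[OF smooth_partials(1)[OF Suc.prems(1)] partial_support(1)[OF Suc.prems]]
      Suc.IH[OF smooth_partials(2)[OF Suc.prems(1)] partial_support(2)[OF Suc.prems]] by blast+
  then show ?case
    by (intro C_k_SucI[OF cauchy_conv_has_derivative[OF Suc.prems]]) simp_all
qed

text \<open>By linearity \<open>dbar\<close> falls on \<open>\<psi>\<close>; reflection returns the
  variable to the kernel, and the Cauchy-Pompeiu formula evaluates the result.\<close>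

lemma dbar_cauchy_conv:
  assumes s: "smooth \<psi>" and R: "\<And>z. \<psi> z \<noteq> 0 \<Longrightarrow> cmod z \<le> R"
  shows "dbar (cauchy_conv \<psi>) z = of_real cauchy_const * \<psi> z"
proof -
  have "dbar (cauchy_conv \<psi>) z = (1/2) * cauchy_conv (partial_x \<psi>) z + (\<i>/2) * cauchy_conv (partial_y \<psi>) z"
    using partial_derivs(3)[OF cauchy_conv_has_derivative[OF assms]] by (simp add: add_divide_distrib)
  also have "\<dots> = cauchy_conv (\<lambda>z. (1/2) * partial_x \<psi> z + (\<i>/2) * partial_y \<psi> z) z"
    by (rule cauchy_conv_linear[symmetric, OF smooth_continuous[OF smooth_partials(1)[OF s]] smooth_continuous[OF smooth_partials(2)[OF s]]
      partial_support(1)[OF assms] partial_support(2)[OF assms]])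
  also have "(\<lambda>z. (1/2) * partial_x \<psi> z + (\<i>/2) * partial_y \<psi> z) = dbar \<psi>"
    by (simp add: fun_eq_iff dbar_def add_divide_distrib)
  also have "cauchy_conv (dbar \<psi>) z = (LINT x|lborel. dbar \<psi> (z - x) / (z - (z - x)))"
    by (simp add: cauchy_conv_def)
  also have "\<dots> = (LINT x|lborel. dbar \<psi> x / (z - x))"
  proof (rule lborel_integral_reflect)
    have [measurable]: "dbar \<psi> \<in> borel_measurable borel"
      by (intro borel_measurable_continuous_onI smooth_continuous smooth_dbar s)
    show "(\<lambda>x. dbar \<psi> x / (z - x)) \<in> borel_measurable borel" by measurable
  qed
  also have "\<dots> = of_real cauchy_const * \<psi> z" by (rule cauchy_pompeiu[OF assms])
  finally show ?thesis .
qed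

lemma cauchy_conv_decay:
  assumes c: "continuous_on UNIV \<psi>" and R: "\<And>z. \<psi> z \<noteq> 0 \<Longrightarrow> cmod z \<le> R"
  obtains C where "0 \<le> C" "\<And>z. cmod (cauchy_conv \<psi> z) \<le> C / bracket z"
proof -
  obtain C where C: "0 \<le> C" "\<And>z. (\<integral>\<^sup>+x. ennreal (cmod (\<psi> x / (z - x))) \<partial>lborel) \<le> ennreal (C / bracket z)"
    using nn_integral_cauchy_kernel[OF assms] by blast
  have [measurable]: "\<psi> \<in> borel_measurable borel" by (rule borel_measurable_continuous_onI[OF c])
  have "cmod (cauchy_conv \<psi> z) \<le> C / bracket z" for z
  proof -
    have "cauchy_conv \<psi> z = (LINT x|lborel. \<psi> (z - x) / (z - (z - x)))" by (simp add: cauchy_conv_def)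
    also have "\<dots> = (LINT x|lborel. \<psi> x / (z - x))" by (rule lborel_integral_reflect) measurable
    finally have "ennreal (cmod (cauchy_conv \<psi> z)) = ennreal (norm (LINT x|lborel. \<psi> x / (z - x)))" by simp
    also have "\<dots> \<le> (\<integral>\<^sup>+x. ennreal (cmod (\<psi> x / (z - x))) \<partial>lborel)"
      by (rule integral_norm_bound_ennreal[OF integrable_cauchy_kernel[OF assms]])
    also have "\<dots> \<le> ennreal (C / bracket z)" by (rule C)
    finally show ?thesis using C(1) by simp
  qed
  with C(1) that show ?thesis by blast
qed

section \<open>Cutoffs and averages over growing discs\<close>

text \<open>A smooth function supported in the disc of radius \<open>n + 1\<close>, tending pointwise to the constant
  \<open>exp (-1)\<close> rather than to \<open>1\<close>.\<close>

definition cutoff :: "nat \<Rightarrow> complex \<Rightarrow> complex" where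
  "cutoff n z = of_real (flat 0 (Re (1 + (- 1 / of_nat (Suc n) ^ 2) * (z * cnj z))))"

lemma cutoff_eq: "cutoff n z = of_real (flat 0 (1 - (cmod z)\<^sup>2 / (real (Suc n))\<^sup>2))"
proof -
  have "1 + (- 1 / of_nat (Suc n) ^ 2) * (z * cnj z) = complex_of_real (1 - (cmod z)\<^sup>2 / (real (Suc n))\<^sup>2)"
    by (simp add: complex_norm_square[symmetric] del: of_nat_Suc)
  then show ?thesis unfolding cutoff_def by (simp only: Re_complex_of_real)
qed

lemma smooth_cutoff: "smooth (cutoff n)"
proof -
  have "smooth (\<lambda>z. 1 + (- 1 / of_nat (Suc n) ^ 2) * (z * cnj z))"
    by (intro smooth_add smooth_mult smooth_const smooth_linear bounded_linear_ident bounded_linear_cnj)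
  then show ?thesis unfolding cutoff_def[abs_def] by (rule smooth_flat_compose)
qed

lemma cutoff_support: assumes "cutoff n z \<noteq> 0" shows "cmod z \<le> real (Suc n)"
proof (rule ccontr)
  assume "\<not> ?thesis"
  then have "(real (Suc n))\<^sup>2 \<le> (cmod z)\<^sup>2" by (intro power_mono) auto
  then have "1 \<le> (cmod z)\<^sup>2 / (real (Suc n))\<^sup>2" by (simp add: pos_le_divide_eq del: of_nat_Suc)
  then show False using assms by (simp add: cutoff_eq flat_def del: of_nat_Suc)
qed

lemma flat_0_le_1: "flat 0 t \<le> 1" "0 \<le> flat m t"
  by (auto simp: flat_def)

text \<open>With s = 1/t this is s^2 * exp (-s) \<le> 2, a consequence of the quadratic Taylor bound
  for the exponential.\<close>

lemma flat_2_le: "flat 2 t \<le> 2"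
proof (cases "t \<le> 0")
  case False
  then have "(1 / t)\<^sup>2 / 2 \<le> exp (1 / t)"
    using exp_lower_Taylor_quadratic[of "1 / t"] by (smt (verit) divide_nonneg_pos)
  then have "(1 / t)\<^sup>2 * exp (- (1 / t)) \<le> 2 * exp (1 / t) * exp (- (1 / t))"
    by (intro mult_right_mono) auto
  also have "\<dots> = 2" by (simp add: exp_minus)
  finally show ?thesis using False by (simp add: flat_def power_divide)
qed (simp add: flat_def)

lemma cutoff_norm_le: "cmod (cutoff n z) \<le> 1"
  unfolding cutoff_eq norm_of_real using flat_0_le_1 by (simp add: abs_of_nonneg)

text \<open>The derivative of \<open>flat 0\<close> is \<open>flat 2\<close>, and
  \<open>dbar\<close> of |z|^2 is z. Keeping the factor |z| matters: it cancels the decay 1/|z| of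
  the convolution and leaves exactly the average over the disc.\<close>

lemma dbar_cutoff_norm_le: "cmod (dbar (cutoff n) z) \<le> 2 * cmod z / (real (Suc n))\<^sup>2"
proof -
  let ?N = "(real (Suc n))\<^sup>2"
  have "((\<lambda>z. 1 - (z \<bullet> z) / ?N) has_derivative (\<lambda>h. - (2 * (z \<bullet> h) / ?N))) (at z)"
  proof -
    have "((\<lambda>z. 1 - (z \<bullet> z) * c) has_derivative (\<lambda>h. - (2 * (z \<bullet> h) * c))) (at z)" for c
      by (auto intro!: derivative_eq_intros simp: inner_commute algebra_simps)
    from this[of "1 / ?N"] show ?thesis by (simp only: times_divide_eq_right mult_1_right)
  qed
  from has_derivative_compose[OF this DERIV_flat[of 0, unfolded has_field_derivative_def]]
  have "((\<lambda>z. flat 0 (1 - (z \<bullet> z) / ?N)) has_derivative (\<lambda>h. flat 2 (1 - (z \<bullet> z) / ?N) * - (2 * (z \<bullet> h) / ?N))) (at z)"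
    by (simp add: numeral_2_eq_2)
  from bounded_linear.has_derivative[OF bounded_linear_of_real this]
  have "(cutoff n has_derivative (\<lambda>h. of_real (flat 2 (1 - (z \<bullet> z) / ?N) * - (2 * (z \<bullet> h) / ?N)))) (at z)"
    unfolding cutoff_eq[abs_def] power2_norm_eq_inner .
  from partial_derivs(3)[OF this]
  have "dbar (cutoff n) z = of_real (- flat 2 (1 - (z \<bullet> z) / ?N) / ?N) * z"
    by (simp add: complex_eq_iff inner_complex_def add_divide_distrib del: of_nat_Suc)
  then have "cmod (dbar (cutoff n) z) = flat 2 (1 - (z \<bullet> z) / ?N) / ?N * cmod z"
    using flat_0_le_1(2) by (simp add: norm_mult abs_divide abs_of_nonneg del: of_nat_Suc of_real_divide of_real_minus)
  also have "\<dots> \<le> 2 / ?N * cmod z" by (intro mult_right_mono divide_right_mono flat_2_le) auto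
  finally show ?thesis by simp
qed

lemma cutoff_tendsto: "(\<lambda>n. cutoff n z) \<longlonglongrightarrow> of_real (exp (-1))"
proof -
  have "(\<lambda>n. 1 / real (Suc n)) \<longlonglongrightarrow> 0"
    using LIMSEQ_inverse_real_of_nat by (simp add: inverse_eq_divide)
  then have "(\<lambda>n. 1 - (cmod z)\<^sup>2 * (1 / real (Suc n))\<^sup>2) \<longlonglongrightarrow> 1 - (cmod z)\<^sup>2 * 0\<^sup>2" by (intro tendsto_intros)
  moreover have "isCont (flat 0) (1 - (cmod z)\<^sup>2 * 0\<^sup>2)" using DERIV_flat DERIV_isCont by blast
  ultimately have "(\<lambda>n. flat 0 (1 - (cmod z)\<^sup>2 * (1 / real (Suc n))\<^sup>2)) \<longlonglongrightarrow> flat 0 (1 - (cmod z)\<^sup>2 * 0\<^sup>2)"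
    by (rule isCont_tendsto_compose[rotated])
  then have "(\<lambda>n. flat 0 (1 - (cmod z)\<^sup>2 / (real (Suc n))\<^sup>2)) \<longlonglongrightarrow> exp (-1)"
    by (simp add: power_divide flat_def[of 0 1])
  then show ?thesis unfolding cutoff_eq by (rule tendsto_of_real)
qed

text \<open>The inequality |w| \<le> l |w|^2 + 1/l splits the average. The square part tends to 0
  for each fixed \<open>l\<close> by dominated convergence, and the rest is at most pi/l, since the
  area of the disc cancels the normalization.\<close>

lemma average_tendsto_0:
  assumes w: "borel_weighted_L2 1 w"
  shows "(\<lambda>n. LINT z|lborel. indicator (cball 0 (real (Suc n))) z * cmod (w z) / (real (Suc n))\<^sup>2) \<longlonglongrightarrow> 0"
proof -
  have [measurable]: "w \<in> borel_measurable borel" using w by (simp add: borel_weighted_L2_def)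
  let ?I = "\<lambda>n z. indicator (cball (0::complex) (real (Suc n))) z :: real" and ?N = "\<lambda>n. (real (Suc n))\<^sup>2"
  have [measurable]: "?I n \<in> borel_measurable borel" for n by (rule borel_measurable_indicator) simp
  have mA: "(\<lambda>z. ?I n z * (cmod (w z))\<^sup>2 / ?N n) \<in> borel_measurable lborel"
    and mB: "(\<lambda>z. ?I n z * cmod (w z) / ?N n) \<in> borel_measurable lborel" for n
    by (intro borel_measurable_divide borel_measurable_times borel_measurable_indicator; measurable; simp)+
  have Ii: "integrable lborel (?I n)" for n
    by (rule integrable_real_indicator) (auto simp: emeasure_cball)
  have Iv: "(LINT z|lborel. ?I n z) = pi * ?N n" for n
    by (simp add: content_cball unit_ball_vol_2)
  have iw: "integrable lborel (\<lambda>z. 2 * ((cmod (w z))\<^sup>2 * bracket z powr -2))"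
    by (rule integrable_mult_right, rule integrableI_bounded) (use w in \<open>auto simp: borel_weighted_L2_def\<close>)
  \<comment> \<open>On the disc of radius n + 1 the square of the bracket is at most twice (n +
    1)^2, which accounts for the factor 2 and gives a bound independent of \<open>n\<close>.\<close>
  have dom: "?I n z * (cmod (w z))\<^sup>2 / ?N n \<le> 2 * ((cmod (w z))\<^sup>2 * bracket z powr -2)" for n z
  proof (cases "z \<in> cball 0 (real (Suc n))")
    case True
    then have "(cmod z)\<^sup>2 \<le> ?N n" by (intro power_mono) auto
    moreover have "1 \<le> ?N n" by (intro one_le_power) simp
    ultimately have "(bracket z)\<^sup>2 \<le> 2 * ?N n" unfolding bracket_sq by linarith
    then have "1 / ?N n \<le> 2 / (bracket z)\<^sup>2" by (simp add: divide_simps del: of_nat_Suc)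
    then have "(cmod (w z))\<^sup>2 * (1 / ?N n) \<le> (cmod (w z))\<^sup>2 * (2 / (bracket z)\<^sup>2)" by (rule mult_left_mono) simp
    then show ?thesis using True by (simp add: powr_minus divide_inverse mult_ac del: of_nat_Suc)
  qed simp
  have A: "(\<lambda>n. LINT z|lborel. ?I n z * (cmod (w z))\<^sup>2 / ?N n) \<longlonglongrightarrow> (LINT z::complex|lborel. 0)"
  proof (rule integral_dominated_convergence[OF _ _ iw])
    show "AE z in lborel. (\<lambda>n. ?I n z * (cmod (w z))\<^sup>2 / ?N n) \<longlonglongrightarrow> 0"
    proof (rule AE_I2)
      fix z
      have "(\<lambda>n. 1 / real (Suc n)) \<longlonglongrightarrow> 0"
        using LIMSEQ_inverse_real_of_nat by (simp add: inverse_eq_divide)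
      then have "(\<lambda>n. (cmod (w z))\<^sup>2 * (1 / real (Suc n))\<^sup>2) \<longlonglongrightarrow> (cmod (w z))\<^sup>2 * 0\<^sup>2" by (intro tendsto_intros)
      then have l: "(\<lambda>n. (cmod (w z))\<^sup>2 * (1 / real (Suc n))\<^sup>2) \<longlonglongrightarrow> 0" by simp
      show "(\<lambda>n. ?I n z * (cmod (w z))\<^sup>2 / ?N n) \<longlonglongrightarrow> 0"
        by (rule tendsto_sandwich[OF _ _ tendsto_const l]) (auto simp: indicator_def power_divide)
    qed
    show "AE z in lborel. norm (?I n z * (cmod (w z))\<^sup>2 / ?N n) \<le> 2 * ((cmod (w z))\<^sup>2 * bracket z powr -2)" for n
      using dom by (intro AE_I2) (simp add: abs_of_nonneg del: of_nat_Suc)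
  qed (simp, rule mA)
  have iA: "integrable lborel (\<lambda>z. ?I n z * (cmod (w z))\<^sup>2 / ?N n)" for n
    by (rule Bochner_Integration.integrable_bound[OF iw])
       (rule mA, intro AE_I2, unfold real_norm_def, rule order_trans[OF _ abs_ge_self],
        subst abs_of_nonneg, simp, rule dom)
  have bound: "\<bar>LINT z|lborel. ?I n z * cmod (w z) / ?N n\<bar> \<le> l * (LINT z|lborel. ?I n z * (cmod (w z))\<^sup>2 / ?N n) + pi / l"
    if l: "0 < l" for n l
  proof -
    have le: "?I n z * cmod (w z) / ?N n \<le> l * (?I n z * (cmod (w z))\<^sup>2 / ?N n) + ?I n z * (1 / (l * ?N n))" for z
    proof (cases "z \<in> cball 0 (real (Suc n))")
      case True
      have "(sqrt l * cmod (w z)) * (1 / sqrt l) \<le> (sqrt l * cmod (w z))\<^sup>2 + (1 / sqrt l)\<^sup>2"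
        by (rule mult_le_sum_squares) (use l in auto)
      then have "cmod (w z) \<le> l * (cmod (w z))\<^sup>2 + 1 / l" using l by (simp add: power_mult_distrib power_divide)
      then have "cmod (w z) / ?N n \<le> (l * (cmod (w z))\<^sup>2 + 1 / l) / ?N n" by (rule divide_right_mono) simp
      then show ?thesis using True l by (simp add: add_divide_distrib del: of_nat_Suc)
    qed simp
    have i: "integrable lborel (\<lambda>z. l * (?I n z * (cmod (w z))\<^sup>2 / ?N n) + ?I n z * (1 / (l * ?N n)))"
      by (intro Bochner_Integration.integrable_add integrable_mult_right integrable_mult_left iA Ii)
    have iB: "integrable lborel (\<lambda>z. ?I n z * cmod (w z) / ?N n)"
      by (rule Bochner_Integration.integrable_bound[OF i])
         (rule mB, intro AE_I2, unfold real_norm_def, rule order_trans[OF _ abs_ge_self],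
          subst abs_of_nonneg, simp, rule le)
    have "\<bar>LINT z|lborel. ?I n z * cmod (w z) / ?N n\<bar> = (LINT z|lborel. ?I n z * cmod (w z) / ?N n)"
      by (intro abs_of_nonneg integral_nonneg_AE AE_I2) simp
    also have "\<dots> \<le> (LINT z|lborel. l * (?I n z * (cmod (w z))\<^sup>2 / ?N n) + ?I n z * (1 / (l * ?N n)))"
      by (rule integral_mono[OF iB i le])
    also have "\<dots> = (LINT z|lborel. l * (?I n z * (cmod (w z))\<^sup>2 / ?N n)) + (LINT z|lborel. ?I n z * (1 / (l * ?N n)))"
      by (rule Bochner_Integration.integral_add) (intro integrable_mult_right integrable_mult_left iA Ii)+
    also have "\<dots> = l * (LINT z|lborel. ?I n z * (cmod (w z))\<^sup>2 / ?N n) + pi * ?N n * (1 / (l * ?N n))"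
      by (simp only: integral_mult_right_zero integral_mult_left_zero Iv)
    also have "pi * ?N n * (1 / (l * ?N n)) = pi / l" by (simp del: of_nat_Suc)
    finally show ?thesis .
  qed
  show ?thesis
  proof (rule LIMSEQ_I)
    fix e :: real assume e: "0 < e"
    \<comment> \<open>This choice makes the remainder pi/l equal to e/2.\<close>
    define l where "l = 2 * pi / e"
    have l: "0 < l" using e by (simp add: l_def)
    from A have "(\<lambda>n. l * (LINT z|lborel. ?I n z * (cmod (w z))\<^sup>2 / ?N n)) \<longlonglongrightarrow> l * 0"
      by (intro tendsto_intros) simp
    then obtain n0 where n0: "\<And>n. n0 \<le> n \<Longrightarrow> norm (l * (LINT z|lborel. ?I n z * (cmod (w z))\<^sup>2 / ?N n) - l * 0) < e / 2"
      using LIMSEQ_D[of _ _ "e/2"] e half_gt_zero by blast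
    have "norm ((LINT z|lborel. ?I n z * cmod (w z) / ?N n) - 0) < e" if "n0 \<le> n" for n
    proof -
      have "pi / l = e / 2" using e by (simp add: l_def)
      with bound[OF l, of n] n0[OF that] show ?thesis
        unfolding real_norm_def by linarith
    qed
    then show "\<exists>n0. \<forall>n\<ge>n0. norm ((LINT z|lborel. ?I n z * cmod (w z) / ?N n) - 0) < e" by blast
  qed
qed

lemma borel_weighted_L2_set_integrable:
  assumes w: "borel_weighted_L2 \<theta> w" and S: "S \<in> sets borel" "bounded S"
  shows "integrable lborel (\<lambda>z. indicator S z *\<^sub>R w z)"
proof -
  obtain R where R: "\<And>z. z \<in> S \<Longrightarrow> cmod z \<le> R" using S(2) by (auto simp: bounded_iff)
  \<comment> \<open>A continuous function equal to 1 on \<open>S\<close>: the integrability lemma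
    for weighted functions takes continuous multipliers, so the indicator is reached by
    domination.\<close>
  let ?g = "\<lambda>z. complex_of_real (max 0 (min 1 (R + 1 - cmod z)))"
  show ?thesis
  proof (rule Bochner_Integration.integrable_bound)
    show "integrable lborel (\<lambda>z. w z * ?g z)"
    proof (rule borel_weighted_L2_integrable_compact_support[OF w])
      show "continuous_on UNIV ?g" by (intro continuous_intros)
      show "cmod z \<le> R + 1" if "?g z \<noteq> 0" for z
        using that by (auto simp: max_def min_def split: if_splits)
    qed
    show "(\<lambda>z. indicator S z *\<^sub>R w z) \<in> borel_measurable lborel"
      by (rule borel_measurable_scaleR, rule borel_measurable_indicator)
        (use w S in \<open>auto simp: borel_weighted_L2_def\<close>)
    show "AE z in lborel. norm (indicator S z *\<^sub>R w z) \<le> norm (w z * ?g z)"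
      using R by (intro AE_I2) (auto simp: indicator_def norm_mult)
  qed
qed

section \<open>The distributional Liouville argument\<close>

lemma dbar_kernel_orthogonal_test_functions:
  assumes w: "borel_weighted_L2 1 w"
    and eq: "\<And>\<phi>. \<phi> \<in> test_functions \<Longrightarrow> (LINT z|lborel. w z * dbar \<phi> z) = 0"
    and \<psi>: "\<psi> \<in> test_functions"
  shows "(LINT z|lborel. w z * \<psi> z) = 0"
proof -
  obtain R where s: "smooth \<psi>" and R: "\<And>z. \<psi> z \<noteq> 0 \<Longrightarrow> cmod z \<le> R"
    and "\<And>z. dbar \<psi> z \<noteq> 0 \<Longrightarrow> cmod z \<le> R"
    using test_functionE[OF \<psi>] by blast
  note c = smooth_continuous[OF s, of UNIV]
  have [measurable]: "w \<in> borel_measurable borel" using w by (simp add: borel_weighted_L2_def)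
  have [measurable]: "\<psi> \<in> borel_measurable borel" by (rule borel_measurable_continuous_onI[OF c])
  have [measurable]: "cutoff n \<in> borel_measurable borel" for n
    by (rule borel_measurable_continuous_onI[OF smooth_continuous[OF smooth_cutoff]])
  have cut0: "dbar (cutoff n) z = 0" if "\<not> cmod z \<le> real (Suc n)" for n z
    using dbar_support[OF smooth_cutoff[of n] cutoff_support[of n]] that by blast
  let ?N = "cauchy_conv \<psi>"
  have sN: "smooth ?N" unfolding smooth_def using cauchy_conv_C_k[OF s R] by blast
  have dN: "dbar ?N z = of_real cauchy_const * \<psi> z" for z
    by (rule dbar_cauchy_conv[OF s]) (rule R)
  note cN = smooth_continuous[OF sN, of UNIV]
  obtain C where C: "0 \<le> C" "\<And>z. cmod (?N z) \<le> C / bracket z" using cauchy_conv_decay[OF c R] by blast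
  have wi: "integrable lborel (\<lambda>z. w z * \<psi> z)" by (rule borel_weighted_L2_integrable_compact_support[OF w c R])
  \<comment> \<open>The cutoffs converge to exp (-1), not to 1; the limit identity is thus scaled by
    a nonzero constant, which is divided out at the end.\<close>
  have 1: "(\<lambda>n. LINT z|lborel. cutoff n z * (w z * \<psi> z)) \<longlonglongrightarrow> (LINT z|lborel. of_real (exp (-1)) * (w z * \<psi> z))"
  proof (rule integral_dominated_convergence[OF _ _ integrable_norm[OF wi]])
    show "AE z in lborel. (\<lambda>n. cutoff n z * (w z * \<psi> z)) \<longlonglongrightarrow> of_real (exp (-1)) * (w z * \<psi> z)"
      by (intro AE_I2 tendsto_intros cutoff_tendsto)
    show "AE z in lborel. norm (cutoff n z * (w z * \<psi> z)) \<le> norm (w z * \<psi> z)" for n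
      unfolding norm_mult[of "cutoff n _"] using cutoff_norm_le by (intro AE_I2 mult_left_le_one_le) auto
  qed measurable
  let ?E = "\<lambda>n. LINT z|lborel. w z * (dbar (cutoff n) z * ?N z)"
  let ?J = "\<lambda>n. LINT z|lborel. indicator (cball 0 (real (Suc n))) z * cmod (w z) / (real (Suc n))\<^sup>2"
  have int2: "integrable lborel (\<lambda>z. w z * (dbar (cutoff n) z * ?N z))" for n
  proof (rule borel_weighted_L2_integrable_compact_support[OF w])
    show "continuous_on UNIV (\<lambda>z. dbar (cutoff n) z * ?N z)"
      by (rule continuous_on_mult[OF smooth_continuous[OF smooth_dbar[OF smooth_cutoff]] cN])
    show "cmod z \<le> real (Suc n)" if "dbar (cutoff n) z * ?N z \<noteq> 0" for z
      using that cut0[of z n] by auto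
  qed
  have int1: "integrable lborel (\<lambda>z. cutoff n z * (w z * \<psi> z))" for n
    by (rule Bochner_Integration.integrable_bound[OF wi])
       (measurable, intro AE_I2, unfold norm_mult[of "cutoff n _"], intro mult_left_le_one_le norm_ge_zero cutoff_norm_le)
  have E: "cmod (?E n) \<le> 2 * C * ?J n" for n
  proof -
    let ?B = "\<lambda>z. 2 * C * (indicator (cball 0 (real (Suc n))) z * cmod (w z) / (real (Suc n))\<^sup>2)"
    have le: "cmod (w z * (dbar (cutoff n) z * ?N z)) \<le> ?B z" for z
    proof (cases "cmod z \<le> real (Suc n)")
      case True
      \<comment> \<open>The growth |z| of the cutoff's derivative meets the decay of the
        convolution, and their product is at most a constant because
        \<open>cmod z \<le> bracket z\<close>.\<close>
      have "cmod (dbar (cutoff n) z * ?N z) \<le> (2 * cmod z / (real (Suc n))\<^sup>2) * (C / bracket z)"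
        unfolding norm_mult by (intro mult_mono dbar_cutoff_norm_le C) auto
      also have "\<dots> = 2 * C / (real (Suc n))\<^sup>2 * (cmod z / bracket z)" by (simp del: of_nat_Suc)
      also have "\<dots> \<le> 2 * C / (real (Suc n))\<^sup>2 * 1"
        using C(1) cmod_le_bracket[of z] by (intro mult_left_mono) (auto simp: divide_le_eq_1)
      finally have "cmod (w z) * cmod (dbar (cutoff n) z * ?N z) \<le> cmod (w z) * (2 * C / (real (Suc n))\<^sup>2)"
        by (intro mult_left_mono) auto
      then show ?thesis using True by (simp add: norm_mult mult_ac del: of_nat_Suc)
    next
      case False
      then have "dbar (cutoff n) z = 0" by (rule cut0)
      then show ?thesis using C(1) by simp
    qed
    have Bi: "integrable lborel ?B"
    proof -
      have "integrable lborel (\<lambda>z. indicator (cball 0 (real (Suc n))) z *\<^sub>R w z)"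
        by (rule borel_weighted_L2_set_integrable[OF w]) auto
      from integrable_mult_right[OF integrable_norm[OF this], of "2 * C / (real (Suc n))\<^sup>2"]
      show ?thesis by (simp add: mult_ac del: of_nat_Suc)
    qed
    have "cmod (?E n) \<le> (LINT z|lborel. cmod (w z * (dbar (cutoff n) z * ?N z)))" by (rule integral_norm_bound)
    also have "\<dots> \<le> (LINT z|lborel. ?B z)" by (rule integral_mono[OF integrable_norm[OF int2] Bi le])
    also have "\<dots> = 2 * C * ?J n" by (rule integral_mult_right_zero)
    finally show ?thesis .
  qed
  have "?E \<longlonglongrightarrow> 0"
  proof (rule Lim_null_comparison)
    show "\<forall>\<^sub>F n in sequentially. norm (?E n) \<le> 2 * C * ?J n" using E by (intro always_eventually allI)
    show "(\<lambda>n. 2 * C * ?J n) \<longlonglongrightarrow> 0" using tendsto_mult[OF tendsto_const average_tendsto_0[OF w], of "2 * C"] by simp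
  qed
  moreover have "?E n = - (of_real cauchy_const * (LINT z|lborel. cutoff n z * (w z * \<psi> z)))" for n
  proof -
    have "(\<lambda>z. cutoff n z * ?N z) \<in> test_functions"
      unfolding test_functions_iff using smooth_mult[OF smooth_cutoff sN] cutoff_support
      by (intro conjI exI[of _ "real (Suc n)"]) auto
    then have "0 = (LINT z|lborel. w z * dbar (\<lambda>z. cutoff n z * ?N z) z)" using eq by simp
    also have "\<dots> = (LINT z|lborel. of_real cauchy_const * (cutoff n z * (w z * \<psi> z)) + w z * (dbar (cutoff n) z * ?N z))"
      by (rule Bochner_Integration.integral_cong[OF refl])
        (simp only: dbar_mult[OF smooth_differentiable[OF smooth_cutoff] smooth_differentiable[OF sN]] dN,
         simp add: algebra_simps)
    also have "\<dots> = (LINT z|lborel. of_real cauchy_const * (cutoff n z * (w z * \<psi> z))) + ?E n"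
      by (rule Bochner_Integration.integral_add[OF integrable_mult_right[OF int1] int2])
    also have "(LINT z|lborel. of_real cauchy_const * (cutoff n z * (w z * \<psi> z))) = of_real cauchy_const * (LINT z|lborel. cutoff n z * (w z * \<psi> z))"
      by (rule integral_mult_right_zero)
    finally show ?thesis by (simp add: eq_neg_iff_add_eq_0 add.commute)
  qed
  ultimately have "(\<lambda>n. - (of_real cauchy_const * (LINT z|lborel. cutoff n z * (w z * \<psi> z)))) \<longlonglongrightarrow> 0" by simp
  moreover have "(\<lambda>n. - (of_real cauchy_const * (LINT z|lborel. cutoff n z * (w z * \<psi> z)))) \<longlonglongrightarrow>
      - (of_real cauchy_const * (LINT z|lborel. of_real (exp (-1)) * (w z * \<psi> z)))"
    by (intro tendsto_intros 1)
  ultimately have "- (of_real cauchy_const * (LINT z|lborel. of_real (exp (-1)) * (w z * \<psi> z))) = 0"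
    by (rule LIMSEQ_unique[symmetric])
  then have "(LINT z|lborel. complex_of_real (exp (-1)) * (w z * \<psi> z)) = 0" using cauchy_const_nonzero by simp
  moreover have "(LINT z|lborel. complex_of_real (exp (-1)) * (w z * \<psi> z)) = of_real (exp (-1)) * (LINT z|lborel. w z * \<psi> z)"
    by (rule integral_mult_right_zero)
  ultimately show ?thesis by simp
qed

section \<open>Test functions detect vanishing almost everywhere\<close>

text \<open>Smooth approximation of the indicator of an open half-plane with \<open>a\<close> on its
  boundary, based on exp (-1/(nt)) tending to 1 for t > 0. The values 1, -1, -\<i> and \<i> of
  \<open>u\<close> give the four sides of a box.\<close>

definition half_plane_step :: "complex \<Rightarrow> complex \<Rightarrow> nat \<Rightarrow> complex \<Rightarrow> complex" where
  "half_plane_step u a n z = of_real (flat 0 (Re (of_nat (Suc n) * (u * (z + - a)))))"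

lemma smooth_half_plane_step: "smooth (half_plane_step u a n)"
proof -
  have "smooth (\<lambda>z. of_nat (Suc n) * (u * (z + - a)))"
    by (intro smooth_add smooth_mult smooth_const smooth_linear bounded_linear_ident)
  then show ?thesis unfolding half_plane_step_def[abs_def] by (rule smooth_flat_compose)
qed

lemma half_plane_step_eq: "half_plane_step u a n z = of_real (flat 0 (real (Suc n) * Re (u * (z - a))))"
  by (simp add: half_plane_step_def)

lemma half_plane_step_nonzero: "half_plane_step u a n z \<noteq> 0 \<Longrightarrow> 0 < Re (u * (z - a))"
  unfolding half_plane_step_eq flat_def by (auto simp: zero_less_mult_iff mult_le_0_iff split: if_splits)

lemma half_plane_step_norm_le: "cmod (half_plane_step u a n z) \<le> 1"
  unfolding half_plane_step_eq norm_of_real using flat_0_le_1 by (simp add: abs_of_nonneg)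

lemma half_plane_step_tendsto:
  "(\<lambda>n. half_plane_step u a n z) \<longlonglongrightarrow> (if 0 < Re (u * (z - a)) then 1 else 0)"
proof (cases "0 < Re (u * (z - a))")
  case True
  define t where "t = Re (u * (z - a))"
  have t: "0 < t" using True by (simp add: t_def)
  have "(\<lambda>n. 1 / real (Suc n)) \<longlonglongrightarrow> 0"
    using LIMSEQ_inverse_real_of_nat by (simp add: inverse_eq_divide)
  then have "(\<lambda>n. exp (- (1 / real (Suc n)) * (1 / t))) \<longlonglongrightarrow> exp (- 0 * (1 / t))" by (intro tendsto_intros)
  moreover have "flat 0 (real (Suc n) * t) = exp (- (1 / real (Suc n)) * (1 / t))" for n
    using t by (simp add: flat_def mult_le_0_iff del: of_nat_Suc)
  ultimately have "(\<lambda>n. flat 0 (real (Suc n) * t)) \<longlonglongrightarrow> 1" by simp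
  then have "(\<lambda>n. complex_of_real (flat 0 (real (Suc n) * t))) \<longlonglongrightarrow> of_real 1" by (rule tendsto_of_real)
  then show ?thesis using True unfolding half_plane_step_eq t_def by simp
next
  case False
  then have "half_plane_step u a n z = 0" for n using half_plane_step_nonzero by blast
  then show ?thesis using False by simp
qed

definition box_bump :: "complex \<Rightarrow> complex \<Rightarrow> nat \<Rightarrow> complex \<Rightarrow> complex" where
  "box_bump a b n z = (half_plane_step 1 a n z * half_plane_step (- 1) b n z) *
     (half_plane_step (- \<i>) a n z * half_plane_step \<i> b n z)"

lemma box_bump_nonzero: "box_bump a b n z \<noteq> 0 \<Longrightarrow> z \<in> box a b"
  unfolding box_bump_def mult_eq_0_iff in_box_complex_iff
  using half_plane_step_nonzero[of 1 a n z] half_plane_step_nonzero[of "- 1" b n z]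
    half_plane_step_nonzero[of "- \<i>" a n z] half_plane_step_nonzero[of \<i> b n z]
  by auto

lemma box_bump_test_function: "box_bump a b n \<in> test_functions"
proof -
  have "smooth (box_bump a b n)"
    unfolding box_bump_def[abs_def] by (intro smooth_mult smooth_half_plane_step)
  moreover obtain R where "0 < R" "\<And>z. z \<in> box a b \<Longrightarrow> cmod z \<le> R"
    using bounded_box[of a b] unfolding bounded_pos by blast
  ultimately show ?thesis unfolding test_functions_iff using box_bump_nonzero by blast
qed

lemma box_bump_tendsto: "(\<lambda>n. box_bump a b n z) \<longlonglongrightarrow> indicator (box a b) z"
proof -
  have "indicator (box a b) z =
    ((if 0 < Re (1 * (z - a)) then 1 else 0) * (if 0 < Re (- 1 * (z - b)) then 1 else 0)) *
    ((if 0 < Re (- \<i> * (z - a)) then 1 else 0) * (if 0 < Re (\<i> * (z - b)) then 1 else (0::complex)))"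
    by (auto simp: indicator_def in_box_complex_iff)
  then show ?thesis
    unfolding box_bump_def by (simp only:) (intro tendsto_mult half_plane_step_tendsto)
qed

lemma box_bump_norm_le: "cmod (box_bump a b n z) \<le> indicator (box a b) z"
proof (cases "box_bump a b n z = 0")
  case False
  have "cmod (box_bump a b n z) \<le> (1 * 1) * (1 * 1)"
    unfolding box_bump_def norm_mult by (intro mult_mono half_plane_step_norm_le) auto
  then show ?thesis using box_bump_nonzero[OF False] by simp
qed simp

lemma integral_box_eq_0:
  assumes w: "borel_weighted_L2 \<theta> w"
    and orth: "\<And>\<psi>. \<psi> \<in> test_functions \<Longrightarrow> (LINT z|lborel. w z * \<psi> z) = 0"
  shows "(LINT z|lborel. indicator (box a b) z *\<^sub>R w z) = 0"
proof -
  have m: "w \<in> borel_measurable lborel" using w by (simp add: borel_weighted_L2_def)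
  have i: "integrable lborel (\<lambda>z. indicator (box a b) z *\<^sub>R w z)"
    by (rule borel_weighted_L2_set_integrable[OF w]) auto
  have "(\<lambda>n. LINT z|lborel. w z * box_bump a b n z) \<longlonglongrightarrow> (LINT z|lborel. indicator (box a b) z *\<^sub>R w z)"
  proof (rule integral_dominated_convergence[OF _ _ integrable_norm[OF i]])
    show "(\<lambda>z. indicator (box a b) z *\<^sub>R w z) \<in> borel_measurable lborel" using i by (rule borel_measurable_integrable)
    show "(\<lambda>z. w z * box_bump a b n z) \<in> borel_measurable lborel" for n
    proof -
      have "smooth (box_bump a b n)" using box_bump_test_function unfolding test_functions_iff by blast
      from borel_measurable_continuous_onI[OF smooth_continuous[OF this]]
      have "box_bump a b n \<in> borel_measurable lborel" by simp
      with m show ?thesis by (rule borel_measurable_times)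
    qed
    show "AE z in lborel. (\<lambda>n. w z * box_bump a b n z) \<longlonglongrightarrow> indicator (box a b) z *\<^sub>R w z"
    proof (rule AE_I2)
      fix z
      have "(\<lambda>n. w z * box_bump a b n z) \<longlonglongrightarrow> w z * indicator (box a b) z" by (intro tendsto_mult tendsto_const box_bump_tendsto)
      also have "w z * indicator (box a b) z = indicator (box a b) z *\<^sub>R w z" by (simp add: indicator_def)
      finally show "(\<lambda>n. w z * box_bump a b n z) \<longlonglongrightarrow> indicator (box a b) z *\<^sub>R w z" .
    qed
    show "AE z in lborel. norm (w z * box_bump a b n z) \<le> norm (indicator (box a b) z *\<^sub>R w z)" for n
    proof (rule AE_I2)
      fix z
      have "norm (w z * box_bump a b n z) \<le> cmod (w z) * indicator (box a b) z"
        unfolding norm_mult by (intro mult_left_mono box_bump_norm_le norm_ge_zero)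
      then show "norm (w z * box_bump a b n z) \<le> norm (indicator (box a b) z *\<^sub>R w z)" by (simp add: mult.commute)
    qed
  qed
  moreover have "(LINT z|lborel. w z * box_bump a b n z) = 0" for n by (rule orth[OF box_bump_test_function])
  ultimately show ?thesis using LIMSEQ_unique[OF _ tendsto_const[of 0]] by simp
qed

text \<open>Boxes are stable under intersection and generate the Borel sets, so a Dynkin argument
  extends vanishing integrals from boxes to all Borel sets. The whole space is not a box;
  \<open>f0\<close> supplies its integral in the complement step.\<close>

lemma AE_eq_0_if_integral_box_eq_0:
  fixes f :: "'a::euclidean_space \<Rightarrow> 'b::{banach, second_countable_topology}"
  assumes f: "integrable lborel f" and f0: "(LINT z|lborel. f z) = 0"
    and box: "\<And>a b. (LINT z:box a b|lborel. f z) = 0"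
  shows "AE z in lborel. f z = 0"
proof (rule sigma_finite_measure.density_zero[OF lborel.sigma_finite_measure_axioms f])
  fix A :: "'a set" assume "A \<in> sets lborel"
  then have A: "A \<in> sigma_sets UNIV (range (\<lambda>(a, b). box a b))"
    by (simp add: borel_eq_box)
  have st: "Int_stable (range (\<lambda>(a, b). box a b :: 'a set))"
    by (auto simp: Int_stable_def box_Int_box)
  have sub: "range (\<lambda>(a, b). box a b :: 'a set) \<subseteq> Pow UNIV" by auto
  from st sub A show "(LINT z:A|lborel. f z) = 0"
  proof (induction rule: sigma_sets_induct_disjoint)
    case (basic A) then show ?case using box by auto
  next
    case empty then show ?case by (simp add: set_lebesgue_integral_def)
  next
    case (compl A)
    then have A: "A \<in> sets lborel" by (simp add: borel_eq_box)
    have i: "integrable lborel (\<lambda>z. indicator A z *\<^sub>R f z)"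
      using f A by (intro integrable_mult_indicator)
    have "(LINT z:(UNIV - A)|lborel. f z) = (LINT z|lborel. f z - indicator A z *\<^sub>R f z)"
      unfolding set_lebesgue_integral_def by (rule Bochner_Integration.integral_cong) (auto simp: indicator_def)
    also have "\<dots> = (LINT z|lborel. f z) - (LINT z:A|lborel. f z)"
      unfolding set_lebesgue_integral_def using f i by simp
    finally show ?case using compl f0 by simp
  next
    case (union A)
    then have A: "\<And>i. A i \<in> sets lborel" by (auto simp: borel_eq_box)
    have "(LINT z:(\<Union>i. A i)|lborel. f z) = (\<Sum>i. (LINT z:(A i)|lborel. f z))"
    proof (rule lebesgue_integral_countable_add)
      show "A i \<in> sets lborel" for i by (rule A)
      show "A i \<inter> A j = {}" if "i \<noteq> j" for i j using union that by (auto simp: disjoint_family_on_def)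
      show "set_integrable lborel (\<Union>i. A i) f"
        unfolding set_integrable_def using f A by (intro integrable_mult_indicator sets.countable_UN) auto
    qed
    then show ?case using union by simp
  qed
qed

text \<open>\<open>w\<close> need not be integrable on the whole plane, so it is first restricted to
  the boxes \<open>?K m\<close>. Intersecting with another box gives a box again, and countably many
  \<open>m\<close> exhaust the plane.\<close>

lemma orthogonal_test_functions_AE_eq_0:
  assumes w: "borel_weighted_L2 \<theta> w"
    and orth: "\<And>\<psi>. \<psi> \<in> test_functions \<Longrightarrow> (LINT z|lborel. w z * \<psi> z) = 0"
  shows "AE z in lborel. w z = 0"
proof -
  let ?K = "\<lambda>m. box (Complex (- real m) (- real m)) (Complex (real m) (real m))"
  have "AE z in lborel. indicator (?K m) z *\<^sub>R w z = 0" for m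
  proof (rule AE_eq_0_if_integral_box_eq_0)
    show "integrable lborel (\<lambda>z. indicator (?K m) z *\<^sub>R w z)"
      by (rule borel_weighted_L2_set_integrable[OF w]) auto
    show "(LINT z|lborel. indicator (?K m) z *\<^sub>R w z) = 0" by (rule integral_box_eq_0[OF w orth])
    fix a b
    obtain c d where cd: "box a b \<inter> ?K m = box c d" unfolding box_Int_box by blast
    have "(LINT z:box a b|lborel. indicator (?K m) z *\<^sub>R w z) = (LINT z|lborel. indicator (box c d) z *\<^sub>R w z)"
      unfolding set_lebesgue_integral_def cd[symmetric]
      by (rule Bochner_Integration.integral_cong) (auto simp: indicator_def)
    also have "\<dots> = 0" by (rule integral_box_eq_0[OF w orth])
    finally show "(LINT z:box a b|lborel. indicator (?K m) z *\<^sub>R w z) = 0" .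
  qed
  then have "AE z in lborel. \<forall>m. indicator (?K m) z *\<^sub>R w z = 0" unfolding AE_all_countable by blast
  then show ?thesis
  proof eventually_elim
    case (elim z)
    obtain m where m: "cmod z < real m" using reals_Archimedean2 by blast
    have "z \<in> ?K m"
      using m abs_Re_le_cmod[of z] abs_Im_le_cmod[of z] by (simp add: in_box_complex_iff) linarith
    then show ?case using elim[rule_format, of m] by simp
  qed
qed

text \<open>The exponent 1 covers all smaller ones, since the weighted spaces grow with the
  exponent.\<close>

lemma borel_solution_unique:
  assumes u: "borel_weighted_L2 1 u" and u': "borel_weighted_L2 1 u'"
    and eq: "\<And>\<phi>. \<phi> \<in> test_functions \<Longrightarrow> (LINT z|lborel. u z * dbar \<phi> z) = (LINT z|lborel. u' z * dbar \<phi> z)"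
  shows "AE z in lborel. u z = u' z"
proof -
  have "borel_weighted_L2 1 (\<lambda>z. - u' z)" using u' by (simp add: borel_weighted_L2_def)
  from borel_weighted_L2_add[OF u this]
  have w: "borel_weighted_L2 1 (\<lambda>z. u z - u' z)" by simp
  have "(LINT z|lborel. (u z - u' z) * dbar \<phi> z) = 0" if \<phi>: "\<phi> \<in> test_functions" for \<phi>
  proof -
    obtain R where s: "smooth \<phi>" and R: "\<And>z. \<phi> z \<noteq> 0 \<Longrightarrow> cmod z \<le> R" "\<And>z. dbar \<phi> z \<noteq> 0 \<Longrightarrow> cmod z \<le> R"
      using test_functionE[OF \<phi>] by blast
    have c: "continuous_on UNIV (dbar \<phi>)" by (rule smooth_continuous[OF smooth_dbar[OF s]])
    have i: "integrable lborel (\<lambda>z. u z * dbar \<phi> z)" "integrable lborel (\<lambda>z. u' z * dbar \<phi> z)"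
      by (rule borel_weighted_L2_integrable_compact_support[OF u c R(2)], assumption)
         (rule borel_weighted_L2_integrable_compact_support[OF u' c R(2)], assumption)
    have "(LINT z|lborel. (u z - u' z) * dbar \<phi> z) = (LINT z|lborel. u z * dbar \<phi> z - u' z * dbar \<phi> z)"
      by (simp only: left_diff_distrib)
    also have "\<dots> = (LINT z|lborel. u z * dbar \<phi> z) - (LINT z|lborel. u' z * dbar \<phi> z)"
      by (rule Bochner_Integration.integral_diff[OF i])
    also have "\<dots> = 0" using eq[OF \<phi>] by simp
    finally show ?thesis .
  qed
  then have "(LINT z|lborel. (u z - u' z) * \<psi> z) = 0" if "\<psi> \<in> test_functions" for \<psi>
    using dbar_kernel_orthogonal_test_functions[OF w _ that] by blast
  then have "AE z in lborel. u z - u' z = 0" by (rule orthogonal_test_functions_AE_eq_0[OF w])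
  then show ?thesis by eventually_elim simp
qed

section \<open>Return from Borel representatives to the weighted spaces\<close>

lemma exists_solution:
  assumes "0 < \<epsilon>" "v \<in> weighted_L2 (\<epsilon> - 2)"
  shows "\<exists>u \<in> weighted_L2 \<epsilon>. dbar_eq u v"
proof -
  obtain v' where v': "borel_weighted_L2 (\<epsilon> - 2) v'" "AE z in lebesgue. v z = v' z"
    by (rule weighted_L2_borel[OF assms(2)])
  obtain n where "\<epsilon> \<le> real n + 1" using real_arch_simple[of "\<epsilon> - 1"] by (auto simp: diff_le_eq)
  from exists_borel_solution[OF assms(1) this v'(1)] obtain u where u: "borel_weighted_L2 \<epsilon> u"
    "\<forall>\<phi>\<in>test_functions. (LINT z|lborel. u z * dbar \<phi> z) = - (LINT z|lborel. v' z * \<phi> z)" by blast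
  have uw: "u \<in> weighted_L2 \<epsilon>" by (rule weighted_L2I[OF u(1)])
  have "dbar_eq u v"
    using u v' dbar_eq_borel_iff[OF _ weighted_L2_measurable[OF uw] _ v'(2) weighted_L2_measurable[OF assms(2)], of u]
    by (simp add: borel_weighted_L2_def)
  with uw show ?thesis by blast
qed

lemma solution_unique:
  assumes \<epsilon>: "\<epsilon> \<le> 1" and v: "v \<in> weighted_L2 \<theta>" and u: "u \<in> weighted_L2 \<epsilon>" and u': "u' \<in> weighted_L2 \<epsilon>"
    and eq: "dbar_eq u v" "dbar_eq u' v"
  shows "AE z in lebesgue. u z = u' z"
proof -
  obtain v0 where v0: "borel_weighted_L2 \<theta> v0" "AE z in lebesgue. v z = v0 z" by (rule weighted_L2_borel[OF v])
  obtain b where b: "borel_weighted_L2 \<epsilon> b" "AE z in lebesgue. u z = b z" by (rule weighted_L2_borel[OF u])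
  obtain b' where b': "borel_weighted_L2 \<epsilon> b'" "AE z in lebesgue. u' z = b' z" by (rule weighted_L2_borel[OF u'])
  have m: "v0 \<in> borel_measurable borel" "b \<in> borel_measurable borel" "b' \<in> borel_measurable borel"
    using v0 b b' by (simp_all add: borel_weighted_L2_def)
  note iff = dbar_eq_borel_iff[OF _ _ _ v0(2) weighted_L2_measurable[OF v] m(1)]
  have "(LINT z|lborel. b z * dbar \<phi> z) = (LINT z|lborel. b' z * dbar \<phi> z)" if "\<phi> \<in> test_functions" for \<phi>
    using eq[unfolded iff[OF b(2) weighted_L2_measurable[OF u] m(2)] iff[OF b'(2) weighted_L2_measurable[OF u'] m(3)]] that
    by simp
  then have "AE z in lborel. b z = b' z"
    by (rule borel_solution_unique[OF borel_weighted_L2_mono[OF b(1) \<epsilon>] borel_weighted_L2_mono[OF b'(1) \<epsilon>]])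
  then have "AE z in lebesgue. b z = b' z" by (rule AE_completion)
  with b(2) b'(2) show ?thesis by eventually_elim simp
qed

theorem proposition2p2:
  shows "(\<forall>\<epsilon>::real. 0 < \<epsilon> \<longrightarrow>
            (\<forall>v \<in> weighted_L2 (\<epsilon> - 2). \<exists>u \<in> weighted_L2 \<epsilon>. dbar_eq u v)) \<and>
         (\<forall>\<epsilon>::real. 0 < \<epsilon> \<and> \<epsilon> \<le> 1 \<longrightarrow>
            (\<forall>v \<in> weighted_L2 (\<epsilon> - 2).
              \<forall>u \<in> weighted_L2 \<epsilon>. \<forall>u' \<in> weighted_L2 \<epsilon>.
                dbar_eq u v \<and> dbar_eq u' v \<longrightarrow> (AE z in lebesgue. u z = u' z)))"
proof (intro conjI allI ballI impI)
  fix \<epsilon> :: real and v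
  assume "0 < \<epsilon>" "v \<in> weighted_L2 (\<epsilon> - 2)"
  then show "\<exists>u\<in>weighted_L2 \<epsilon>. dbar_eq u v" by (rule exists_solution)
next
  fix \<epsilon> :: real and v u u'
  assume "0 < \<epsilon> \<and> \<epsilon> \<le> 1" and v: "v \<in> weighted_L2 (\<epsilon> - 2)" and u: "u \<in> weighted_L2 \<epsilon>" "u' \<in> weighted_L2 \<epsilon>"
    and eq: "dbar_eq u v \<and> dbar_eq u' v"
  then have "\<epsilon> \<le> 1" by simp
  from solution_unique[OF this v u] eq show "AE z in lebesgue. u z = u' z" by blast
qed

end
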